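(* Let $\mathbf{F}_q$ be a finite field, and let $C$ and $D$ be similarity classes of $\mathrm{Mat}_n(\mathbf{F}_q)$. The classes $C$ and $D$ have the same class type if and only if $C$ and $D$ are polynomial in one another (that is, $D$ is polynomial in $C$ and $C$ is polynomial in $D$).
   Context: A partition is a weakly decreasing finite sequence of positive integers $\lambda=(\lambda(1),\lambda(2),\dots)$, whose terms are its parts. Let $K$ be a field and $M\in\mathrm{Mat}_n(K)$. Let $f_1,\dots,f_t$ be the distinct monic irreducible factors over $K$ of the characteristic polynomial of $M$. For each $i$, let $\lambda_i$ be the partition such that the $f_i$-primary component of the $K[x]$-module $K^n$ (with $x$ acting as $M$) is isomorphic to $\bigoplus_j K[x]/(f_i^{\lambda_i(j)})$. The cycle type of $M$ is the formal expression $f_1^{\lambda_1}\cdots f_t^{\lambda_t}$, and the class type of $M$ is the formal string $\mathrm{ty}(M)=d_1^{\lambda_1}\cdots d_t^{\lambda_t}$, where $d_i=\deg f_i$; the order of the terms is unimportant (so the class type is the multiset of pairs $(d_i,\lambda_i)$). Similar matrices have the same class type, so the class type of a similarity class is well defined. For similarity classes $C,D$ of $\mathrm{Mat}_n(\mathbf{F}_q)$, $D$ is polynomial in $C$ if there exists a polynomial $F\in\mathbf{F}_q[x]$ such that $F(X)\in D$ for all $X\in C$. *)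

theory Defs
  imports
    "Jordan_Normal_Form.Char_Poly"
    "Jordan_Normal_Form.VS_Connect"
    "HOL-Algebra.QuotRing"
    "HOL-Library.FuncSet"
    "HOL-Library.Multiset"
begin

section \<open>Polynomials evaluated at matrices, similarity classes\<close>

(* F(A) = \<Sum>k. coeff F k * A^k, written entrywise *)
definition poly_mat :: "'a::comm_ring_1 poly \<Rightarrow> 'a mat \<Rightarrow> 'a mat" where
  "poly_mat F A = mat (dim_row A) (dim_row A)
     (\<lambda>(i, j). \<Sum>k\<le>degree F. coeff F k * (A ^\<^sub>m k) $$ (i, j))"

definition similarity_classes :: "nat \<Rightarrow> 'a::field mat set set" where
  "similarity_classes n =
     carrier_mat n n // {(A, B) \<in> carrier_mat n n \<times> carrier_mat n n. similar_mat A B}"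

definition polynomial_in :: "'a::field mat set \<Rightarrow> 'a mat set \<Rightarrow> bool"
    (infix \<open>polynomial'_in\<close> 50) where
  "D polynomial_in C \<longleftrightarrow> (\<exists>F::'a poly. \<forall>X\<in>C. poly_mat F X \<in> D)"


section \<open>Modules\<close>

text \<open>
  Modules are records of \<^theory>\<open>HOL-Algebra.Module\<close>; their multiplicative fields carry
  no meaning. The ring \<open>K[x]\<close> is \<open>class_ring\<close> at type \<open>'a poly\<close>.
\<close>

definition module_isomorphic ::
  "('r, 'c) ring_scheme \<Rightarrow> ('r, 'm, 'd) module_scheme \<Rightarrow> ('r, 'k, 'e) module_scheme \<Rightarrow> bool" where
  "module_isomorphic R M N \<longleftrightarrow> (\<exists>h\<in>module_hom R M N. bij_betw h (carrier M) (carrier N))"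

definition quotient_module :: "('r, 'c) ring_scheme \<Rightarrow> 'r set \<Rightarrow> ('r, 'r set) module" where
  "quotient_module R I = \<lparr>
     carrier = carrier (R Quot I),
     mult = mult (R Quot I),
     one = one (R Quot I),
     zero = zero (R Quot I),
     add = add (R Quot I),
     smult = (\<lambda>r X. (I +>\<^bsub>R\<^esub> r) \<otimes>\<^bsub>R Quot I\<^esub> X)\<rparr>"

definition direct_sum_modules :: "('r, 'm) module list \<Rightarrow> ('r, nat \<Rightarrow> 'm) module" where
  "direct_sum_modules Ms = \<lparr>
     carrier = (\<Pi>\<^sub>E j\<in>{..<length Ms}. carrier (Ms ! j)),
     mult = undefined,
     one = undefined,
     zero = (\<lambda>j\<in>{..<length Ms}. \<zero>\<^bsub>Ms ! j\<^esub>),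
     add = (\<lambda>x y. \<lambda>j\<in>{..<length Ms}. x j \<oplus>\<^bsub>Ms ! j\<^esub> y j),
     smult = (\<lambda>r x. \<lambda>j\<in>{..<length Ms}. r \<odot>\<^bsub>Ms ! j\<^esub> x j)\<rparr>"

(* the K[x]-module K^n on which x acts as A *)
definition mat_module :: "'a::field mat \<Rightarrow> ('a poly, 'a vec) module" where
  "mat_module A = \<lparr>
     carrier = carrier_vec (dim_row A),
     mult = undefined,
     one = undefined,
     zero = 0\<^sub>v (dim_row A),
     add = (+),
     smult = (\<lambda>F v. poly_mat F A *\<^sub>v v)\<rparr>"

definition primary_component ::
  "'r::comm_ring_1 \<Rightarrow> ('r, 'm) module \<Rightarrow> ('r, 'm) module" where
  "primary_component f M = M\<lparr>carrier := {v \<in> carrier M. \<exists>k. (f ^ k) \<odot>\<^bsub>M\<^esub> v = \<zero>\<^bsub>M\<^esub>}\<rparr>"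


section \<open>Cycle type and class type\<close>

definition is_partition :: "nat list \<Rightarrow> bool" where
  "is_partition l \<longleftrightarrow> sorted_wrt (\<ge>) l \<and> (\<forall>k\<in>set l. 0 < k)"

definition primary_partition :: "'a::field mat \<Rightarrow> 'a poly \<Rightarrow> nat list" where
  "primary_partition A f = (THE l. is_partition l \<and>
     module_isomorphic class_ring
       (primary_component f (mat_module A))
       (direct_sum_modules
         (map (\<lambda>k. quotient_module class_ring (PIdl\<^bsub>class_ring\<^esub> (f ^ k))) l)))"

definition cycle_type :: "'a::field mat \<Rightarrow> ('a poly \<times> nat list) set" where
  "cycle_type A = (\<lambda>f. (f, primary_partition A f)) `
     {f. monic f \<and> irreducible f \<and> f dvd char_poly A}"

definition class_type :: "'a::field mat \<Rightarrow> (nat \<times> nat list) multiset" where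
  "class_type A = image_mset (\<lambda>(f, l). (degree f, l)) (mset_set (cycle_type A))"

(* meaningful for similarity classes, on which class_type is constant: class_type_similar below *)
definition class_type_of_class :: "'a::field mat set \<Rightarrow> (nat \<times> nat list) multiset" where
  "class_type_of_class C = the_elem (class_type ` C)"


section \<open>The class type of a similarity class is well defined\<close>

lemma finite_cycle_type:
  fixes A :: "'a::{field,finite} mat"
  assumes "A \<in> carrier_mat n n"
  shows "finite (cycle_type A)"
proof -
  let ?S = "{f. monic f \<and> irreducible f \<and> f dvd char_poly A}"
  have nz: "degree (char_poly A) = n" "char_poly A \<noteq> 0"
    using degree_monic_char_poly[OF assms] by auto
  have "coeffs ` ?S \<subseteq> {xs. set xs \<subseteq> UNIV \<and> length xs \<le> Suc n}"
    using nz by (auto simp: length_coeffs dest!: dvd_imp_degree_le)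
  then have "finite (coeffs ` ?S)"
    by (rule finite_subset) (rule finite_lists_length_le, simp)
  then have "finite ?S"
    by (rule finite_imageD) (auto simp: inj_on_def coeffs_eq_iff)
  then show ?thesis by (simp add: cycle_type_def)
qed

lemma poly_mat_carrier [simp]: "A \<in> carrier_mat n n \<Longrightarrow> poly_mat F A \<in> carrier_mat n n"
  by (auto simp: poly_mat_def)

lemma poly_mat_similar:
  assumes "similar_mat_wit A B P Q" "A \<in> carrier_mat n n"
  shows "poly_mat F A = P * poly_mat F B * Q"
proof -
  note w = similar_mat_witD2[OF assms(2,1)]
  have conj: "(P * X * Q) $$ (i, j) = (\<Sum>a<n. \<Sum>b<n. P $$ (i, a) * X $$ (a, b) * Q $$ (b, j))"
    if "i < n" "j < n" "X \<in> carrier_mat n n" for X i j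
    using that w by (auto simp: scalar_prod_def sum_distrib_left mult.assoc lessThan_atLeast0)
  show ?thesis
  proof (rule eq_matI)
    fix i j assume "i < dim_row (P * poly_mat F B * Q)" "j < dim_col (P * poly_mat F B * Q)"
    then have ij: "i < n" "j < n" using w by auto
    have pB: "(B ^\<^sub>m k) \<in> carrier_mat n n" for k using w by auto
    have "poly_mat F A $$ (i, j) = (\<Sum>k\<le>degree F. coeff F k * (P * B ^\<^sub>m k * Q) $$ (i, j))"
      using ij w similar_mat_wit_pow_id[OF assms(1)] by (auto simp: poly_mat_def)
    also have "\<dots> = (\<Sum>k\<le>degree F. \<Sum>a<n. \<Sum>b<n.
        P $$ (i, a) * (coeff F k * (B ^\<^sub>m k) $$ (a, b)) * Q $$ (b, j))"
      using ij by (simp add: conj[OF _ _ pB] sum_distrib_left mult_ac)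
    also have "\<dots> = (\<Sum>a<n. \<Sum>b<n. \<Sum>k\<le>degree F.
        P $$ (i, a) * (coeff F k * (B ^\<^sub>m k) $$ (a, b)) * Q $$ (b, j))"
      by (subst sum.swap, rule sum.cong[OF refl], subst sum.swap, rule refl)
    also have "\<dots> = (\<Sum>a<n. \<Sum>b<n. P $$ (i, a) * poly_mat F B $$ (a, b) * Q $$ (b, j))"
      using w by (auto simp: poly_mat_def sum_distrib_left sum_distrib_right intro!: sum.cong)
    also have "\<dots> = (P * poly_mat F B * Q) $$ (i, j)"
      using ij w by (intro conj[symmetric]) (simp_all add: poly_mat_def)
    finally show "poly_mat F A $$ (i, j) = (P * poly_mat F B * Q) $$ (i, j)" .
  qed (use w in \<open>auto simp: poly_mat_def\<close>)
qed

lemma primary_component_similar: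
  fixes A B :: "'a::field mat"
  assumes "similar_mat A B"
    and "module_isomorphic class_ring (primary_component f (mat_module A)) N"
  shows "module_isomorphic class_ring (primary_component f (mat_module B)) N"
proof -
  obtain n where A: "A \<in> carrier_mat n n"
    using similar_matD[OF assms(1)] by blast
  obtain P Q where wit: "similar_mat_wit A B P Q"
    using assms(1) by (auto simp: similar_mat_def)
  note w = similar_mat_witD2[OF A wit]
  let ?MA = "primary_component f (mat_module A)" and ?MB = "primary_component f (mat_module B)"
  obtain h where h: "h \<in> module_hom class_ring ?MA N" "bij_betw h (carrier ?MA) (carrier N)"
    using assms(2) by (auto simp: module_isomorphic_def)
  have QP: "Q *\<^sub>v (P *\<^sub>v v) = v" "P *\<^sub>v (Q *\<^sub>v v) = v" if "v \<in> carrier_vec n" for v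
    using that w by (metis assoc_mult_mat_vec one_mult_mat_vec)+
  have act: "P *\<^sub>v (poly_mat F B *\<^sub>v v) = poly_mat F A *\<^sub>v (P *\<^sub>v v)" if v: "v \<in> carrier_vec n" for F v
  proof -
    have B: "poly_mat F B \<in> carrier_mat n n" using w by simp
    have "poly_mat F A *\<^sub>v (P *\<^sub>v v) = P *\<^sub>v (poly_mat F B *\<^sub>v (Q *\<^sub>v (P *\<^sub>v v)))"
      unfolding poly_mat_similar[OF wit A] using w B v
      by (simp add: assoc_mult_mat_vec[of _ n n _ n])
    then show ?thesis using QP v by simp
  qed
  have act': "poly_mat F B *\<^sub>v (Q *\<^sub>v v) = Q *\<^sub>v (poly_mat F A *\<^sub>v v)" if v: "v \<in> carrier_vec n" for F v
  proof -
    have "Q *\<^sub>v v \<in> carrier_vec n" "poly_mat F B *\<^sub>v (Q *\<^sub>v v) \<in> carrier_vec n"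
      using w v by (simp_all add: mult_mat_vec_carrier[of _ n n])
    from QP(1)[OF this(2)] act[OF this(1), of F] show ?thesis
      using QP(2)[OF v] by simp
  qed
  have zero: "P *\<^sub>v 0\<^sub>v n = 0\<^sub>v n" "Q *\<^sub>v 0\<^sub>v n = 0\<^sub>v n"
    using w by auto
  have dims: "dim_row A = n" "dim_row B = n" using w A by auto
  have cA: "carrier ?MA = {v \<in> carrier_vec n. \<exists>k. poly_mat (f ^ k) A *\<^sub>v v = 0\<^sub>v n}"
    and cB: "carrier ?MB = {v \<in> carrier_vec n. \<exists>k. poly_mat (f ^ k) B *\<^sub>v v = 0\<^sub>v n}"
    by (auto simp: primary_component_def mat_module_def dims)
  have into: "P *\<^sub>v v \<in> carrier ?MA" if vB: "v \<in> carrier ?MB" for v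
  proof -
    obtain k where v: "v \<in> carrier_vec n" and k: "poly_mat (f ^ k) B *\<^sub>v v = 0\<^sub>v n"
      using vB unfolding cB by blast
    have "poly_mat (f ^ k) A *\<^sub>v (P *\<^sub>v v) = 0\<^sub>v n"
      using act[OF v, of "f ^ k"] k zero(1) by simp
    then show ?thesis unfolding cA using w(6) v mult_mat_vec_carrier by blast
  qed
  have outof: "Q *\<^sub>v v \<in> carrier ?MB" if vA: "v \<in> carrier ?MA" for v
  proof -
    obtain k where v: "v \<in> carrier_vec n" and k: "poly_mat (f ^ k) A *\<^sub>v v = 0\<^sub>v n"
      using vA unfolding cA by blast
    have "poly_mat (f ^ k) B *\<^sub>v (Q *\<^sub>v v) = 0\<^sub>v n"
      using act'[OF v, of "f ^ k"] k zero(2) by simp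
    then show ?thesis unfolding cB using w(7) v mult_mat_vec_carrier by blast
  qed
  have bij: "bij_betw (\<lambda>v. P *\<^sub>v v) (carrier ?MB) (carrier ?MA)"
  proof (rule bij_betw_byWitness[of _ "\<lambda>v. Q *\<^sub>v v"])
    show "\<forall>v\<in>carrier ?MB. Q *\<^sub>v (P *\<^sub>v v) = v"
      using QP(1) unfolding cB by blast
    show "\<forall>v\<in>carrier ?MA. P *\<^sub>v (Q *\<^sub>v v) = v"
      using QP(2) unfolding cA by blast
  qed (use into outof in blast)+
  have addA: "add ?MA = (+)" "add ?MB = (+)"
    and smA: "smult ?MA = (\<lambda>F v. poly_mat F A *\<^sub>v v)" "smult ?MB = (\<lambda>F v. poly_mat F B *\<^sub>v v)"
    by (auto simp: primary_component_def mat_module_def)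
  have "h \<circ> (\<lambda>v. P *\<^sub>v v) \<in> module_hom class_ring ?MB N"
    unfolding module_hom_def
  proof (intro CollectI conjI allI impI)
    show "h \<circ> (\<lambda>v. P *\<^sub>v v) \<in> carrier ?MB \<rightarrow> carrier N"
      using into h(1) by (auto simp: module_hom_def)
  next
    fix u v assume uv: "u \<in> carrier ?MB \<and> v \<in> carrier ?MB"
    then have "u \<in> carrier_vec n" "v \<in> carrier_vec n" by (auto simp: cB)
    then have "P *\<^sub>v (u + v) = P *\<^sub>v u + P *\<^sub>v v"
      using w by (metis mult_add_distrib_mat_vec)
    then show "(h \<circ> (\<lambda>v. P *\<^sub>v v)) (u \<oplus>\<^bsub>?MB\<^esub> v) =
        (h \<circ> (\<lambda>v. P *\<^sub>v v)) u \<oplus>\<^bsub>N\<^esub> (h \<circ> (\<lambda>v. P *\<^sub>v v)) v"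
      using module_hom_add[OF h(1)] into uv by (simp add: addA)
  next
    fix F :: "'a poly" and v assume Fv: "F \<in> carrier class_ring \<and> v \<in> carrier ?MB"
    then have "v \<in> carrier_vec n" by (auto simp: cB)
    then show "(h \<circ> (\<lambda>v. P *\<^sub>v v)) (F \<odot>\<^bsub>?MB\<^esub> v) = F \<odot>\<^bsub>N\<^esub> (h \<circ> (\<lambda>v. P *\<^sub>v v)) v"
      using module_hom_smult[OF h(1)] into Fv by (simp add: act smA)
  qed
  moreover have "bij_betw (h \<circ> (\<lambda>v. P *\<^sub>v v)) (carrier ?MB) (carrier N)"
    using bij h(2) by (rule bij_betw_trans)
  ultimately show ?thesis by (auto simp: module_isomorphic_def)
qed

lemma class_type_similar:
  fixes A B :: "'a::field mat"
  assumes "similar_mat A B"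
  shows "class_type A = class_type B"
proof -
  have "module_isomorphic class_ring (primary_component f (mat_module A)) N \<longleftrightarrow>
      module_isomorphic class_ring (primary_component f (mat_module B)) N"
    for f and N :: "('a poly, nat \<Rightarrow> 'a poly set) module"
    using primary_component_similar[OF assms]
      primary_component_similar[OF similar_mat_sym[OF assms]] by (rule iffI)
  then have "primary_partition A f = primary_partition B f" for f
    unfolding primary_partition_def by (simp only:)
  then show ?thesis
    by (simp add: class_type_def cycle_type_def char_poly_similar[OF assms])
qed

lemma class_type_of_class:
  assumes "C \<in> similarity_classes n" "A \<in> C"
  shows "class_type_of_class C = class_type A"
proof -
  have "class_type ` C = {class_type A}"
    using assms by (auto simp: similarity_classes_def quotient_def
      intro: class_type_similar similar_mat_trans similar_mat_sym)
  then show ?thesis by (simp add: class_type_of_class_def)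
qed

end

(* A finite K[x]-module M is determined up to isomorphism by the cardinalities of the kernels of f^j,
   f irreducible: a cyclic submodule generated by an element of maximal f-power order is a direct
   summand, and the order of that element can be read off from the kernels. Hence both the similarity
   class of A and the partition attached to a prime factor f of its characteristic polynomial are
   encoded by the numbers |ker f(A)^j|.

   If A and F(A) are polynomials in one another, each ker f(A)^j equals ker g(F(A))^j for a unique
   prime factor g of the characteristic polynomial of F(A), and deg f = deg g because a vector
   killed by f(A) generates the same cyclic subspace under A and under F(A). When only the classes
   are polynomial in one another, comparing the sizes of the algebras K[A], K[F(A)] and K[G(F(A))]
   shows that A is a polynomial in F(A).

   Conversely, let f be matched with s(f) of the same degree. As K is finite, s(f) has a root in
   K[x]/(f), which can be chosen such that f divides s(f)(p) exactly once. Gluing these p modulo f^2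
   by the Chinese remainder theorem gives F with ker s(f)(F(A))^j = ker f(A)^j for all f and j. *)

theory Submission
  imports
    Defs
    "HOL-Library.Function_Algebras"
    "HOL-Library.Cardinality"
    "HOL-Algebra.Algebraic_Closure_Type"
begin

no_notation fps_nth (infixl \<open>$\<close> 75)

hide_const (open) Divisibility.irreducible Divisibility.prime Polynomials.degree Polynomials.lead_coeff
  up_ring.monom up_ring.coeff
hide_fact (open) Divisibility.irreducibleI Divisibility.irreducibleD Divisibility.irreducibleE

section \<open>Polynomials over a field\<close>

text \<open>Cardinalities play the part of dimensions: with q = |K|, the kernel of f(A)^j has q^(deg
  f * sum of min(j,k)) elements, the sum running over the parts k attached to f. Since q > 1, these
  numbers give back the partition, and in a direct sum they multiply, so that a common cyclic
  summand of two modules can be cancelled.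

  The prime f must divide s(f)(F) exactly once. Otherwise ker s(f)(F(A)) contains ker f(A)^2, which
  is larger than ker f(A) as soon as some part exceeds 1. Exactness is possible because irreducible
  polynomials over a finite field are separable, and it is a condition on F modulo f^2 only, whence
  the squares in the remainder theorem.

  If only the classes are polynomial in one another, G(F(A)) is similar to A but need not equal A,
  so G need not invert F on A; this is why algebras are compared by size.

  The abstract modules live on a whole type, but K^n depends on n. Vectors are therefore functions
  on nat, and statements are relative to an invariant subset M.\<close>

lemma poly_ideal_principal:
  fixes I :: "'a::field poly set"
  assumes "\<And>p q. p \<in> I \<Longrightarrow> q \<in> I \<Longrightarrow> p + q \<in> I" "\<And>p r. p \<in> I \<Longrightarrow> r * p \<in> I"
    and "p0 \<in> I" "p0 \<noteq> 0"
  obtains g where "g \<in> I" "g \<noteq> 0" "\<And>p. p \<in> I \<Longrightarrow> g dvd p"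
proof -
  obtain g where g: "g \<in> I" "g \<noteq> 0" "\<And>h. h \<in> I \<Longrightarrow> h \<noteq> 0 \<Longrightarrow> degree g \<le> degree h"
    using ex_has_least_nat[of "\<lambda>g. g \<in> I \<and> g \<noteq> 0" p0 degree] assms(3,4) by auto
  have "g dvd p" if "p \<in> I" for p
  proof -
    have "p mod g = p + (- (p div g)) * g" by (simp add: minus_div_mult_eq_mod[symmetric])
    then have "p mod g \<in> I" using assms(1,2) g(1) that by metis
    then have "p mod g = 0" using g(2) g(3)[of "p mod g"] degree_mod_less[of g p] by linarith
    then show ?thesis by (simp only: dvd_eq_mod_eq_0)
  qed
  then show ?thesis using that g by blast
qed

lemma irreducible_bezout:
  fixes f :: "'a::field poly"
  assumes "irreducible f" "\<not> f dvd c"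
  obtains s t where "s * c + t * f = 1"
proof -
  have "f \<noteq> 0" using assms(1) by auto
  obtain g where g: "g \<in> {s * c + t * f |s t. True}" "g \<noteq> 0"
      "\<And>p. p \<in> {s * c + t * f |s t. True} \<Longrightarrow> g dvd p"
  proof (rule poly_ideal_principal[of "{s * c + t * f |s t. True}" f])
    show "p + q \<in> {s * c + t * f |s t. True}"
      if "p \<in> {s * c + t * f |s t. True}" "q \<in> {s * c + t * f |s t. True}" for p q
    proof -
      obtain s t s' t' where "p = s * c + t * f" "q = s' * c + t' * f" using \<open>p \<in> _\<close> \<open>q \<in> _\<close> by blast
      then have "p + q = (s + s') * c + (t + t') * f" by (simp add: algebra_simps)
      then show ?thesis by blast
    qed
    show "r * p \<in> {s * c + t * f |s t. True}"
      if "p \<in> {s * c + t * f |s t. True}" for p r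
    proof -
      obtain s t where "p = s * c + t * f" using \<open>p \<in> _\<close> by blast
      then have "r * p = (r * s) * c + (r * t) * f" by (simp add: algebra_simps)
      then show ?thesis by blast
    qed
    show "f \<in> {s * c + t * f |s t. True}" by (rule CollectI, rule exI[of _ 0], rule exI[of _ 1]) simp
  qed (use \<open>f \<noteq> 0\<close> in auto)
  have "f = 0 * c + 1 * f" "c = 1 * c + 0 * f" by simp_all
  then have gf: "g dvd f" and gc: "g dvd c" using g(3) by blast+
  \<comment> \<open>A non-unit divisor of the irreducible \<open>f\<close> is a multiple of
    \<open>f\<close>, which would make \<open>f\<close> divide \<open>c\<close>.\<close>
  have "g dvd 1" using assms gf gc irreducibleD' dvd_trans by blast
  then obtain u where "1 = g * u" by (rule dvdE)
  moreover obtain s t where "g = s * c + t * f" using g(1) by blast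
  ultimately have "(u * s) * c + (u * t) * f = 1" by (simp add: algebra_simps)
  then show ?thesis using that by blast
qed

lemma irreducible_power_bezout:
  fixes f :: "'a::field poly"
  assumes "irreducible f" "\<not> f dvd c"
  shows "\<exists>s t. s * c + t * f ^ m = 1"
proof (induction m)
  case 0
  show ?case by (rule exI[of _ 0], rule exI[of _ 1]) simp
next
  case (Suc m)
  then obtain s t where st: "s * c + t * f ^ m = 1" by blast
  obtain s' t' where st': "s' * c + t' * f = 1" using irreducible_bezout[OF assms] .
  \<comment> \<open>In the product of the two identities, \<open>t * f ^ m * t' * f\<close> is the
    only term without a factor \<open>c\<close>.\<close>
  have "1 = (s * c + t * f ^ m) * (s' * c + t' * f)" using st st' by simp
  also have "\<dots> = (s * (s' * c + t' * f) + t * f ^ m * s') * c + (t * t') * f ^ Suc m"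
    by (simp add: algebra_simps)
  finally show ?case by metis
qed

text \<open>A nonconstant divisor of least degree is irreducible, since each factor of it is
  constant or of full degree.\<close>

lemma exists_irreducible_factor:
  fixes p :: "'a::field poly"
  assumes "p \<noteq> 0" "\<not> is_unit p"
  obtains f where "irreducible f" "monic f" "f dvd p"
proof -
  have "degree p \<noteq> 0" using assms is_unit_iff_degree by blast
  obtain g where g: "g dvd p" "degree g \<noteq> 0"
    and least: "\<And>h. h dvd p \<Longrightarrow> degree h \<noteq> 0 \<Longrightarrow> degree g \<le> degree h"
    using ex_has_least_nat[of "\<lambda>g. g dvd p \<and> degree g \<noteq> 0" p degree] \<open>degree p \<noteq> 0\<close> by auto
  have "g \<noteq> 0" using g(2) by auto
  have "irreducible g"
  proof (rule irreducibleI)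
    fix a b assume ab: "g = a * b"
    have nz: "a \<noteq> 0" "b \<noteq> 0" using ab \<open>g \<noteq> 0\<close> by auto
    have "a dvd p" "b dvd p" using ab g(1) dvd_trans by fastforce+
    then have "degree a = 0 \<or> degree g \<le> degree a" "degree b = 0 \<or> degree g \<le> degree b"
      using least by blast+
    moreover have "degree g = degree a + degree b" using nz ab by (simp add: degree_mult_eq)
    ultimately have "degree a = 0 \<or> degree b = 0" by auto
    then show "is_unit a \<or> is_unit b" using nz is_unit_iff_degree by blast
  qed (use g(2) \<open>g \<noteq> 0\<close> is_unit_iff_degree in auto)
  let ?c = "inverse (lead_coeff g)"
  have c: "?c \<noteq> 0" using \<open>g \<noteq> 0\<close> by simp
  show ?thesis
  proof (rule that[of "Polynomial.smult ?c g"])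
    show "irreducible (Polynomial.smult ?c g)"
      using \<open>irreducible g\<close> irreducible_mult_unit_left[of "[:?c:]" g] c is_unit_iff_degree[of "[:?c:]"] by simp
    show "monic (Polynomial.smult ?c g)" using \<open>g \<noteq> 0\<close> by simp
    show "Polynomial.smult ?c g dvd p" using g(1) c by (simp add: smult_dvd_iff)
  qed
qed

lemma monic_irreducible_dvd_eq:
  fixes f g :: "'a::field poly"
  assumes "irreducible f" "irreducible g" "monic f" "monic g" "f dvd g"
  shows "f = g"
proof -
  have "g dvd f" using assms(1,2,5) irreducibleD'[OF assms(2,5)] irreducible_not_unit by blast
  then show ?thesis using assms(3-5) by (intro poly_dvd_antisym) auto
qed

lemma degree_irreducible_pos: "irreducible (f :: 'a::field poly) \<Longrightarrow> degree f > 0"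
  using is_unit_iff_degree[of f] irreducible_not_unit[of f] by (cases "f = 0") auto

lemma extract_power:
  fixes f p :: "'a::field poly"
  assumes "p \<noteq> 0" "irreducible f"
  obtains k u where "p = f ^ k * u" "\<not> f dvd u"
proof -
  have "\<exists>k u. p = f ^ k * u \<and> \<not> f dvd u" using assms(1)
  proof (induction "degree p" arbitrary: p rule: less_induct)
    case less
    show ?case
    proof (cases "f dvd p")
      case False
      then show ?thesis by (intro exI[of _ 0] exI[of _ p]) simp
    next
      case True
      then obtain q where q: "p = f * q" by (elim dvdE)
      then have "degree p = degree f + degree q" using less.prems by (simp add: degree_mult_eq)
      then obtain k u where "q = f ^ k * u" "\<not> f dvd u"
        using less.hyps[of q] degree_irreducible_pos[OF assms(2)] q less.prems by auto
      then show ?thesis using q by (intro exI[of _ "Suc k"] exI[of _ u]) (simp add: mult.assoc)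
    qed
  qed
  then show ?thesis using that by blast
qed

text \<open>The disjunct \<open>p = 0\<close> matters at \<open>d = 0\<close>: the zero polynomial
  has degree 0, yet it must be counted. A polynomial is encoded by its first \<open>d\<close>
  coefficients.\<close>

lemma card_poly_degree_less:
  "card {p :: 'a::{zero,finite} poly. p = 0 \<or> degree p < d} = CARD('a) ^ d"
  "finite {p :: 'a::{zero,finite} poly. p = 0 \<or> degree p < d}"
proof -
  let ?P = "{p :: 'a poly. p = 0 \<or> degree p < d}"
  let ?L = "{xs :: 'a list. set xs \<subseteq> UNIV \<and> length xs = d}"
  have bij: "bij_betw (\<lambda>p. map (coeff p) [0..<d]) ?P ?L"
  proof (rule bij_betw_byWitness[of _ Poly])
    show "\<forall>p\<in>?P. Poly (map (coeff p) [0..<d]) = p"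
      by (auto simp: poly_eq_iff coeff_Poly nth_default_def coeff_eq_0)
    show "\<forall>xs\<in>?L. map (coeff (Poly xs)) [0..<d] = xs"
      by (auto intro!: nth_equalityI simp: coeff_Poly nth_default_def)
    show "Poly ` ?L \<subseteq> ?P"
    proof (rule image_subsetI)
      fix xs assume "xs \<in> ?L"
      then have "coeff (Poly xs) m = 0" if "m \<ge> d" for m
        using that by (auto simp: coeff_Poly nth_default_def)
      then have "d \<le> degree (Poly xs) \<Longrightarrow> lead_coeff (Poly xs) = 0" by blast
      then show "Poly xs \<in> ?P" unfolding leading_coeff_0_iff mem_Collect_eq by linarith
    qed
  qed auto
  show "card ?P = CARD('a) ^ d"
    using bij_betw_same_card[OF bij] card_lists_length_eq[of "UNIV :: 'a set" d] by simp
  show "finite ?P"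
    unfolding bij_betw_finite[OF bij] by (rule finite_lists_length_eq) simp
qed

text \<open>The kernel of \<open>f^j\<close> on a cyclic module with annihilator \<open>f^k\<close>, where \<open>e\<close> is the
  quotient map from the polynomial ring onto that module.\<close>

lemma card_cyclic_kernel:
  fixes f :: "'a::{field,finite} poly" and e :: "'a poly \<Rightarrow> 'b"
  assumes f: "f \<noteq> 0" and e: "\<And>p q. e p = e q \<longleftrightarrow> f ^ k dvd p - q"
  shows "card (e ` {p. f ^ k dvd f ^ j * p}) = CARD('a) ^ (degree f * min j k)"
proof -
  let ?m = "min j k"
  let ?R = "{r :: 'a poly. r = 0 \<or> degree r < degree f * ?m}"
  have fk: "f ^ k = f ^ ?m * f ^ (k - ?m)" by (metis le_add_diff_inverse min.cobounded2 power_add)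
  have ker: "f ^ k dvd f ^ j * p \<longleftrightarrow> f ^ (k - ?m) dvd p" for p
  proof (cases "j \<le> k")
    case True
    then have "f ^ k = f ^ j * f ^ (k - j)" by (metis le_add_diff_inverse power_add)
    moreover have "f ^ j \<noteq> 0" using f by simp
    ultimately show ?thesis using True by (simp only: dvd_mult_cancel_left min.absorb1) simp
  next
    case False
    then have "f ^ k dvd f ^ j" by (intro le_imp_power_dvd) simp
    then show ?thesis using False by simp
  qed
  \<comment> \<open>Kernel elements are the classes of \<open>f ^ (k - ?m) * s\<close>, and
    \<open>s\<close> matters only modulo \<open>f ^ ?m\<close>; its remainders give each class once,
    which produces the exponent \<open>degree f * min j k\<close>.\<close>
  have sub: "e ` {p. f ^ k dvd f ^ j * p} = (\<lambda>r. e (f ^ (k - ?m) * r)) ` ?R"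
  proof (intro equalityI subsetI)
    fix y assume "y \<in> e ` {p. f ^ k dvd f ^ j * p}"
    then obtain p where "y = e p" "f ^ (k - ?m) dvd p" unfolding ker by blast
    then obtain s where s: "y = e (f ^ (k - ?m) * s)" by (blast elim: dvdE)
    let ?r = "s mod f ^ ?m"
    have "f ^ (k - ?m) * s - f ^ (k - ?m) * ?r = f ^ (k - ?m) * (f ^ ?m * (s div f ^ ?m))"
      by (simp only: right_diff_distrib[symmetric] minus_mod_eq_mult_div)
    also have "\<dots> = f ^ k * (s div f ^ ?m)"
      unfolding fk by (simp only: mult.assoc mult.left_commute[of "f ^ ?m"])
    finally have "y = e (f ^ (k - ?m) * ?r)" unfolding s e by (simp only: dvd_triv_left)
    moreover have "?r \<in> ?R"
    proof -
      have "degree (f ^ ?m) = degree f * ?m" using f by (simp add: degree_power_eq mult.commute)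
      moreover have "f ^ ?m \<noteq> 0" using f by simp
      ultimately have "s mod f ^ ?m = 0 \<or> degree (s mod f ^ ?m) < degree f * ?m"
        using degree_mod_less[of "f ^ ?m" s] by metis
      then show ?thesis by (rule CollectI)
    qed
    ultimately show "y \<in> (\<lambda>r. e (f ^ (k - ?m) * r)) ` ?R" by (rule image_eqI)
  next
    fix y assume "y \<in> (\<lambda>r. e (f ^ (k - ?m) * r)) ` ?R"
    then obtain r where "y = e (f ^ (k - ?m) * r)" by blast
    moreover have "f ^ (k - ?m) * r \<in> {p. f ^ k dvd f ^ j * p}" unfolding mem_Collect_eq ker by (rule dvd_triv_left)
    ultimately show "y \<in> e ` {p. f ^ k dvd f ^ j * p}" by (rule image_eqI)
  qed
  have "inj_on (\<lambda>r. e (f ^ (k - ?m) * r)) ?R"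
  proof (rule inj_onI)
    fix r s assume rs: "r \<in> ?R" "s \<in> ?R" "e (f ^ (k - ?m) * r) = e (f ^ (k - ?m) * s)"
    then have "f ^ ?m * f ^ (k - ?m) dvd (r - s) * f ^ (k - ?m)"
      by (simp only: e fk right_diff_distrib mult.commute[of _ "f ^ (k - ?m)"])
    moreover have "f ^ (k - ?m) \<noteq> 0" using f by simp
    ultimately have "f ^ ?m dvd r - s" by (simp only: dvd_mult_cancel_right) simp
    then have "r - s = 0 \<or> degree (f ^ ?m) \<le> degree (r - s)" using dvd_imp_degree_le by blast
    moreover have "r - s = 0 \<or> degree (r - s) < degree (f ^ ?m)"
    proof -
      have "degree (f ^ ?m) = degree f * ?m" using f by (simp add: degree_power_eq mult.commute)
      then show ?thesis using rs(1,2) degree_diff_less[of r "degree (f ^ ?m)" s]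
        by (cases "r = 0"; cases "s = 0") auto
    qed
    ultimately show "r = s" by auto
  qed
  then show ?thesis unfolding sub by (simp only: card_image card_poly_degree_less(1))
qed

section \<open>Finite modules over a polynomial ring\<close>

locale poly_module = Modules.module scale
  for scale :: "'a::{field,finite} poly \<Rightarrow> 'b::ab_group_add \<Rightarrow> 'b" (infixr "*s" 75)
begin

definition kern :: "'b set \<Rightarrow> 'a poly \<Rightarrow> 'b set" where
  "kern M h = {x \<in> M. h *s x = 0}"

definition has_order :: "'b \<Rightarrow> 'a poly \<Rightarrow> bool" where
  "has_order v q \<longleftrightarrow> (\<forall>p. p *s v = 0 \<longleftrightarrow> q dvd p)"

text \<open>Internal direct sum: \<open>M\<close> is \<open>N\<close> plus the cyclic submodule of
  \<open>v\<close>, and the last conjunct says that these meet in 0.\<close>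

definition splits_off :: "'b set \<Rightarrow> 'b set \<Rightarrow> 'b \<Rightarrow> bool" where
  "splits_off M N v \<longleftrightarrow> subspace N \<and> N \<subseteq> M \<and> v \<in> M \<and>
     (\<forall>x\<in>M. \<exists>n\<in>N. \<exists>p. x = n + p *s v) \<and> (\<forall>p. p *s v \<in> N \<longrightarrow> p *s v = 0)"

text \<open>By pigeonhole in the finite \<open>M\<close>, two different powers of x act equally on
  \<open>v\<close>; their difference annihilates \<open>v\<close>.\<close>

lemma torsion:
  assumes "subspace M" "finite M" "v \<in> M"
  obtains p where "p \<noteq> 0" "p *s v = 0"
proof -
  have "\<not> inj (\<lambda>k. monom 1 k *s v)"
  proof
    assume "inj (\<lambda>k. monom 1 k *s v)"
    then have "infinite (range (\<lambda>k::nat. monom 1 k *s v))" by (rule range_inj_infinite)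
    moreover have "range (\<lambda>k::nat. monom 1 k *s v) \<subseteq> M" using assms subspace_scale by blast
    ultimately show False using assms(2) finite_subset by blast
  qed
  then obtain i j where ij: "i \<noteq> j" "monom 1 i *s v = monom 1 j *s v" by (auto simp: inj_def)
  show ?thesis
  proof (rule that)
    show "monom 1 i - monom 1 j \<noteq> (0 :: 'a poly)" using ij(1) by (simp add: monom_eq_iff')
    show "(monom 1 i - monom 1 j) *s v = 0" using ij(2) by (simp add: scale_left_diff_distrib)
  qed
qed

text \<open>The polynomials sending \<open>w\<close> into \<open>S\<close> form an ideal. Its
  generator is the order of \<open>w\<close> in the quotient by \<open>S\<close>, obtained without
  forming the quotient; \<open>S = {0}\<close> gives the usual annihilator.\<close>

lemma order_modulo:
  assumes "subspace S" "p0 *s w \<in> S" "p0 \<noteq> 0"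
  obtains g where "g \<noteq> 0" "\<And>p. p *s w \<in> S \<longleftrightarrow> g dvd p"
proof -
  obtain g where g: "g \<in> {p. p *s w \<in> S}" "g \<noteq> 0" "\<And>p. p \<in> {p. p *s w \<in> S} \<Longrightarrow> g dvd p"
  proof (rule poly_ideal_principal[of "{p. p *s w \<in> S}" p0])
    show "p + q \<in> {p. p *s w \<in> S}" if "p \<in> {p. p *s w \<in> S}" "q \<in> {p. p *s w \<in> S}" for p q
      using that assms(1) by (auto simp: scale_left_distrib subspace_add)
    show "r * p \<in> {p. p *s w \<in> S}" if "p \<in> {p. p *s w \<in> S}" for p r
      using that subspace_scale[OF assms(1), of "p *s w" r] by simp
  qed (use assms in auto)
  have "p *s w \<in> S" if gp: "g dvd p" for p
  proof -
    obtain r where "p = g * r" using gp by (rule dvdE)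
    then have p: "p *s w = r *s (g *s w)" by (simp add: mult.commute)
    have "g *s w \<in> S" using g(1) by simp
    then show ?thesis unfolding p by (rule subspace_scale[OF assms(1)])
  qed
  then have "p *s w \<in> S \<longleftrightarrow> g dvd p" for p using g(3)[of p] by auto
  then show ?thesis by (rule that[OF g(2)])
qed

text \<open>Write the order of \<open>v\<close> as \<open>f * r\<close> with \<open>f\<close> prime.
  By degree, the order does not divide \<open>r\<close>, so \<open>r\<close> leaves \<open>v\<close>
  nonzero while \<open>f\<close> kills the result.\<close>

lemma irreducible_torsion:
  assumes "p *s v = 0" "p \<noteq> 0" "v \<noteq> 0"
  obtains f r where "irreducible f" "monic f" "f dvd p" "r *s v \<noteq> 0" "f *s (r *s v) = 0"
proof -
  obtain g where g: "g \<noteq> 0" "\<And>q. q *s v \<in> {0} \<longleftrightarrow> g dvd q"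
    using order_modulo[of "{0}" p v] assms by (auto simp: subspace_def)
  have "\<not> is_unit g" using g(2)[of 1] assms(3) by auto
  then obtain f where f: "irreducible f" "monic f" "f dvd g"
    using exists_irreducible_factor g(1) by blast
  then obtain r where r: "g = f * r" by (blast elim: dvdE)
  have "\<not> g dvd r"
  proof
    assume "g dvd r"
    then have "degree g \<le> degree r" using r g(1) by (auto intro: dvd_imp_degree_le)
    moreover have "degree g = degree f + degree r" using r g(1) by (auto simp: degree_mult_eq)
    ultimately show False using degree_irreducible_pos[OF f(1)] by simp
  qed
  then have "r *s v \<noteq> 0" using g(2)[of r] by simp
  moreover have "f *s (r *s v) = 0" using g(2)[of g] r by simp
  moreover have "f dvd p" using g(2)[of p] assms(1) f(3) dvd_trans by blast
  ultimately show ?thesis using that f(1,2) by blast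
qed

text \<open>Apply a Bezout identity between \<open>c\<close> and \<open>f ^ k\<close> to
  \<open>v\<close>.\<close>

lemma irreducible_kernel_disjoint:
  assumes "irreducible f" "\<not> f dvd c" "f ^ k *s v = 0" "c *s v = 0"
  shows "v = 0"
proof -
  obtain s t where st: "s * c + t * f ^ k = 1" using irreducible_power_bezout[OF assms(1,2)] by blast
  have "v = (s * c + t * f ^ k) *s v" using st by simp
  also have "\<dots> = s *s (c *s v) + t *s (f ^ k *s v)" by (simp add: scale_left_distrib)
  finally show ?thesis using assms(3,4) by simp
qed

text \<open>Induction on \<open>m\<close>, replacing \<open>v\<close> by \<open>f *s v\<close>. A
  polynomial annihilating \<open>v\<close> also annihilates \<open>f ^ m *s v\<close>, which is
  nonzero and killed by \<open>f\<close>; hence it is divisible by \<open>f\<close>, and the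
  quotient annihilates \<open>f *s v\<close>.\<close>

lemma has_order_power:
  assumes "irreducible f" "f ^ Suc m *s v = 0" "f ^ m *s v \<noteq> 0"
  shows "has_order v (f ^ Suc m)"
proof -
  have "f ^ Suc m dvd p" if "p *s v = 0" for p
    using assms(2,3) that
  proof (induction m arbitrary: v p)
    case 0
    then show ?case using irreducible_kernel_disjoint[OF assms(1), of p 1 v] by auto
  next
    case (Suc m)
    have "p *s (f ^ Suc m *s v) = 0" using Suc.prems(3) by (metis scale_left_commute scale_zero_right)
    moreover have "f ^ 1 *s (f ^ Suc m *s v) = 0" using Suc.prems(1) by simp
    ultimately have "f dvd p"
      using irreducible_kernel_disjoint[OF assms(1)] Suc.prems(2) by blast
    then obtain q where q: "p = f * q" by (rule dvdE)
    have "f ^ Suc m dvd q"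
    proof (rule Suc.IH[of "f *s v"])
      show "f ^ Suc m *s (f *s v) = 0" "f ^ m *s (f *s v) \<noteq> 0" "q *s (f *s v) = 0"
        using Suc.prems q by (simp_all add: mult_ac)
    qed
    then show ?case unfolding q by (simp add: mult_dvd_mono)
  qed
  moreover have "p *s v = 0" if fp: "f ^ Suc m dvd p" for p
  proof -
    obtain r where "p = f ^ Suc m * r" using fp by (rule dvdE)
    then have "p *s v = r *s (f ^ Suc m *s v)" by (simp add: mult.commute)
    then show ?thesis using assms(2) by (simp only: scale_zero_right)
  qed
  ultimately show ?thesis unfolding has_order_def by blast
qed

lemma subspace_add_cyclic:
  assumes "subspace N"
  shows "subspace {n + c *s w |n c. n \<in> N}"
proof (rule subspaceI)
  have "0 = 0 + 0 *s w" by simp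
  then show "0 \<in> {n + c *s w |n c. n \<in> N}" using subspace_0[OF assms] by blast
next
  fix x y assume "x \<in> {n + c *s w |n c. n \<in> N}" "y \<in> {n + c *s w |n c. n \<in> N}"
  then obtain n c n' c' where "x = n + c *s w" "y = n' + c' *s w" "n \<in> N" "n' \<in> N" by blast
  then have "x + y = (n + n') + (c + c') *s w" "n + n' \<in> N"
    using subspace_add[OF assms] by (auto simp: algebra_simps)
  then show "x + y \<in> {n + c *s w |n c. n \<in> N}" by blast
next
  fix r x assume "x \<in> {n + c *s w |n c. n \<in> N}"
  then obtain n c where "x = n + c *s w" "n \<in> N" by blast
  then have "r *s x = r *s n + (r * c) *s w" "r *s n \<in> N"
    using subspace_scale[OF assms] by (auto simp: algebra_simps)
  then show "r *s x \<in> {n + c *s w |n c. n \<in> N}" by blast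
qed

text \<open>A cyclic submodule whose generator has maximal \<open>f\<close>-power order is a direct summand: a
  submodule maximal among those meeting it trivially is a complement.\<close>

lemma cyclic_complement:
  assumes M: "subspace M" "finite M" and f: "irreducible f"
    and v: "v \<in> M" "has_order v (f ^ Suc m)"
    and max: "\<And>w k. w \<in> M \<Longrightarrow> f ^ k *s w = 0 \<Longrightarrow> f ^ Suc m *s w = 0"
  obtains N where "splits_off M N v"
proof -
  note ord = v(2)[unfolded has_order_def, rule_format]
  have fm0: "f ^ k \<noteq> 0" for k using f by auto
  define \<N> where "\<N> = {N. subspace N \<and> N \<subseteq> M \<and> (\<forall>p. p *s v \<in> N \<longrightarrow> p *s v = 0)}"
  have "\<N> \<subseteq> Pow M" by (auto simp: \<N>_def)
  then have "finite \<N>" using M(2) finite_subset by blast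
  moreover have "{0} \<in> \<N>" using subspace_0[OF M(1)] unfolding \<N>_def by simp
  ultimately obtain N where N: "N \<in> \<N>" and Nmax: "\<And>N'. N' \<in> \<N> \<Longrightarrow> N \<subseteq> N' \<Longrightarrow> N' = N"
    using finite_has_maximal[of \<N>] by blast
  have subN: "subspace N" and NM: "N \<subseteq> M" and disj: "\<And>p. p *s v \<in> N \<Longrightarrow> p *s v = 0"
    using N by (auto simp: \<N>_def)
  define S where "S = {n + p *s v |n p. n \<in> N}"
  have subS: "subspace S" unfolding S_def using subN by (rule subspace_add_cyclic)
  have NS: "N \<subseteq> S"
  proof
    fix n assume "n \<in> N"
    moreover have "n = n + 0 *s v" by simp
    ultimately show "n \<in> S" unfolding S_def by blast
  qed
  have vS: "p *s v \<in> S" for p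
  proof -
    have "p *s v = 0 + p *s v" by simp
    then show ?thesis using subspace_0[OF subN] unfolding S_def by blast
  qed
  have "x \<in> S" if xM: "x \<in> M" for x
  proof (rule ccontr)
    assume "x \<notin> S"
    obtain p0 where "p0 \<noteq> 0" "p0 *s x = 0" using torsion[OF M xM] .
    then obtain g0 where g0: "g0 \<noteq> 0" "\<And>p. p *s x \<in> S \<longleftrightarrow> g0 dvd p"
      using order_modulo[OF subS, of p0 x] subspace_0[OF subS] by metis
    have "\<not> is_unit g0" using g0(2)[of 1] \<open>x \<notin> S\<close> by auto
    \<comment> \<open>Taking \<open>f\<close> itself whenever it divides \<open>g0\<close> rules out
      other associates of \<open>f\<close>: below, \<open>g\<close> is either equal to
      \<open>f\<close> or not divisible by it.\<close>
    obtain g where g: "irreducible g" "g dvd g0" "g = f \<or> \<not> f dvd g"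
    proof (cases "f dvd g0")
      case False
      obtain g where "irreducible g" "g dvd g0"
        using exists_irreducible_factor[OF g0(1) \<open>\<not> is_unit g0\<close>] by blast
      then show ?thesis using that False dvd_trans by blast
    qed (use that f in blast)
    obtain r where r: "g0 = g * r" using g(2) by (rule dvdE)
    define w where "w = r *s x"
    have wM: "w \<in> M" unfolding w_def using subspace_scale[OF M(1) xM] .
    have "\<not> g0 dvd r"
    proof
      assume "g0 dvd r"
      then have "degree g0 \<le> degree r" using r g0(1) by (auto intro: dvd_imp_degree_le)
      moreover have "degree g0 = degree g + degree r" using r g0(1) by (auto simp: degree_mult_eq)
      ultimately show False using degree_irreducible_pos[OF g(1)] by simp
    qed
    then have wS: "w \<notin> S" unfolding w_def g0(2) .
    have "g *s w \<in> S" using g0(2)[of g0] unfolding w_def r by simp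
    then obtain n a where na: "g *s w = n + a *s v" "n \<in> N" unfolding S_def by blast
    \<comment> \<open>\<open>w\<close> lies outside \<open>S\<close> but \<open>g *s w\<close> lies
      in it. Once the component \<open>a *s v\<close> is seen to be divisible by \<open>g\<close>,
      the element \<open>w - b *s v\<close> is moved by \<open>g\<close> into \<open>N\<close> and
      can be used to enlarge \<open>N\<close>.\<close>
    obtain b where b: "a *s v = (g * b) *s v"
    proof (cases "g = f")
      case False
      \<comment> \<open>\<open>g\<close> is invertible modulo the order of \<open>v\<close>, so
        division by \<open>g\<close> is possible in the cyclic submodule.\<close>
      then obtain s t where st: "s * g + t * f ^ Suc m = 1"
        using irreducible_power_bezout[OF f] g(3) by blast
      have "f ^ Suc m *s v = 0" unfolding ord by (rule dvd_refl)
      have "a *s v = (a * (s * g + t * f ^ Suc m)) *s v" unfolding st by simp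
      also have "\<dots> = (g * (a * s)) *s v + (a * t) *s (f ^ Suc m *s v)"
        by (simp only: distrib_left mult_ac scale_left_distrib scale_scale)
      also have "\<dots> = (g * (a * s)) *s v" unfolding \<open>f ^ Suc m *s v = 0\<close> by (simp only: scale_zero_right add_0_right)
      finally show ?thesis by (rule that)
    next
      case True
      \<comment> \<open>Here maximality enters. If \<open>u\<close> is the part of an annihilator of
        \<open>w\<close> prime to \<open>f\<close>, then \<open>u *s w\<close> has
        \<open>f\<close>-power order and is killed by \<open>f ^ Suc m\<close>. The multiple of
        \<open>v\<close> that results lies in \<open>N\<close>, so it vanishes and \<open>f\<close>
        divides \<open>u * a\<close>, hence \<open>a\<close>.\<close>
      obtain h where "h \<noteq> 0" "h *s w = 0" using torsion[OF M wM] .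
      then obtain k u where ku: "h = f ^ k * u" "\<not> f dvd u" using extract_power[OF \<open>h \<noteq> 0\<close> f] by blast
      have "f ^ k *s (u *s w) = 0" using \<open>h *s w = 0\<close> ku by simp
      then have "f ^ Suc m *s (u *s w) = 0" using max subspace_scale[OF M(1) wM] by blast
      then have "(f ^ m * u) *s (g *s w) = 0" unfolding True by (simp add: mult_ac)
      then have "(f ^ m * u) *s n + (f ^ m * u * a) *s v = 0" by (simp add: na(1) scale_right_distrib)
      then have "(f ^ m * u * a) *s v = - ((f ^ m * u) *s n)" by (simp add: eq_neg_iff_add_eq_0 add.commute)
      also have "\<dots> \<in> N" using subspace_neg[OF subN] subspace_scale[OF subN na(2)] by blast
      finally have "(f ^ m * u * a) *s v = 0" by (rule disj)
      then have "f ^ Suc m dvd f ^ m * u * a" unfolding ord .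
      then have "f ^ m * f dvd f ^ m * (u * a)" by (simp add: mult_ac)
      then have "f dvd u * a" using fm0[of m] by (subst (asm) dvd_mult_cancel_left) blast
      then have "f dvd a"
        using ku(2) prime_elem_dvd_mult_iff[OF field_poly_irreducible_imp_prime[OF f]] by blast
      then obtain b where "a = f * b" by (rule dvdE)
      then show ?thesis using that True by blast
    qed
    define w' where "w' = w - b *s v"
    have w'M: "w' \<in> M" unfolding w'_def
      using subspace_diff[OF M(1) wM subspace_scale[OF M(1) v(1)]] .
    have w'S: "w' \<notin> S"
    proof
      assume "w' \<in> S"
      then have "w' + b *s v \<in> S" using subspace_add[OF subS] vS by blast
      then show False using wS unfolding w'_def by simp
    qed
    have gw': "g *s w' \<in> N" unfolding w'_def using na b by (simp add: scale_right_diff_distrib)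
    define N' where "N' = {n + c *s w' |n c. n \<in> N}"
    have "w' = 0 + 1 *s w'" by simp
    then have "w' \<in> N'" unfolding N'_def using subspace_0[OF subN] by blast
    have "N \<subseteq> N'"
    proof
      fix n assume "n \<in> N"
      moreover have "n = n + 0 *s w'" by simp
      ultimately show "n \<in> N'" unfolding N'_def by blast
    qed
    have "N' \<in> \<N>" unfolding \<N>_def
    proof (intro CollectI conjI allI impI)
      show "subspace N'" unfolding N'_def using subN by (rule subspace_add_cyclic)
      show "N' \<subseteq> M"
      proof
        fix y assume "y \<in> N'"
        then obtain n c where "y = n + c *s w'" "n \<in> N" unfolding N'_def by blast
        then have "n \<in> M" "c *s w' \<in> M" using NM subspace_scale[OF M(1) w'M] by auto
        then show "y \<in> M" unfolding \<open>y = n + c *s w'\<close> by (rule subspace_add[OF M(1)])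
      qed
    next
      fix e assume "e *s v \<in> N'"
      then obtain n' c where e: "e *s v = n' + c *s w'" "n' \<in> N" unfolding N'_def by blast
      show "e *s v = 0"
      proof (cases "g dvd c")
        case True
        then obtain d where "c = g * d" by (rule dvdE)
        then have "c *s w' = d *s (g *s w')" by (simp add: mult.commute)
        then have "e *s v \<in> N"
          unfolding e(1) using subspace_add[OF subN e(2) subspace_scale[OF subN gw']] by simp
        then show ?thesis by (rule disj)
      next
        case False
        \<comment> \<open>A coefficient prime to \<open>g\<close> would put \<open>w'\<close> into
          \<open>S\<close>, because both \<open>c *s w'\<close> and \<open>g *s w'\<close> lie in
          \<open>S\<close>.\<close>
        then obtain s t where st: "s * c + t * g = 1" using irreducible_bezout[OF g(1)] by blast
        have "w' = (s * c + t * g) *s w'" unfolding st by simp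
        also have "\<dots> = s *s (c *s w') + t *s (g *s w')" by (simp add: scale_left_distrib)
        also have "c *s w' = e *s v - n'" using e(1) by simp
        also have "s *s (e *s v - n') + t *s (g *s w') \<in> S"
          using vS[of e] subsetD[OF NS e(2)] subsetD[OF NS gw']
          by (meson subspace_add[OF subS] subspace_diff[OF subS] subspace_scale[OF subS])
        finally show ?thesis using w'S by blast
      qed
    qed
    then have "N' = N" using Nmax \<open>N \<subseteq> N'\<close> by blast
    then show False using \<open>w' \<in> N'\<close> NS w'S by blast
  qed
  then have "splits_off M N v"
    unfolding splits_off_def S_def using subN NM v(1) disj by blast
  then show ?thesis by (rule that)
qed

end

section \<open>Kernel counts and the splitting off of cyclic summands\<close>

context poly_module
begin

lemma annihilates_multiple: "h *s x = 0 \<Longrightarrow> h *s c *s x = 0"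
  by (subst scale_left_commute) simp

lemma kern_subspace: "subspace M \<Longrightarrow> subspace (kern M h)"
  unfolding kern_def
  by (rule subspaceI) (auto simp: subspace_0 subspace_add subspace_scale scale_right_distrib
      annihilates_multiple simp del: scale_scale)

lemma kern_power_mono:
  assumes "i \<le> j"
  shows "kern M (f ^ i) \<subseteq> kern M (f ^ j)"
proof -
  have "f ^ j = f ^ (j - i) * f ^ i" using assms by (simp flip: power_add)
  then show ?thesis unfolding kern_def by (auto simp flip: scale_scale)
qed

lemma kern_one: "subspace M \<Longrightarrow> kern M 1 = {0}"
  by (auto simp: kern_def subspace_0)

lemma card_kern_cyclic:
  assumes ord: "has_order v (f ^ k)" and f: "f \<noteq> 0"
  shows "card (kern (range (\<lambda>p. p *s v)) (f ^ j)) = CARD('a) ^ (degree f * min j k)"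
proof -
  have 1: "p *s v = q *s v \<longleftrightarrow> f ^ k dvd p - q" for p q
    using ord[unfolded has_order_def] by (metis right_minus_eq scale_left_diff_distrib)
  have 2: "f ^ j *s p *s v = 0 \<longleftrightarrow> f ^ k dvd f ^ j * p" for p
    using ord[unfolded has_order_def] by simp
  have "kern (range (\<lambda>p. p *s v)) (f ^ j) = (\<lambda>p. p *s v) ` {p. f ^ k dvd f ^ j * p}"
    unfolding kern_def using 2 by auto
  then show ?thesis using card_cyclic_kernel[OF f 1, of j] by simp
qed

lemma kern_cyclic_other:
  assumes ord: "has_order v (f ^ k)" and "irreducible g" "\<not> g dvd f"
  shows "kern (range (\<lambda>p. p *s v)) (g ^ j) = {0}"
proof -
  have "\<not> g dvd f ^ k"
    using assms(3) prime_elem_dvd_power[OF field_poly_irreducible_imp_prime[OF assms(2)]] by blast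
  have "y = 0" if y: "y \<in> kern (range (\<lambda>p. p *s v)) (g ^ j)" for y
  proof -
    obtain p where p: "y = p *s v" "g ^ j *s y = 0" using y unfolding kern_def by auto
    have "f ^ k *s v = 0" using ord unfolding has_order_def by (metis dvd_refl)
    then have "f ^ k *s y = 0" unfolding p(1) by (rule annihilates_multiple)
    then show ?thesis by (rule irreducible_kernel_disjoint[OF assms(2) \<open>\<not> g dvd f ^ k\<close> p(2)])
  qed
  moreover have "0 \<in> kern (range (\<lambda>p. p *s v)) (g ^ j)"
    unfolding kern_def by (auto intro!: image_eqI[of _ _ 0])
  ultimately show ?thesis by blast
qed

lemma splits_off_unique:
  assumes "splits_off M N v" "n \<in> N" "n' \<in> N" "n + p *s v = n' + p' *s v"
  shows "n = n' \<and> p *s v = p' *s v"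
proof -
  have N: "subspace N" and z: "\<And>p. p *s v \<in> N \<Longrightarrow> p *s v = 0"
    using assms(1) unfolding splits_off_def by blast+
  have "(p - p') *s v = n' - n"
    using assms(4) by (simp add: scale_left_diff_distrib algebra_simps)
  then have "(p - p') *s v \<in> N" using subspace_diff[OF N assms(3,2)] by simp
  then have "(p - p') *s v = 0" by (rule z)
  then have "p *s v = p' *s v" by (simp add: scale_left_diff_distrib)
  then show ?thesis using assms(4) by simp
qed

text \<open>Both summands are invariant, so by uniqueness of the decomposition \<open>h\<close>
  kills a sum only if it kills both terms.\<close>

lemma card_kern_splits_off:
  assumes s: "splits_off M N v" and M: "subspace M"
  shows "card (kern M h) = card (kern N h) * card (kern (range (\<lambda>p. p *s v)) h)"
proof -
  let ?C = "range (\<lambda>p. p *s v)"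
  have N: "subspace N" and NM: "N \<subseteq> M" and vM: "v \<in> M"
    and ex: "\<And>x. x \<in> M \<Longrightarrow> \<exists>n\<in>N. \<exists>p. x = n + p *s v"
    using s unfolding splits_off_def by blast+
  have "bij_betw (\<lambda>(n, y). n + y) (kern N h \<times> kern ?C h) (kern M h)"
    unfolding bij_betw_def
  proof (intro conjI equalityI subsetI)
    show "inj_on (\<lambda>(n, y). n + y) (kern N h \<times> kern ?C h)"
      using splits_off_unique[OF s] unfolding inj_on_def kern_def by auto
  next
    fix x assume "x \<in> (\<lambda>(n, y). n + y) ` (kern N h \<times> kern ?C h)"
    then obtain n p where x: "x = n + p *s v" and n: "n \<in> N" "h *s n = 0" and p: "h *s p *s v = 0"
      unfolding kern_def by auto
    have "x \<in> M" unfolding x using subspace_add[OF M subsetD[OF NM n(1)] subspace_scale[OF M vM]] .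
    moreover have "h *s x = 0" unfolding x scale_right_distrib n(2) p by simp
    ultimately show "x \<in> kern M h" unfolding kern_def by simp
  next
    fix x assume "x \<in> kern M h"
    then have xM: "x \<in> M" and hx: "h *s x = 0" unfolding kern_def by simp_all
    obtain n p where x: "x = n + p *s v" and n: "n \<in> N" using ex[OF xM] by blast
    have "h *s n + (h * p) *s v = 0 + 0 *s v" using hx unfolding x by (simp add: scale_right_distrib)
    then have "h *s n = 0 \<and> (h * p) *s v = 0 *s v"
      by (rule splits_off_unique[OF s subspace_scale[OF N n] subspace_0[OF N]])
    then have "(n, p *s v) \<in> kern N h \<times> kern ?C h" using n unfolding kern_def by simp
    then show "x \<in> (\<lambda>(n, y). n + y) ` (kern N h \<times> kern ?C h)" unfolding x by force
  qed
  then show ?thesis using bij_betw_same_card card_cartesian_product by metis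
qed

text \<open>\<open>top\<close> says that the kernels have stopped growing at \<open>Suc m\<close>,
  which is the maximality required for a complement; \<open>least\<close> provides an element of
  order exactly \<open>f ^ Suc m\<close>. Both speak of cardinalities only, so that two modules with
  equal counts split at the same exponent.\<close>

lemma split_cyclic:
  assumes M: "subspace M" "finite M" and f: "irreducible f"
    and top: "\<And>k. card (kern M (f ^ k)) \<le> card (kern M (f ^ Suc m))"
    and least: "card (kern M (f ^ m)) < card (kern M (f ^ Suc m))"
  obtains N v where "splits_off M N v" "has_order v (f ^ Suc m)"
proof -
  have fin: "finite (kern M h)" for h using M(2) unfolding kern_def by simp
  have max: "f ^ Suc m *s w = 0" if "w \<in> M" "f ^ k *s w = 0" for w k
  proof -
    have "kern M (f ^ Suc m) \<subseteq> kern M (f ^ max k (Suc m))" by (rule kern_power_mono) simp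
    then have "kern M (f ^ Suc m) = kern M (f ^ max k (Suc m))"
      using top fin by (intro card_seteq) auto
    moreover have "w \<in> kern M (f ^ max k (Suc m))"
      using kern_power_mono[of k "max k (Suc m)" M f] that unfolding kern_def by auto
    ultimately show ?thesis unfolding kern_def by blast
  qed
  have "kern M (f ^ m) \<noteq> kern M (f ^ Suc m)" using least by auto
  then obtain v where "v \<in> M" "f ^ Suc m *s v = 0" "f ^ m *s v \<noteq> 0"
    using kern_power_mono[of m "Suc m" M f] unfolding kern_def by auto
  then have "v \<in> M" "has_order v (f ^ Suc m)" using has_order_power[OF f] by auto
  then show ?thesis using cyclic_complement[OF M f] max that by metis
qed

text \<open>The counts are bounded by \<open>card M\<close>; take the least exponent with the
  largest count. It is a successor because the kernel at exponent 0 is trivial and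
  \<open>kern M f\<close> is not.\<close>

lemma exists_top_power:
  assumes M: "subspace M" "finite M" and "kern M f \<noteq> {0}"
  obtains m where "\<And>k. card (kern M (f ^ k)) \<le> card (kern M (f ^ Suc m))"
    "card (kern M (f ^ m)) < card (kern M (f ^ Suc m))"
proof -
  let ?c = "\<lambda>k. card (kern M (f ^ k))"
  have fin: "finite (kern M h)" for h using M(2) unfolding kern_def by simp
  have "?c k \<le> card M" for k using M(2) unfolding kern_def by (intro card_mono) auto
  then have "\<exists>j. True \<and> (\<forall>k. True \<longrightarrow> ?c k \<le> ?c j)"
    by (intro Lattices_Big.ex_has_greatest_nat[of _ 0 _ "Suc (card M)"]) (auto simp: less_Suc_eq_le)
  then obtain j where j: "\<And>k. ?c k \<le> ?c j" by blast
  define i where "i = (LEAST i. \<forall>k. ?c k \<le> ?c i)"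
  have i: "\<forall>k. ?c k \<le> ?c i" unfolding i_def by (rule LeastI[of _ j]) (use j in blast)
  have "i \<noteq> 0"
  proof
    assume "i = 0"
    then have "card (kern M (f ^ 1)) \<le> card (kern M 1)" using i by (metis power_0)
    then have "card (kern M f) \<le> 1" using kern_one[OF M(1)] by simp
    moreover have "0 \<in> kern M f" using subspace_0[OF M(1)] unfolding kern_def by simp
    ultimately show False
      using assms(3) fin[of f] card_le_Suc0_iff_eq[of "kern M f"] by auto
  qed
  then obtain m where m: "i = Suc m" using not0_implies_Suc by blast
  have "\<not> (\<forall>k. ?c k \<le> ?c m)" using not_less_Least[of m "\<lambda>i. \<forall>k. ?c k \<le> ?c i"] m
    unfolding i_def[symmetric] by blast
  then have "?c m < ?c i" using i by (meson le_less_trans not_le)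
  then show ?thesis using that i unfolding m by blast
qed

end

section \<open>Equal kernel counts imply isomorphism\<close>

context poly_module
begin

lemma splits_off_psubset:
  assumes "splits_off M N v" "has_order v q" "\<not> is_unit q"
  shows "N \<subset> M"
proof -
  have "v \<notin> N"
  proof
    assume "v \<in> N"
    then have "1 *s v \<in> N" by simp
    then have "1 *s v = 0" using assms(1) unfolding splits_off_def by blast
    then show False using assms(2,3) unfolding has_order_def by blast
  qed
  then show ?thesis using assms(1) unfolding splits_off_def by blast
qed

text \<open>Every nonzero element has a nonzero multiple that is killed by a monic prime.\<close>

lemma trivial_if_no_irreducible_kernel:
  assumes "subspace M" "finite M" "\<And>f. irreducible f \<Longrightarrow> monic f \<Longrightarrow> kern M f = {0}"
  shows "M = {0}"
proof (rule ccontr)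
  assume "M \<noteq> {0}"
  then obtain v where v: "v \<in> M" "v \<noteq> 0" using subspace_0[OF assms(1)] by blast
  obtain p where "p \<noteq> 0" "p *s v = 0" using torsion[OF assms(1,2) v(1)] .
  then obtain f r where f: "irreducible f" "monic f" "r *s v \<noteq> 0" "f *s (r *s v) = 0"
    using irreducible_torsion[of p v] v(2) by metis
  then have "r *s v \<in> kern M f" using subspace_scale[OF assms(1) v(1)] unfolding kern_def by blast
  then show False using assms(3)[OF f(1,2)] f(3) by blast
qed

end

locale poly_module_pair = m1: poly_module s1 + m2: poly_module s2
  for s1 :: "'a::{field,finite} poly \<Rightarrow> 'b::ab_group_add \<Rightarrow> 'b"
    and s2 :: "'a poly \<Rightarrow> 'c::ab_group_add \<Rightarrow> 'c"
begin

definition iso_on :: "('b \<Rightarrow> 'c) \<Rightarrow> 'b set \<Rightarrow> 'c set \<Rightarrow> bool" where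
  "iso_on \<phi> M M' \<longleftrightarrow> bij_betw \<phi> M M' \<and> (\<forall>x\<in>M. \<forall>y\<in>M. \<phi> (x + y) = \<phi> x + \<phi> y) \<and>
     (\<forall>p. \<forall>x\<in>M. \<phi> (s1 p x) = s2 p (\<phi> x))"

text \<open>Send \<open>n + s1 p v\<close> to \<open>\<phi> n + s2 p v'\<close>. This is well
  defined because the decomposition is unique and \<open>v\<close>, \<open>v'\<close> have the same
  annihilator.\<close>

lemma iso_on_extend:
  assumes sp: "m1.splits_off M N v" "m2.splits_off M' N' v'" and M: "m1.subspace M" "m2.subspace M'"
    and ord: "m1.has_order v q" "m2.has_order v' q" and \<phi>: "iso_on \<phi> N N'"
  shows "\<exists>\<psi>. iso_on \<psi> M M'"
proof -
  have N: "m1.subspace N" "N \<subseteq> M" "v \<in> M" and ex: "\<And>x. x \<in> M \<Longrightarrow> \<exists>n\<in>N. \<exists>p. x = n + s1 p v"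
    using sp(1) unfolding m1.splits_off_def by blast+
  have N': "m2.subspace N'" "N' \<subseteq> M'" "v' \<in> M'" and ex': "\<And>x. x \<in> M' \<Longrightarrow> \<exists>n\<in>N'. \<exists>p. x = n + s2 p v'"
    using sp(2) unfolding m2.splits_off_def by blast+
  have bij: "bij_betw \<phi> N N'" and add: "\<And>x y. x \<in> N \<Longrightarrow> y \<in> N \<Longrightarrow> \<phi> (x + y) = \<phi> x + \<phi> y"
    and sc: "\<And>p x. x \<in> N \<Longrightarrow> \<phi> (s1 p x) = s2 p (\<phi> x)"
    using \<phi> unfolding iso_on_def by blast+
  have \<phi>N: "\<phi> n \<in> N'" if "n \<in> N" for n using bij that bij_betwE by blast
  have eq: "s1 p v = s1 p' v \<longleftrightarrow> s2 p v' = s2 p' v'" for p p'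
  proof -
    have "s1 p v = s1 p' v \<longleftrightarrow> s1 (p - p') v = 0" by (simp add: m1.scale_left_diff_distrib)
    also have "\<dots> \<longleftrightarrow> s2 (p - p') v' = 0" using ord unfolding m1.has_order_def m2.has_order_def by blast
    also have "\<dots> \<longleftrightarrow> s2 p v' = s2 p' v'" by (simp add: m2.scale_left_diff_distrib)
    finally show ?thesis .
  qed
  define \<psi> where "\<psi> x = (THE y. \<exists>n\<in>N. \<exists>p. x = n + s1 p v \<and> y = \<phi> n + s2 p v')" for x
  have \<psi>: "\<psi> (n + s1 p v) = \<phi> n + s2 p v'" if n: "n \<in> N" for n p
    unfolding \<psi>_def
  proof (rule the_equality)
    show "\<exists>n'\<in>N. \<exists>p'. n + s1 p v = n' + s1 p' v \<and> \<phi> n + s2 p v' = \<phi> n' + s2 p' v'"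
      using n by blast
  next
    fix y assume "\<exists>n'\<in>N. \<exists>p'. n + s1 p v = n' + s1 p' v \<and> y = \<phi> n' + s2 p' v'"
    then obtain n' p' where n': "n' \<in> N" "n + s1 p v = n' + s1 p' v" "y = \<phi> n' + s2 p' v'" by blast
    then have "n = n' \<and> s1 p v = s1 p' v" using m1.splits_off_unique[OF sp(1) n n'(1,2)] by blast
    then show "y = \<phi> n + s2 p v'" using n'(3) eq by auto
  qed
  have "iso_on \<psi> M M'" unfolding iso_on_def bij_betw_def
  proof (intro conjI ballI allI)
    show "inj_on \<psi> M"
    proof (rule inj_onI)
      fix x y assume "x \<in> M" "y \<in> M" and e: "\<psi> x = \<psi> y"
      then obtain n p n' p' where x: "x = n + s1 p v" "n \<in> N" and y: "y = n' + s1 p' v" "n' \<in> N"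
        using ex by meson
      have "\<phi> n + s2 p v' = \<phi> n' + s2 p' v'" using e \<psi> x y by simp
      then have "\<phi> n = \<phi> n' \<and> s2 p v' = s2 p' v'"
        by (rule m2.splits_off_unique[OF sp(2) \<phi>N[OF x(2)] \<phi>N[OF y(2)]])
      then have "n = n'" "s1 p v = s1 p' v"
        using bij x(2) y(2) eq unfolding bij_betw_def inj_on_def by auto
      then show "x = y" using x(1) y(1) by simp
    qed
    show "\<psi> ` M = M'"
    proof (intro equalityI subsetI)
      fix y assume "y \<in> \<psi> ` M"
      then obtain x where "x \<in> M" "y = \<psi> x" by blast
      then obtain n p where x: "x = n + s1 p v" "n \<in> N" using ex by meson
      have "y = \<phi> n + s2 p v'" using \<psi> x \<open>y = \<psi> x\<close> by simp
      moreover have "\<phi> n \<in> M'" using \<phi>N[OF x(2)] N'(2) by blast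
      ultimately show "y \<in> M'" using m2.subspace_add[OF M(2)] m2.subspace_scale[OF M(2) N'(3)] by simp
    next
      fix y assume "y \<in> M'"
      then obtain n' p where y: "y = n' + s2 p v'" "n' \<in> N'" using ex' by meson
      then obtain n where n: "n \<in> N" "n' = \<phi> n" using bij unfolding bij_betw_def by blast
      have "y = \<psi> (n + s1 p v)" using \<psi>[OF n(1)] y(1) n(2) by simp
      moreover have "n + s1 p v \<in> M"
        using m1.subspace_add[OF M(1)] m1.subspace_scale[OF M(1) N(3)] n(1) N(2) by blast
      ultimately show "y \<in> \<psi> ` M" by (rule image_eqI)
    qed
  next
    fix x y assume "x \<in> M" "y \<in> M"
    then obtain n p n' p' where x: "x = n + s1 p v" "n \<in> N" and y: "y = n' + s1 p' v" "n' \<in> N"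
      using ex by meson
    have "x + y = (n + n') + s1 (p + p') v"
      unfolding x(1) y(1) by (simp add: m1.scale_left_distrib algebra_simps)
    then have "\<psi> (x + y) = \<phi> (n + n') + s2 (p + p') v'"
      using \<psi>[OF m1.subspace_add[OF N(1) x(2) y(2)]] by simp
    then show "\<psi> (x + y) = \<psi> x + \<psi> y"
      unfolding x(1) y(1) \<psi>[OF x(2)] \<psi>[OF y(2)] add[OF x(2) y(2)]
      by (simp add: m2.scale_left_distrib algebra_simps)
  next
    fix r x assume "x \<in> M"
    then obtain n p where x: "x = n + s1 p v" "n \<in> N" using ex by meson
    have "s1 r x = s1 r n + s1 (r * p) v" unfolding x(1) by (simp add: m1.scale_right_distrib)
    then have "\<psi> (s1 r x) = \<phi> (s1 r n) + s2 (r * p) v'"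
      using \<psi>[OF m1.subspace_scale[OF N(1) x(2)]] by simp
    then show "\<psi> (s1 r x) = s2 r (\<psi> x)"
      unfolding x(1) \<psi>[OF x(2)] sc[OF x(2)] by (simp add: m2.scale_right_distrib)
  qed
  then show ?thesis by blast
qed

theorem iso_if_equal_kernels:
  assumes "m1.subspace M" "finite M" "m2.subspace M'" "finite M'"
    and "\<And>f j. irreducible f \<Longrightarrow> monic f \<Longrightarrow> card (m1.kern M (f ^ j)) = card (m2.kern M' (f ^ j))"
  shows "\<exists>\<phi>. iso_on \<phi> M M'"
  using assms
proof (induction "card M" arbitrary: M M' rule: less_induct)
  case less
  note M = less.prems(1,2) and M' = less.prems(3,4) and card_eq = less.prems(5)
  have trivial_iff: "m1.kern M f = {0} \<longleftrightarrow> m2.kern M' f = {0}" if "irreducible f" "monic f" for f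
  proof -
    have "0 \<in> m1.kern M f" "0 \<in> m2.kern M' f"
      using m1.subspace_0[OF M(1)] m2.subspace_0[OF M'(1)] by (simp_all add: m1.kern_def m2.kern_def)
    moreover have "finite (m1.kern M f)" "finite (m2.kern M' f)"
      using M(2) M'(2) by (simp_all add: m1.kern_def m2.kern_def)
    moreover have "card (m1.kern M f) = card (m2.kern M' f)" using card_eq[of f 1] that by simp
    ultimately show ?thesis
      by (metis card_1_singletonE card_eq_0_iff is_singletonI is_singleton_altdef singletonD)
  qed
  show ?case
  proof (cases "\<forall>f. irreducible f \<longrightarrow> monic f \<longrightarrow> m1.kern M f = {0}")
    case True
    have "M = {0}" using m1.trivial_if_no_irreducible_kernel[OF M] True by blast
    moreover have "M' = {0}"
      using m2.trivial_if_no_irreducible_kernel[OF M'] True trivial_iff by blast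
    ultimately have "iso_on (\<lambda>_. 0) M M'" unfolding iso_on_def bij_betw_def by simp
    then show ?thesis by blast
  next
    case False
    then obtain f where f: "irreducible f" "monic f" and nt: "m1.kern M f \<noteq> {0}" by blast
    have f0: "f \<noteq> 0" using f(1) by auto
    obtain m where m: "\<And>k. card (m1.kern M (f ^ k)) \<le> card (m1.kern M (f ^ Suc m))"
      "card (m1.kern M (f ^ m)) < card (m1.kern M (f ^ Suc m))"
      using m1.exists_top_power[OF M nt] by blast
    obtain N v where N: "m1.splits_off M N v" "m1.has_order v (f ^ Suc m)"
      using m1.split_cyclic[OF M f(1) m] by blast
    obtain N' v' where N': "m2.splits_off M' N' v'" "m2.has_order v' (f ^ Suc m)"
      using m2.split_cyclic[OF M' f(1) m[unfolded card_eq[OF f]]] by blast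
    have "\<not> is_unit (f ^ Suc m)"
      using irreducible_not_unit[OF f(1)] is_unit_power_iff[of f "Suc m"] by simp
    then have "N \<subset> M" using m1.splits_off_psubset[OF N] by blast
    have sub: "m1.subspace N" "m2.subspace N'" "N' \<subseteq> M'"
      using N(1) N'(1) unfolding m1.splits_off_def m2.splits_off_def by blast+
    have "card (m1.kern N (g ^ j)) = card (m2.kern N' (g ^ j))" if g: "irreducible g" "monic g" for g j
    proof -
      let ?c = "card (m1.kern (range (\<lambda>p. s1 p v)) (g ^ j))"
      \<comment> \<open>The two cyclic summands have equal and positive counts; cancelling these in
        the product formula passes the hypothesis on to the complements.\<close>
      have "?c = card (m2.kern (range (\<lambda>p. s2 p v')) (g ^ j)) \<and> ?c > 0"
      proof (cases "g = f")
        case True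
        then show ?thesis
          unfolding True m1.card_kern_cyclic[OF N(2) f0] m2.card_kern_cyclic[OF N'(2) f0] by simp
      next
        case False
        then have "\<not> g dvd f" using monic_irreducible_dvd_eq f g by blast
        then show ?thesis
          using m1.kern_cyclic_other[OF N(2) g(1)] m2.kern_cyclic_other[OF N'(2) g(1)] by simp
      qed
      then show ?thesis
        using card_eq[OF g, of j] m1.card_kern_splits_off[OF N(1) M(1), of "g ^ j"]
          m2.card_kern_splits_off[OF N'(1) M'(1), of "g ^ j"] by simp
    qed
    then obtain \<phi> where "iso_on \<phi> N N'"
      using less.hyps[OF psubset_card_mono[OF M(2) \<open>N \<subset> M\<close>] sub(1) _ sub(2)]
        finite_subset[OF psubset_imp_subset[OF \<open>N \<subset> M\<close>] M(2)] finite_subset[OF sub(3) M'(2)] by blast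
    then show ?thesis using iso_on_extend[OF N(1) N'(1) M(1) M'(1) N(2) N'(2)] by blast
  qed
qed

end

section \<open>Cyclic decomposition of a primary module\<close>

context poly_module
begin

text \<open>The last conjunct says that the \<open>vs ! i\<close> are independent with orders \<open>f ^ (l ! i)\<close>.\<close>

definition primary_basis :: "'a poly \<Rightarrow> 'b set \<Rightarrow> nat list \<Rightarrow> 'b list \<Rightarrow> bool" where
  "primary_basis f M l vs \<longleftrightarrow> length vs = length l \<and> set vs \<subseteq> M \<and>
     (\<forall>x\<in>M. \<exists>c. x = (\<Sum>i<length l. c i *s vs ! i)) \<and>
     (\<forall>c. (\<Sum>i<length l. c i *s vs ! i) = 0 \<longleftrightarrow> (\<forall>i<length l. f ^ (l ! i) dvd c i))"

text \<open>The middle conjunct strengthens the induction. A part \<open>k\<close> of the complement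
  marks a strict growth of kernels at exponent \<open>k\<close>, in the complement and hence in
  \<open>M\<close>; beyond \<open>Suc m\<close> nothing grows, so \<open>k \<le> Suc m\<close> and
  prepending \<open>Suc m\<close> keeps the list weakly decreasing.\<close>

theorem exists_primary_basis:
  assumes "subspace M" "finite M" "irreducible f" "\<And>x. x \<in> M \<Longrightarrow> \<exists>k. f ^ k *s x = 0"
  shows "\<exists>l vs. is_partition l \<and> (\<forall>k\<in>set l. kern M (f ^ (k - 1)) \<noteq> kern M (f ^ k)) \<and>
    primary_basis f M l vs"
  using assms(1,2,4)
proof (induction "card M" arbitrary: M rule: less_induct)
  case less
  note M = less.prems(1,2) and f = assms(3)
  show ?case
  proof (cases "kern M f = {0}")
    case True
    have "x = 0" if "x \<in> M" for x
    proof -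
      obtain k where "f ^ k *s x = 0" using less.prems(3) \<open>x \<in> M\<close> by blast
      then show ?thesis
      proof (induction k)
        case (Suc k)
        have "f ^ k *s x \<in> kern M f"
          using Suc.prems subspace_scale[OF M(1) \<open>x \<in> M\<close>] by (simp add: kern_def)
        then show ?case using Suc.IH True by simp
      qed simp
    qed
    then have "primary_basis f M [] []" unfolding primary_basis_def by auto
    moreover have "is_partition []" by (simp add: is_partition_def)
    ultimately show ?thesis by (metis empty_iff empty_set)
  next
    case False
    obtain m where m: "\<And>k. card (kern M (f ^ k)) \<le> card (kern M (f ^ Suc m))"
      "card (kern M (f ^ m)) < card (kern M (f ^ Suc m))"
      using exists_top_power[OF M False] by blast
    obtain N v where N: "splits_off M N v" "has_order v (f ^ Suc m)"
      using split_cyclic[OF M f m] by blast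
    have "\<not> is_unit (f ^ Suc m)"
      using irreducible_not_unit[OF f] is_unit_power_iff[of f "Suc m"] by simp
    then have "N \<subset> M" using splits_off_psubset[OF N] by blast
    have sub: "subspace N" "v \<in> M" and ex: "\<And>x. x \<in> M \<Longrightarrow> \<exists>n\<in>N. \<exists>p. x = n + p *s v"
      using N(1) unfolding splits_off_def by blast+
    have "\<exists>l vs. is_partition l \<and> (\<forall>k\<in>set l. kern N (f ^ (k - 1)) \<noteq> kern N (f ^ k)) \<and>
      primary_basis f N l vs"
      using less.hyps[OF psubset_card_mono[OF M(2) \<open>N \<subset> M\<close>] sub(1)]
        finite_subset[OF psubset_imp_subset[OF \<open>N \<subset> M\<close>] M(2)] less.prems(3) \<open>N \<subset> M\<close> by blast
    then obtain l vs where l: "is_partition l" "\<And>k. k \<in> set l \<Longrightarrow> kern N (f ^ (k - 1)) \<noteq> kern N (f ^ k)"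
      and vs: "primary_basis f N l vs" by blast
    have len: "length vs = length l" and vsN: "set vs \<subseteq> N"
      and gen: "\<And>x. x \<in> N \<Longrightarrow> \<exists>c. x = (\<Sum>i<length l. c i *s vs ! i)"
      and ind: "\<And>c. (\<Sum>i<length l. c i *s vs ! i) = 0 \<longleftrightarrow> (\<forall>i<length l. f ^ (l ! i) dvd c i)"
      using vs unfolding primary_basis_def by blast+
    have kNM: "kern N h = kern M h \<inter> N" for h using \<open>N \<subset> M\<close> unfolding kern_def by blast
    have step: "kern M (f ^ (k - 1)) \<noteq> kern M (f ^ k)" if "k \<in> set l" for k
      using l(2)[OF that] unfolding kNM by blast
    have fin: "finite (kern M h)" for h using M(2) unfolding kern_def by simp
    have le: "k \<le> Suc m" if "k \<in> set l" for k
    proof (rule ccontr)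
      assume "\<not> k \<le> Suc m"
      then have "kern M (f ^ Suc m) \<subseteq> kern M (f ^ (k - 1))" by (intro kern_power_mono) simp
      then have "card (kern M (f ^ k)) \<le> card (kern M (f ^ (k - 1)))"
        using m(1)[of k] card_mono[OF fin] le_trans by blast
      moreover have "kern M (f ^ (k - 1)) \<subseteq> kern M (f ^ k)" by (intro kern_power_mono) simp
      ultimately have "kern M (f ^ (k - 1)) = kern M (f ^ k)" using fin by (intro card_seteq) auto
      then show False using step[OF that] by blast
    qed
    have "is_partition (Suc m # l)" using l(1) le unfolding is_partition_def by auto
    moreover have "\<forall>k\<in>set (Suc m # l). kern M (f ^ (k - 1)) \<noteq> kern M (f ^ k)"
      using step m(2) by auto
    moreover have "primary_basis f M (Suc m # l) (v # vs)" unfolding primary_basis_def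
    proof (intro conjI ballI allI)
      show "length (v # vs) = length (Suc m # l)" using len by simp
      show "set (v # vs) \<subseteq> M" using sub(2) vsN \<open>N \<subset> M\<close> by auto
    next
      fix x assume "x \<in> M"
      then obtain n p where x: "x = n + p *s v" "n \<in> N" using ex by meson
      obtain c where "n = (\<Sum>i<length l. c i *s vs ! i)" using gen[OF x(2)] by blast
      then have "x = (\<Sum>i<length (Suc m # l). case_nat p c i *s (v # vs) ! i)"
        unfolding x(1) by (simp add: sum.lessThan_Suc_shift add.commute del: sum.lessThan_Suc)
      then show "\<exists>c. x = (\<Sum>i<length (Suc m # l). c i *s (v # vs) ! i)" by blast
    next
      fix c
      let ?n = "\<Sum>i<length l. c (Suc i) *s vs ! i"
      have nN: "?n \<in> N" using vsN len by (intro subspace_sum[OF sub(1)] subspace_scale[OF sub(1)]) auto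
      have "(\<Sum>i<length (Suc m # l). c i *s (v # vs) ! i) = ?n + c 0 *s v"
        by (simp add: sum.lessThan_Suc_shift add.commute del: sum.lessThan_Suc)
      also have "\<dots> = 0 \<longleftrightarrow> ?n = 0 \<and> c 0 *s v = 0"
        using splits_off_unique[OF N(1) nN subspace_0[OF sub(1)], of "c 0" 0] by auto
      also have "\<dots> \<longleftrightarrow> (\<forall>i<length l. f ^ (l ! i) dvd c (Suc i)) \<and> f ^ Suc m dvd c 0"
        using ind[of "\<lambda>i. c (Suc i)"] N(2) unfolding has_order_def by auto
      also have "\<dots> \<longleftrightarrow> (\<forall>i<length (Suc m # l). f ^ ((Suc m # l) ! i) dvd c i)"
        by (auto simp: All_less_Suc2)
      finally show "(\<Sum>i<length (Suc m # l). c i *s (v # vs) ! i) = 0 \<longleftrightarrow>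
        (\<forall>i<length (Suc m # l). f ^ ((Suc m # l) ! i) dvd c i)" .
    qed
    ultimately show ?thesis by blast
  qed
qed

end

section \<open>Matrices as polynomial actions\<close>

text \<open>The coset of \<open>p\<close> modulo the ideal of \<open>q\<close>, stated by
  divisibility; computations in the quotient modules are reduced to it.\<close>

definition residue_class :: "'a::comm_ring_1 \<Rightarrow> 'a \<Rightarrow> 'a set" where
  "residue_class q p = {r. q dvd r - p}"

lemma residue_class_eq_iff: "residue_class q p = residue_class q p' \<longleftrightarrow> q dvd p - p'"
proof
  assume "residue_class q p = residue_class q p'"
  moreover have "p \<in> residue_class q p" unfolding residue_class_def by simp
  ultimately show "q dvd p - p'" unfolding residue_class_def by blast
next
  assume *: "q dvd p - p'"
  have "q dvd r - p \<longleftrightarrow> q dvd r - p'" for r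
  proof -
    have "r - p' = (r - p) + (p - p')" by simp
    then show ?thesis using * dvd_add_left_iff by metis
  qed
  then show "residue_class q p = residue_class q p'" unfolding residue_class_def by simp
qed

lemma coset_eq_residue_class: "PIdl\<^bsub>class_ring\<^esub> q +>\<^bsub>class_ring\<^esub> p = residue_class q p"
proof -
  have "q dvd r - p \<longleftrightarrow> (\<exists>x. r = x * q + p)" for r
  proof
    assume "q dvd r - p"
    then obtain x where "r - p = q * x" by (rule dvdE)
    then have "r = x * q + p" by (simp add: algebra_simps)
    then show "\<exists>x. r = x * q + p" by blast
  qed auto
  then show ?thesis
    unfolding residue_class_def a_r_coset_def' cgenideal_def by auto
qed

lemma PIdl_eq_residue_class: "PIdl\<^bsub>class_ring\<^esub> q = residue_class q 0"
  unfolding residue_class_def cgenideal_def by (auto elim!: dvdE simp: mult.commute)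

lemma quotient_module_simps:
  fixes q :: "'a::comm_ring_1"
  defines "M \<equiv> quotient_module class_ring (PIdl\<^bsub>class_ring\<^esub> q)"
  shows "carrier M = range (residue_class q)"
    and "\<zero>\<^bsub>M\<^esub> = residue_class q 0"
    and "residue_class q p \<oplus>\<^bsub>M\<^esub> residue_class q p' = residue_class q (p + p')"
    and "r \<odot>\<^bsub>M\<^esub> residue_class q p = residue_class q (r * p)"
proof -
  show "carrier M = range (residue_class q)"
    unfolding M_def quotient_module_def FactRing_def A_RCOSETS_def'
    by (auto simp: coset_eq_residue_class)
  show "\<zero>\<^bsub>M\<^esub> = residue_class q 0"
    unfolding M_def quotient_module_def FactRing_def by (simp add: PIdl_eq_residue_class)
  have "{x + y |x y. x \<in> residue_class q p \<and> y \<in> residue_class q p'} = residue_class q (p + p')"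
  proof (intro equalityI subsetI)
    fix z assume "z \<in> {x + y |x y. x \<in> residue_class q p \<and> y \<in> residue_class q p'}"
    then obtain x y where "z = x + y" "q dvd x - p" "q dvd y - p'" unfolding residue_class_def by blast
    moreover have "x + y - (p + p') = (x - p) + (y - p')" by simp
    ultimately show "z \<in> residue_class q (p + p')" unfolding residue_class_def by (metis dvd_add mem_Collect_eq)
  next
    fix z assume "z \<in> residue_class q (p + p')"
    then have "z - p' \<in> residue_class q p" unfolding residue_class_def by (simp add: algebra_simps)
    moreover have "p' \<in> residue_class q p'" unfolding residue_class_def by simp
    moreover have "z = (z - p') + p'" by simp
    ultimately show "z \<in> {x + y |x y. x \<in> residue_class q p \<and> y \<in> residue_class q p'}" by blast
  qed
  then show "residue_class q p \<oplus>\<^bsub>M\<^esub> residue_class q p' = residue_class q (p + p')"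
    unfolding M_def quotient_module_def FactRing_def set_add_def set_mult_def by (simp, blast)
  have "(\<Union>a\<in>residue_class q r. \<Union>b\<in>residue_class q p. residue_class q (a * b)) = residue_class q (r * p)"
  proof -
    have "residue_class q (a * b) = residue_class q (r * p)"
      if "a \<in> residue_class q r" "b \<in> residue_class q p" for a b
    proof -
      have "q dvd a - r" "q dvd b - p" using that unfolding residue_class_def by simp_all
      moreover have "a * b - r * p = (a - r) * b + r * (b - p)" by (simp add: algebra_simps)
      ultimately show ?thesis unfolding residue_class_eq_iff by (metis dvd_add dvd_mult dvd_mult2)
    qed
    moreover have "r \<in> residue_class q r" "p \<in> residue_class q p" unfolding residue_class_def by simp_all
    ultimately show ?thesis by blast
  qed
  then show "r \<odot>\<^bsub>M\<^esub> residue_class q p = residue_class q (r * p)"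
    unfolding M_def quotient_module_def FactRing_def rcoset_mult_def coset_eq_residue_class by simp
qed

section \<open>Evaluating polynomials at a matrix\<close>

lemma poly_mat_dim [simp]: "dim_row (poly_mat p A) = dim_row A" "dim_col (poly_mat p A) = dim_row A"
  by (simp_all add: poly_mat_def)

text \<open>The free bound \<open>m\<close> gives polynomials of different degrees a common range of
  summation.\<close>

lemma poly_mat_index:
  assumes "A \<in> carrier_mat n n" "i < n" "j < n" "degree p \<le> m"
  shows "poly_mat p A $$ (i, j) = (\<Sum>k\<le>m. coeff p k * (A ^\<^sub>m k) $$ (i, j))"
proof -
  have "poly_mat p A $$ (i, j) = (\<Sum>k\<le>degree p. coeff p k * (A ^\<^sub>m k) $$ (i, j))"
    using assms(1-3) by (simp add: poly_mat_def)
  also have "\<dots> = (\<Sum>k\<le>m. coeff p k * (A ^\<^sub>m k) $$ (i, j))"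
    using assms(4) by (intro sum.mono_neutral_left) (auto simp: coeff_eq_0)
  finally show ?thesis .
qed

lemma poly_mat_0: "poly_mat 0 A = 0\<^sub>m (dim_row A) (dim_row A)"
  by (intro eq_matI) (auto simp: poly_mat_def)

lemma poly_mat_1: "A \<in> carrier_mat n n \<Longrightarrow> poly_mat 1 A = 1\<^sub>m n"
  by (intro eq_matI) (auto simp: poly_mat_def)

lemma poly_mat_add:
  assumes A: "A \<in> carrier_mat n n"
  shows "poly_mat (p + q) A = poly_mat p A + poly_mat q A"
proof (rule eq_matI)
  fix i j assume "i < dim_row (poly_mat p A + poly_mat q A)" "j < dim_col (poly_mat p A + poly_mat q A)"
  then have ij: "i < n" "j < n" using A by (simp_all add: poly_mat_def)
  let ?m = "max (degree p) (degree q)"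
  show "poly_mat (p + q) A $$ (i, j) = (poly_mat p A + poly_mat q A) $$ (i, j)"
    using ij A poly_mat_index[OF A ij, of p ?m] poly_mat_index[OF A ij, of q ?m]
      poly_mat_index[OF A ij degree_add_le_max, of p q]
      poly_mat_carrier[OF A, of p] poly_mat_carrier[OF A, of q]
    by (simp add: ring_distribs sum.distrib)
qed (use A in \<open>auto simp: poly_mat_def\<close>)

lemma poly_mat_pCons:
  assumes A: "A \<in> carrier_mat n n"
  shows "poly_mat (pCons a p) A = a \<cdot>\<^sub>m 1\<^sub>m n + poly_mat p A * A"
proof (rule eq_matI)
  fix i j assume "i < dim_row (a \<cdot>\<^sub>m 1\<^sub>m n + poly_mat p A * A)" "j < dim_col (a \<cdot>\<^sub>m 1\<^sub>m n + poly_mat p A * A)"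
  then have ij: "i < n" "j < n" using A by simp_all
  have pow: "A ^\<^sub>m k \<in> carrier_mat n n" for k using A by simp
  have "poly_mat (pCons a p) A $$ (i, j) =
      (\<Sum>k\<le>Suc (degree p). coeff (pCons a p) k * (A ^\<^sub>m k) $$ (i, j))"
    by (rule poly_mat_index[OF A ij]) (simp add: degree_pCons_le)
  also have "\<dots> = a * (1\<^sub>m n) $$ (i, j) + (\<Sum>k\<le>degree p. coeff p k * (A ^\<^sub>m Suc k) $$ (i, j))"
    using A by (simp add: sum.atMost_Suc_shift del: sum.atMost_Suc pow_mat.simps(2))
  also have "(\<Sum>k\<le>degree p. coeff p k * (A ^\<^sub>m Suc k) $$ (i, j)) =
      (\<Sum>k\<le>degree p. \<Sum>l<n. coeff p k * (A ^\<^sub>m k) $$ (i, l) * A $$ (l, j))"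
    using A pow ij by (auto simp: scalar_prod_def lessThan_atLeast0 sum_distrib_left mult.assoc intro!: sum.cong)
  also have "\<dots> = (\<Sum>l<n. poly_mat p A $$ (i, l) * A $$ (l, j))"
    by (subst sum.swap) (auto simp: poly_mat_index[OF A ij(1) _ order.refl] sum_distrib_right intro!: sum.cong)
  also have "\<dots> = (poly_mat p A * A) $$ (i, j)"
    using A poly_mat_carrier[OF A, of p] ij by (simp add: scalar_prod_def lessThan_atLeast0)
  finally show "poly_mat (pCons a p) A $$ (i, j) = (a \<cdot>\<^sub>m 1\<^sub>m n + poly_mat p A * A) $$ (i, j)"
    using ij A by simp
qed (use A in \<open>auto simp: poly_mat_def\<close>)

lemma poly_mat_pCons_0:
  assumes A: "A \<in> carrier_mat n n"
  shows "poly_mat (pCons 0 p) A = poly_mat p A * A"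
  by (rule eq_matI) (use A in \<open>auto simp: poly_mat_pCons[OF A]\<close>)

lemma poly_mat_smult:
  assumes A: "A \<in> carrier_mat n n"
  shows "poly_mat (Polynomial.smult a p) A = a \<cdot>\<^sub>m poly_mat p A"
proof (rule eq_matI)
  fix i j assume "i < dim_row (a \<cdot>\<^sub>m poly_mat p A)" "j < dim_col (a \<cdot>\<^sub>m poly_mat p A)"
  then have ij: "i < n" "j < n" using A by simp_all
  show "poly_mat (Polynomial.smult a p) A $$ (i, j) = (a \<cdot>\<^sub>m poly_mat p A) $$ (i, j)"
    using poly_mat_index[OF A ij degree_smult_le, of a p] poly_mat_index[OF A ij order.refl, of p] ij A
    by (simp add: sum_distrib_left mult.assoc)
qed (use A in auto)

lemma poly_mat_mult:
  assumes A: "A \<in> carrier_mat n n"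
  shows "poly_mat (p * q) A = poly_mat p A * poly_mat q A"
proof (induction q)
  case 0
  then show ?case using A poly_mat_carrier[OF A, of p] by (simp add: poly_mat_0)
next
  case (pCons a q)
  note c = poly_mat_carrier[OF A, of p] poly_mat_carrier[OF A, of q]
  have "poly_mat (p * pCons a q) A = poly_mat (Polynomial.smult a p) A + poly_mat (pCons 0 (p * q)) A"
    by (simp add: mult_pCons_right poly_mat_add[OF A])
  also have "\<dots> = a \<cdot>\<^sub>m poly_mat p A + poly_mat p A * poly_mat q A * A"
    unfolding poly_mat_smult[OF A] poly_mat_pCons_0[OF A] pCons.IH ..
  also have "\<dots> = poly_mat p A * (a \<cdot>\<^sub>m 1\<^sub>m n) + poly_mat p A * (poly_mat q A * A)"
    using A c by (simp add: assoc_mult_mat[of _ n n _ n] mult_smult_distrib[of _ n n _ n])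
  also have "\<dots> = poly_mat p A * poly_mat (pCons a q) A"
    unfolding poly_mat_pCons[OF A] using A c by (subst mult_add_distrib_mat[of _ n n]) auto
  finally show ?case .
qed

lemma poly_mat_pcompose:
  assumes A: "A \<in> carrier_mat n n"
  shows "poly_mat (p \<circ>\<^sub>p F) A = poly_mat p (poly_mat F A)"
proof (induction p)
  case 0
  then show ?case using A poly_mat_carrier[OF A, of F] by (simp add: poly_mat_0)
next
  case (pCons a p)
  note Y = poly_mat_carrier[OF A, of F]
  have const: "poly_mat [:a:] A = a \<cdot>\<^sub>m 1\<^sub>m n" using A by (auto simp: poly_mat_pCons[OF A] poly_mat_0)
  have e: "pCons a p \<circ>\<^sub>p F = pCons a 0 + (p \<circ>\<^sub>p F) * F" by (simp add: pcompose_pCons mult.commute)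
  have "poly_mat (pCons a p \<circ>\<^sub>p F) A = a \<cdot>\<^sub>m 1\<^sub>m n + poly_mat p (poly_mat F A) * poly_mat F A"
    by (simp only: e poly_mat_add[OF A] poly_mat_mult[OF A] pCons.IH const)
  then show ?case by (simp only: poly_mat_pCons[OF Y])
qed

lemma poly_mat_X: "A \<in> carrier_mat n n \<Longrightarrow> poly_mat [:0, 1:] A = A"
  by (intro eq_matI) (auto simp: poly_mat_pCons poly_mat_0 scalar_prod_def sum.delta
    if_distrib[of "\<lambda>c. c * _"] cong: if_cong)

text \<open>Vectors of dimension \<open>n\<close> are represented inside the group \<open>nat \<Rightarrow> 'a\<close>; coordinates beyond
  the dimension carry the (irrelevant) action in which \<open>x\<close> acts as zero.\<close>

definition fvec :: "nat \<Rightarrow> (nat \<Rightarrow> 'a::zero) set" where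
  "fvec n = {v. \<forall>i\<ge>n. v i = 0}"

definition act :: "'a::comm_ring_1 mat \<Rightarrow> 'a poly \<Rightarrow> (nat \<Rightarrow> 'a) \<Rightarrow> nat \<Rightarrow> 'a" where
  "act A p v i = (if i < dim_row A then (\<Sum>j<dim_row A. poly_mat p A $$ (i, j) * v j) else coeff p 0 * v i)"

lemma act_poly_module:
  fixes A :: "'a::{field,finite} mat"
  assumes A: "A \<in> carrier_mat n n"
  shows "poly_module (act A)"
proof (unfold_locales, goal_cases)
  case (1 p x y)
  show ?case by (rule ext) (simp add: act_def ring_distribs sum.distrib)
next
  case (2 p q x)
  show ?case
    using A by (intro ext) (simp add: act_def ring_distribs sum.distrib poly_mat_add[OF A])
next
  case (3 p q x)
  show ?case
  proof (rule ext)
    fix i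
    show "act A p (act A q x) i = act A (p * q) x i"
    proof (cases "i < n")
      case True
      have "act A p (act A q x) i = (\<Sum>j<n. \<Sum>k<n. poly_mat p A $$ (i, j) * poly_mat q A $$ (j, k) * x k)"
        using True A by (simp add: act_def sum_distrib_left mult.assoc)
      also have "\<dots> = (\<Sum>k<n. (poly_mat p A * poly_mat q A) $$ (i, k) * x k)"
        using True A by (subst sum.swap) (auto simp: scalar_prod_def lessThan_atLeast0 sum_distrib_right intro!: sum.cong)
      finally show ?thesis using True A by (simp add: act_def poly_mat_mult[OF A])
    qed (use A in \<open>simp add: act_def coeff_mult_0 mult.assoc\<close>)
  qed
next
  case (4 x)
  show ?case
  proof (rule ext)
    fix i
    have "(\<Sum>j<n. (1\<^sub>m n) $$ (i, j) * x j) = (\<Sum>j<n. if j = i then x j else 0)" if "i < n"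
      using that by (intro sum.cong) auto
    then have "(\<Sum>j<n. (1\<^sub>m n) $$ (i, j) * x j) = x i" if "i < n"
      using that by simp
    then show "act A 1 x i = x i" using A by (simp add: act_def poly_mat_1[OF A])
  qed
qed

lemma fvec_subspace:
  fixes A :: "'a::{field,finite} mat"
  assumes A: "A \<in> carrier_mat n n"
  shows "Modules.module.subspace (act A) (fvec n)"
proof -
  interpret poly_module "act A" using act_poly_module[OF A] .
  show ?thesis by (rule subspaceI) (use A in \<open>auto simp: fvec_def act_def\<close>)
qed

lemma finite_fvec: "finite (fvec n :: (nat \<Rightarrow> 'a::{zero,finite}) set)"
proof -
  have "fvec n = {v :: nat \<Rightarrow> 'a. \<forall>i. (i \<in> {..<n} \<longrightarrow> v i \<in> UNIV) \<and> (i \<notin> {..<n} \<longrightarrow> v i = 0)}"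
    unfolding fvec_def by auto
  then show ?thesis using finite_set_of_finite_funs[of "{..<n}" "UNIV :: 'a set" 0] by simp
qed

lemma vec_act:
  assumes "A \<in> carrier_mat n n"
  shows "vec n (act A p v) = poly_mat p A *\<^sub>v vec n v"
  using assms poly_mat_carrier[OF assms, of p]
  by (intro eq_vecI) (auto simp: act_def scalar_prod_def lessThan_atLeast0)

lemma bij_betw_vec: "bij_betw (vec n) (fvec n) (carrier_vec n)"
  by (rule bij_betw_byWitness[of _ "\<lambda>v i. if i < n then v $ i else 0"]) (auto simp: fvec_def)

text \<open>The restriction to \<open>fvec n\<close> matters: beyond the dimension, the left side
  multiplies by the constant coefficient of \<open>p\<close> and the right side by that of
  \<open>p \<circ>\<^sub>p F\<close>, which need not agree unless the coordinates vanish.\<close>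

lemma act_pcompose:
  assumes A: "A \<in> carrier_mat n n" and v: "v \<in> fvec n"
  shows "act (poly_mat F A) p v = act A (p \<circ>\<^sub>p F) v"
proof (rule ext)
  fix i show "act (poly_mat F A) p v i = act A (p \<circ>\<^sub>p F) v i"
    using A v poly_mat_carrier[OF A, of F]
    by (auto simp: act_def fvec_def poly_mat_pcompose[OF A])
qed

section \<open>The partition of a primary component\<close>

text \<open>The growth from \<open>j\<close> to \<open>Suc j\<close> counts the parts larger than
  \<open>j\<close>; the differences of these counts are the multiplicities, and a decreasing list is
  determined by its multiset.\<close>

lemma partition_eqI:
  assumes "is_partition l" "is_partition l'"
    and eq: "\<And>j. (\<Sum>k\<leftarrow>l. min j k) = (\<Sum>k\<leftarrow>l'. min j k)"
  shows "l = l'"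
proof -
  have step: "(\<Sum>k\<leftarrow>m. min (Suc j) k) = (\<Sum>k\<leftarrow>m. min j k) + length (filter (\<lambda>k. j < k) m)" for j m
    by (induction m) auto
  have gt: "length (filter (\<lambda>k. j < k) l) = length (filter (\<lambda>k. j < k) l')" for j
    using step[of j l] step[of j l'] eq by simp
  have count: "length (filter (\<lambda>k. j < k) m) = count (mset m) (Suc j) + length (filter (\<lambda>k. Suc j < k) m)"
    for j m by (induction m) auto
  have "count (mset l) k = count (mset l') k" for k
  proof (cases k)
    case 0
    have "0 \<notin> set l" "0 \<notin> set l'" using assms(1,2) by (auto simp: is_partition_def)
    then show ?thesis unfolding 0 by (metis count_eq_zero_iff set_mset_mset)
  next
    case (Suc j)
    then show ?thesis using gt[of j] gt[of "Suc j"] count[of j l] count[of j l'] by simp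
  qed
  then have "mset (rev l) = mset (rev l')" by (simp add: multiset_eq_iff)
  moreover have "sorted (rev l)" "sorted (rev l')"
    using assms(1,2) by (simp_all add: is_partition_def sorted_wrt_rev)
  ultimately have "rev l = rev l'" using properties_for_sort[of "rev l" "rev l'"] by (simp add: sorted_sort_id)
  then show ?thesis by simp
qed

abbreviation cyclic_sum :: "'a::field poly \<Rightarrow> nat list \<Rightarrow> ('a poly, nat \<Rightarrow> 'a poly set) module" where
  "cyclic_sum f l \<equiv> direct_sum_modules
     (map (\<lambda>k. quotient_module class_ring (PIdl\<^bsub>class_ring\<^esub> (f ^ k))) l)"

lemma cyclic_sum_simps:
  shows "carrier (cyclic_sum f l) = (\<Pi>\<^sub>E i\<in>{..<length l}. range (residue_class (f ^ (l ! i))))"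
    and "\<zero>\<^bsub>cyclic_sum f l\<^esub> = (\<lambda>i\<in>{..<length l}. residue_class (f ^ (l ! i)) 0)"
    and "(\<lambda>i\<in>{..<length l}. residue_class (f ^ (l ! i)) (c i)) \<oplus>\<^bsub>cyclic_sum f l\<^esub>
           (\<lambda>i\<in>{..<length l}. residue_class (f ^ (l ! i)) (d i)) =
         (\<lambda>i\<in>{..<length l}. residue_class (f ^ (l ! i)) (c i + d i))"
    and "r \<odot>\<^bsub>cyclic_sum f l\<^esub> (\<lambda>i\<in>{..<length l}. residue_class (f ^ (l ! i)) (c i)) =
         (\<lambda>i\<in>{..<length l}. residue_class (f ^ (l ! i)) (r * c i))"
  by (auto simp: direct_sum_modules_def quotient_module_simps intro!: PiE_cong restrict_ext)

lemma cyclic_sum_carrierE: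
  assumes "\<xi> \<in> carrier (cyclic_sum f l)"
  obtains c where "\<xi> = (\<lambda>i\<in>{..<length l}. residue_class (f ^ (l ! i)) (c i))"
proof -
  have \<xi>: "\<xi> \<in> (\<Pi>\<^sub>E i\<in>{..<length l}. range (residue_class (f ^ (l ! i))))"
    using assms unfolding cyclic_sum_simps .
  then have "\<forall>i\<in>{..<length l}. \<exists>p. \<xi> i = residue_class (f ^ (l ! i)) p" by (auto simp: PiE_def Pi_def)
  then obtain c where "\<forall>i\<in>{..<length l}. \<xi> i = residue_class (f ^ (l ! i)) (c i)" by metis
  then have "\<xi> = (\<lambda>i\<in>{..<length l}. residue_class (f ^ (l ! i)) (c i))"
    using \<xi> by (intro ext) (auto simp: PiE_def extensional_def)
  then show ?thesis by (rule that)
qed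

text \<open>The kernel is a product over the summands, so the counts for single cyclic modules
  multiply.\<close>

lemma card_cyclic_sum_kernel:
  fixes f :: "'a::{field,finite} poly"
  assumes f: "f \<noteq> 0"
  shows "card {\<xi> \<in> carrier (cyclic_sum f l). f ^ j \<odot>\<^bsub>cyclic_sum f l\<^esub> \<xi> = \<zero>\<^bsub>cyclic_sum f l\<^esub>} =
    CARD('a) ^ (degree f * (\<Sum>k\<leftarrow>l. min j k))"
proof -
  let ?K = "\<lambda>i. residue_class (f ^ (l ! i)) ` {p. f ^ (l ! i) dvd f ^ j * p}"
  have "{\<xi> \<in> carrier (cyclic_sum f l). f ^ j \<odot>\<^bsub>cyclic_sum f l\<^esub> \<xi> = \<zero>\<^bsub>cyclic_sum f l\<^esub>} =
      (\<Pi>\<^sub>E i\<in>{..<length l}. ?K i)"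
  proof (intro equalityI subsetI)
    fix \<xi> assume *: "\<xi> \<in> {\<xi> \<in> carrier (cyclic_sum f l). f ^ j \<odot>\<^bsub>cyclic_sum f l\<^esub> \<xi> = \<zero>\<^bsub>cyclic_sum f l\<^esub>}"
    then obtain c where \<xi>: "\<xi> = (\<lambda>i\<in>{..<length l}. residue_class (f ^ (l ! i)) (c i))"
      by (blast elim: cyclic_sum_carrierE)
    have e: "(\<lambda>i\<in>{..<length l}. residue_class (f ^ (l ! i)) (f ^ j * c i)) =
        (\<lambda>i\<in>{..<length l}. residue_class (f ^ (l ! i)) 0)"
      using * cyclic_sum_simps(4)[of f l "f ^ j" c] cyclic_sum_simps(2)[of f l] unfolding \<xi> by simp
    have "f ^ (l ! i) dvd f ^ j * c i" if "i < length l" for i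
      using fun_cong[OF e, of i] that by (simp add: residue_class_eq_iff)
    then show "\<xi> \<in> (\<Pi>\<^sub>E i\<in>{..<length l}. ?K i)" unfolding \<xi> by (auto simp: PiE_def)
  next
    fix \<xi> assume \<xi>: "\<xi> \<in> (\<Pi>\<^sub>E i\<in>{..<length l}. ?K i)"
    then have "\<forall>i\<in>{..<length l}. \<exists>p. \<xi> i = residue_class (f ^ (l ! i)) p \<and> f ^ (l ! i) dvd f ^ j * p"
      by (auto simp: PiE_def Pi_def)
    then obtain c where c: "\<And>i. i < length l \<Longrightarrow> \<xi> i = residue_class (f ^ (l ! i)) (c i)"
      "\<And>i. i < length l \<Longrightarrow> f ^ (l ! i) dvd f ^ j * c i" by (metis lessThan_iff)
    have \<xi>': "\<xi> = (\<lambda>i\<in>{..<length l}. residue_class (f ^ (l ! i)) (c i))"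
      using \<xi> c(1) by (intro ext) (auto simp: PiE_def extensional_def)
    show "\<xi> \<in> {\<xi> \<in> carrier (cyclic_sum f l). f ^ j \<odot>\<^bsub>cyclic_sum f l\<^esub> \<xi> = \<zero>\<^bsub>cyclic_sum f l\<^esub>}"
      unfolding \<xi>' mem_Collect_eq cyclic_sum_simps
    proof (intro conjI)
      show "(\<lambda>i\<in>{..<length l}. residue_class (f ^ (l ! i)) (f ^ j * c i)) =
          (\<lambda>i\<in>{..<length l}. residue_class (f ^ (l ! i)) 0)"
        by (rule restrict_ext) (simp add: residue_class_eq_iff c(2))
    qed auto
  qed
  then have "card {\<xi> \<in> carrier (cyclic_sum f l). f ^ j \<odot>\<^bsub>cyclic_sum f l\<^esub> \<xi> = \<zero>\<^bsub>cyclic_sum f l\<^esub>} =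
      (\<Prod>i<length l. card (?K i))"
    by (simp add: card_PiE)
  also have "\<dots> = (\<Prod>i<length l. CARD('a) ^ (degree f * min j (l ! i)))"
    by (intro prod.cong refl card_cyclic_kernel[OF f]) (simp add: residue_class_eq_iff)
  also have "\<dots> = CARD('a) ^ (degree f * (\<Sum>i<length l. min j (l ! i)))"
    by (simp add: power_sum sum_distrib_left)
  also have "(\<Sum>i<length l. min j (l ! i)) = (\<Sum>k\<leftarrow>l. min j k)"
    by (simp add: sum_list_sum_nth lessThan_atLeast0)
  finally show ?thesis .
qed

abbreviation mat_kern :: "'a::{field,finite} mat \<Rightarrow> 'a poly \<Rightarrow> (nat \<Rightarrow> 'a) set" where
  "mat_kern A h \<equiv> poly_module.kern (act A) (fvec (dim_row A)) h"

lemma mat_kern_iff: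
  assumes "A \<in> carrier_mat n n"
  shows "v \<in> mat_kern A h \<longleftrightarrow> v \<in> fvec n \<and> act A h v = 0"
  using assms by (auto simp: poly_module.kern_def[OF act_poly_module[OF assms]])

lemma act_fvec: "A \<in> carrier_mat n n \<Longrightarrow> v \<in> fvec n \<Longrightarrow> act A p v \<in> fvec n"
  by (auto simp: act_def fvec_def)

lemma vec_eq_zero_iff:
  assumes "v \<in> fvec n"
  shows "vec n v = 0\<^sub>v n \<longleftrightarrow> v = 0"
proof
  assume *: "vec n v = 0\<^sub>v n"
  show "v = 0"
  proof (rule ext)
    fix i
    have "vec n v $ i = 0\<^sub>v n $ i" using * by simp
    then show "v i = 0 i" using assms by (cases "i < n") (auto simp: fvec_def)
  qed
qed auto

lemma primary_component_simps:
  assumes "A \<in> carrier_mat n n"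
  shows "carrier (primary_component f (mat_module A)) =
      {v \<in> carrier_vec n. \<exists>k. poly_mat (f ^ k) A *\<^sub>v v = 0\<^sub>v n}"
    and "add (primary_component f (mat_module A)) = (+)"
    and "smult (primary_component f (mat_module A)) = (\<lambda>F v. poly_mat F A *\<^sub>v v)"
  using assms by (auto simp: primary_component_def mat_module_def)

lemma bij_betw_mat_kern:
  assumes A: "A \<in> carrier_mat n n"
  shows "bij_betw (vec n) (mat_kern A h) {v \<in> carrier_vec n. poly_mat h A *\<^sub>v v = 0\<^sub>v n}"
proof -
  have iff: "poly_mat h A *\<^sub>v vec n v = 0\<^sub>v n \<longleftrightarrow> act A h v = 0" if "v \<in> fvec n" for v
    unfolding vec_act[OF A, symmetric] by (rule vec_eq_zero_iff[OF act_fvec[OF A that]])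
  have "vec n ` mat_kern A h = {v \<in> carrier_vec n. poly_mat h A *\<^sub>v v = 0\<^sub>v n}"
  proof (intro equalityI subsetI)
    fix w assume "w \<in> {v \<in> carrier_vec n. poly_mat h A *\<^sub>v v = 0\<^sub>v n}"
    then have w: "w \<in> carrier_vec n" "poly_mat h A *\<^sub>v w = 0\<^sub>v n" by simp_all
    then obtain v where "v \<in> fvec n" "w = vec n v" using bij_betw_vec unfolding bij_betw_def by blast
    then show "w \<in> vec n ` mat_kern A h" using w(2) iff mat_kern_iff[OF A] by auto
  qed (use iff mat_kern_iff[OF A] in auto)
  moreover have "inj_on (vec n) (mat_kern A h)"
    using bij_betw_vec mat_kern_iff[OF A] unfolding bij_betw_def by (metis inj_on_subset subsetI)
  ultimately show ?thesis unfolding bij_betw_def by blast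
qed

text \<open>All of the kernel of \<open>f ^ j\<close> lies in the primary component, so the
  isomorphism maps it onto the corresponding kernel in the cyclic sum, where it has been
  counted.\<close>

lemma card_mat_kern_if_isomorphic:
  fixes A :: "'a::{field,finite} mat"
  assumes A: "A \<in> carrier_mat n n" and f: "f \<noteq> 0"
    and iso: "module_isomorphic class_ring (primary_component f (mat_module A)) (cyclic_sum f l)"
  shows "card (mat_kern A (f ^ j)) = CARD('a) ^ (degree f * (\<Sum>k\<leftarrow>l. min j k))"
proof -
  let ?M = "primary_component f (mat_module A)" and ?D = "cyclic_sum f l"
  note M = primary_component_simps[OF A, of f]
  obtain h where h: "h \<in> module_hom class_ring ?M ?D" and bij: "bij_betw h (carrier ?M) (carrier ?D)"
    using iso unfolding module_isomorphic_def by blast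
  let ?K = "{v \<in> carrier_vec n. poly_mat (f ^ j) A *\<^sub>v v = 0\<^sub>v n}"
  let ?L = "{\<xi> \<in> carrier ?D. f ^ j \<odot>\<^bsub>?D\<^esub> \<xi> = \<zero>\<^bsub>?D\<^esub>}"
  have KM: "?K \<subseteq> carrier ?M" unfolding M by blast
  have zM: "0\<^sub>v n \<in> carrier ?M" unfolding M by (auto intro!: exI[of _ 0] simp: poly_mat_1[OF A])
  \<comment> \<open>\<open>module_hom\<close> requires nothing about zero elements. That zero goes
    to zero is obtained from the scalar 0, which turns every component into the class of 0.\<close>
  have zero: "h (poly_mat 0 A *\<^sub>v v) = \<zero>\<^bsub>?D\<^esub>" if "v \<in> carrier ?M" for v
  proof -
    have "h v \<in> carrier ?D" using bij_betwE[OF bij] that by blast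
    then obtain c where "h v = (\<lambda>i\<in>{..<length l}. residue_class (f ^ (l ! i)) (c i))"
      by (rule cyclic_sum_carrierE)
    moreover have "h (0 \<odot>\<^bsub>?M\<^esub> v) = 0 \<odot>\<^bsub>?D\<^esub> h v" using module_hom_smult[OF h _ that] by simp
    ultimately show ?thesis by (simp add: M cyclic_sum_simps)
  qed
  have z0: "poly_mat 0 A *\<^sub>v v = 0\<^sub>v n" if "v \<in> carrier ?M" for v
    using that A unfolding M poly_mat_0 by auto
  have iff: "v \<in> ?K \<longleftrightarrow> h v \<in> ?L" if v: "v \<in> carrier ?M" for v
  proof -
    obtain k where k: "poly_mat (f ^ k) A *\<^sub>v v = 0\<^sub>v n" and vn: "v \<in> carrier_vec n" using v unfolding M by blast
    note c = poly_mat_carrier[OF A, of "f ^ k"] poly_mat_carrier[OF A, of "f ^ j"]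
    have "poly_mat (f ^ k) A *\<^sub>v (poly_mat (f ^ j) A *\<^sub>v v) = poly_mat (f ^ j * f ^ k) A *\<^sub>v v"
      using c vn by (simp add: mult.commute[of "f ^ j"] poly_mat_mult[OF A] assoc_mult_mat_vec[of _ n n _ n])
    also have "\<dots> = poly_mat (f ^ j) A *\<^sub>v 0\<^sub>v n"
      using c vn by (simp add: poly_mat_mult[OF A] assoc_mult_mat_vec[of _ n n _ n] k)
    also have "\<dots> = 0\<^sub>v n" using A by (intro eq_vecI) (auto simp: scalar_prod_def)
    finally have fv: "poly_mat (f ^ j) A *\<^sub>v v \<in> carrier ?M"
      unfolding M using mult_mat_vec_carrier[OF c(2) vn] by blast
    have e: "f ^ j \<odot>\<^bsub>?D\<^esub> h v = h (poly_mat (f ^ j) A *\<^sub>v v)"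
      using module_hom_smult[OF h _ v, of "f ^ j"] by (simp add: M)
    have z: "\<zero>\<^bsub>?D\<^esub> = h (0\<^sub>v n)" using zero[OF v] z0[OF v] by simp
    have "f ^ j \<odot>\<^bsub>?D\<^esub> h v = \<zero>\<^bsub>?D\<^esub> \<longleftrightarrow> poly_mat (f ^ j) A *\<^sub>v v = 0\<^sub>v n"
      unfolding e z using bij fv zM unfolding bij_betw_def by (metis inj_on_eq_iff)
    then show ?thesis using vn bij_betwE[OF bij] v by blast
  qed
  have "h ` ?K = ?L"
  proof (intro equalityI subsetI)
    fix \<xi> assume \<xi>: "\<xi> \<in> ?L"
    then obtain v where v: "v \<in> carrier ?M" "\<xi> = h v" using bij unfolding bij_betw_def by blast
    then have "v \<in> ?K" using \<xi> iff[OF v(1)] by metis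
    then show "\<xi> \<in> h ` ?K" unfolding v(2) by (rule imageI)
  next
    fix \<xi> assume "\<xi> \<in> h ` ?K"
    then obtain v where v: "v \<in> ?K" "\<xi> = h v" by blast
    show "\<xi> \<in> ?L" unfolding v(2) using iff[OF subsetD[OF KM v(1)]] v(1) by (rule iffD1)
  qed
  then have "card ?K = card ?L"
    using card_image[OF inj_on_subset[OF bij_betw_imp_inj_on[OF bij] KM]] by (simp only:)
  then show ?thesis
    by (simp only: bij_betw_same_card[OF bij_betw_mat_kern[OF A]] card_cyclic_sum_kernel[OF f])
qed

lemma primary_component_isomorphic_cyclic_sum:
  fixes A :: "'a::{field,finite} mat"
  assumes A: "A \<in> carrier_mat n n" and f: "irreducible f"
  shows "\<exists>l. is_partition l \<and>
    module_isomorphic class_ring (primary_component f (mat_module A)) (cyclic_sum f l)"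
proof -
  interpret poly_module "act A" using act_poly_module[OF A] .
  note M = primary_component_simps[OF A, of f]
  let ?M = "primary_component f (mat_module A)"
  define V where "V = {v \<in> fvec n. \<exists>k. act A (f ^ k) v = 0}"
  note sub = fvec_subspace[OF A]
  have subV: "subspace V"
  proof (rule subspaceI)
    show "0 \<in> V" using subspace_0[OF sub] unfolding V_def by auto
  next
    fix x y assume "x \<in> V" "y \<in> V"
    then obtain k m where x: "x \<in> fvec n" "act A (f ^ k) x = 0" and y: "y \<in> fvec n" "act A (f ^ m) y = 0"
      unfolding V_def by blast
    have "act A (f ^ (m + k)) (x + y) = act A (f ^ m) (act A (f ^ k) x) + act A (f ^ k) (act A (f ^ m) y)"
      by (simp add: power_add scale_right_distrib mult.commute)
    then have "act A (f ^ (m + k)) (x + y) = 0" using x y by (simp del: scale_scale)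
    then show "x + y \<in> V" using subspace_add[OF sub x(1) y(1)] unfolding V_def by blast
  next
    fix c x assume "x \<in> V"
    then obtain k where x: "x \<in> fvec n" "act A (f ^ k) x = 0" unfolding V_def by blast
    then show "act A c x \<in> V"
      using subspace_scale[OF sub x(1)] annihilates_multiple[OF x(2)] unfolding V_def by blast
  qed
  have "finite V" by (rule finite_subset[OF _ finite_fvec[of n]]) (auto simp: V_def)
  moreover have "\<exists>k. act A (f ^ k) x = 0" if "x \<in> V" for x using that unfolding V_def by blast
  ultimately obtain l vs where l: "is_partition l" and "primary_basis f V l vs"
    using exists_primary_basis[OF subV _ f] by metis
  then have len: "length vs = length l" and vsV: "set vs \<subseteq> V"
    and gen: "\<And>x. x \<in> V \<Longrightarrow> \<exists>c. x = (\<Sum>i<length l. act A (c i) (vs ! i))"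
    and ind: "\<And>c. (\<Sum>i<length l. act A (c i) (vs ! i)) = 0 \<longleftrightarrow> (\<forall>i<length l. f ^ (l ! i) dvd c i)"
    unfolding primary_basis_def by blast+
  \<comment> \<open>Coefficient tuples map onto both sides: \<open>S\<close> to the primary
    component, \<open>R\<close> to the cyclic sum. Independence of \<open>vs\<close> makes their
    fibres equal, so \<open>S c\<close> \<mapsto> \<open>R c\<close> is a bijection; it is a
    homomorphism because both maps respect sums and scalars.\<close>
  define S where "S c = (\<Sum>i<length l. act A (c i) (vs ! i))" for c
  define R where "R c = (\<lambda>i\<in>{..<length l}. residue_class (f ^ (l ! i)) (c i))" for c
  have SV: "S c \<in> V" for c
    unfolding S_def using vsV len by (intro subspace_sum[OF subV] subspace_scale[OF subV]) auto
  have eq: "S c = S d \<longleftrightarrow> R c = R d" for c d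
  proof -
    have "S c - S d = S (\<lambda>i. c i - d i)"
      unfolding S_def by (simp add: scale_left_diff_distrib sum_subtractf)
    then have "S c = S d \<longleftrightarrow> S (\<lambda>i. c i - d i) = 0" by (metis right_minus_eq)
    also have "\<dots> \<longleftrightarrow> (\<forall>i<length l. f ^ (l ! i) dvd c i - d i)" unfolding S_def ind ..
    also have "\<dots> \<longleftrightarrow> R c = R d"
      unfolding R_def residue_class_eq_iff[symmetric] by (auto simp: fun_eq_iff restrict_def)
    finally show ?thesis .
  qed
  have VM: "bij_betw (vec n) V (carrier ?M)"
  proof -
    have iff: "vec n v \<in> carrier ?M \<longleftrightarrow> v \<in> V" if "v \<in> fvec n" for v
      unfolding M V_def vec_act[OF A, symmetric] mem_Collect_eq
      using that vec_eq_zero_iff[OF act_fvec[OF A that]] by auto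
    have "vec n ` V = carrier ?M"
    proof (intro equalityI subsetI)
      fix w assume w: "w \<in> carrier ?M"
      then have "w \<in> carrier_vec n" unfolding M by blast
      then obtain v where "v \<in> fvec n" "w = vec n v" using bij_betw_vec unfolding bij_betw_def by blast
      then show "w \<in> vec n ` V" using w iff[of v] by blast
    next
      fix w assume "w \<in> vec n ` V"
      then obtain v where v: "v \<in> V" "w = vec n v" by blast
      then have "v \<in> fvec n" unfolding V_def by blast
      then show "w \<in> carrier ?M" unfolding v(2) using iff v(1) by (metis (full_types))
    qed
    moreover have "inj_on (vec n) V"
      by (rule inj_on_subset[OF bij_betw_imp_inj_on[OF bij_betw_vec]]) (auto simp: V_def)
    ultimately show ?thesis unfolding bij_betw_def by blast
  qed
  have exS: "\<exists>c. w = vec n (S c)" if "w \<in> carrier ?M" for w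
  proof -
    have "w \<in> vec n ` V" using bij_betw_imp_surj_on[OF VM] that by simp
    then obtain v where v: "w = vec n v" "v \<in> V" by (rule imageE)
    obtain c where "v = S c" using gen[OF v(2)] unfolding S_def by (elim exE)
    then show ?thesis unfolding v(1) by (intro exI[of _ c]) simp
  qed
  have vS: "vec n (S c) \<in> carrier ?M" for c using bij_betwE[OF VM] SV by blast
  \<comment> \<open>Any representing tuple may be chosen, since by \<open>eq\<close> the value does
    not depend on it.\<close>
  define h where "h w = R (SOME c. w = vec n (S c))" for w
  have h: "h (vec n (S c)) = R c" for c
  proof -
    let ?d = "SOME d. vec n (S c) = vec n (S d)"
    have "vec n (S c) = vec n (S ?d)" by (rule someI[of "\<lambda>d. vec n (S c) = vec n (S d)" c]) (rule refl)
    then have "S c = S ?d" by (rule inj_onD[OF bij_betw_imp_inj_on[OF VM] _ SV SV])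
    then show ?thesis unfolding h_def eq by (rule sym)
  qed
  have RD: "R c \<in> carrier (cyclic_sum f l)" for c unfolding cyclic_sum_simps R_def by auto
  have hD: "h w \<in> carrier (cyclic_sum f l)" if w: "w \<in> carrier ?M" for w
  proof -
    obtain c where c: "w = vec n (S c)" using exS[OF w] by (elim exE)
    show ?thesis unfolding c h by (rule RD)
  qed
  have "h \<in> module_hom class_ring ?M (cyclic_sum f l)"
    unfolding module_hom_def
  proof (intro CollectI conjI allI impI)
    show "h \<in> carrier ?M \<rightarrow> carrier (cyclic_sum f l)" using hD by (rule Pi_I)
  next
    fix u w assume uw: "u \<in> carrier ?M \<and> w \<in> carrier ?M"
    obtain c where u: "u = vec n (S c)" using exS[OF conjunct1[OF uw]] by (elim exE)
    obtain d where w: "w = vec n (S d)" using exS[OF conjunct2[OF uw]] by (elim exE)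
    have "u + w = vec n (S (\<lambda>i. c i + d i))"
      unfolding u w S_def by (intro eq_vecI) (auto simp: scale_left_distrib sum.distrib)
    then have "h (u + w) = R (\<lambda>i. c i + d i)" using h by simp
    then show "h (u \<oplus>\<^bsub>?M\<^esub> w) = h u \<oplus>\<^bsub>cyclic_sum f l\<^esub> h w"
      unfolding M u w h R_def cyclic_sum_simps .
  next
    fix F :: "'a poly" and w assume Fw: "F \<in> carrier class_ring \<and> w \<in> carrier ?M"
    obtain c where w: "w = vec n (S c)" using exS[OF conjunct2[OF Fw]] by (elim exE)
    have "act A F (S c) = S (\<lambda>i. F * c i)" unfolding S_def by (simp add: scale_sum_right)
    then have "poly_mat F A *\<^sub>v w = vec n (S (\<lambda>i. F * c i))" unfolding w vec_act[OF A, symmetric] by simp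
    then have "h (poly_mat F A *\<^sub>v w) = R (\<lambda>i. F * c i)" using h by simp
    then show "h (F \<odot>\<^bsub>?M\<^esub> w) = F \<odot>\<^bsub>cyclic_sum f l\<^esub> h w"
      unfolding M w h R_def cyclic_sum_simps .
  qed
  moreover have "bij_betw h (carrier ?M) (carrier (cyclic_sum f l))"
    unfolding bij_betw_def
  proof (intro conjI equalityI subsetI)
    show "inj_on h (carrier ?M)"
    proof (rule inj_onI)
      fix u w assume uw: "u \<in> carrier ?M" "w \<in> carrier ?M" "h u = h w"
      obtain c where u: "u = vec n (S c)" using exS[OF uw(1)] by (elim exE)
      obtain d where w: "w = vec n (S d)" using exS[OF uw(2)] by (elim exE)
      have "S c = S d" using uw(3) unfolding u w h eq .
      then show "u = w" unfolding u w by (rule arg_cong)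
    qed
  next
    fix \<xi> assume "\<xi> \<in> h ` carrier ?M"
    then show "\<xi> \<in> carrier (cyclic_sum f l)" using hD by (elim imageE) simp
  next
    fix \<xi> assume "\<xi> \<in> carrier (cyclic_sum f l)"
    then obtain c where \<xi>: "\<xi> = R c" unfolding R_def by (rule cyclic_sum_carrierE)
    show "\<xi> \<in> h ` carrier ?M" unfolding \<xi> h[symmetric] by (rule imageI[OF vS])
  qed
  ultimately show ?thesis using l unfolding module_isomorphic_def by blast
qed

text \<open>Existence and uniqueness of the partition, so that the \<open>THE\<close> in its
  definition denotes. For uniqueness, two such cyclic sums have equal kernel counts, and as
  \<open>CARD('a) > 1\<close> and \<open>degree f > 0\<close> the exponents, hence the parts, can be
  read off.\<close>

theorem primary_partition_spec:
  fixes A :: "'a::{field,finite} mat"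
  assumes A: "A \<in> carrier_mat n n" and f: "irreducible f"
  shows "is_partition (primary_partition A f)"
    and "card (mat_kern A (f ^ j)) = CARD('a) ^ (degree f * (\<Sum>k\<leftarrow>primary_partition A f. min j k))"
proof -
  let ?P = "\<lambda>l. is_partition l \<and>
    module_isomorphic class_ring (primary_component f (mat_module A)) (cyclic_sum f l)"
  have f0: "f \<noteq> 0" using f by auto
  obtain l where l: "?P l" using primary_component_isomorphic_cyclic_sum[OF A f] by blast
  have "l' = l" if "?P l'" for l'
  proof (rule partition_eqI)
    fix j
    have "CARD('a) ^ (degree f * (\<Sum>k\<leftarrow>l'. min j k)) = CARD('a) ^ (degree f * (\<Sum>k\<leftarrow>l. min j k))"
      using card_mat_kern_if_isomorphic[OF A f0, of l' j] card_mat_kern_if_isomorphic[OF A f0, of l j]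
        l that by simp
    moreover have "CARD('a) > 1" using card_mono[of UNIV "{0::'a, 1}"] by simp
    ultimately show "(\<Sum>k\<leftarrow>l'. min j k) = (\<Sum>k\<leftarrow>l. min j k)"
      using degree_irreducible_pos[OF f] by (simp add: power_inject_exp)
  qed (use l that in blast)+
  then have "primary_partition A f = l" unfolding primary_partition_def using l by (intro the_equality)
  then show "is_partition (primary_partition A f)"
    "card (mat_kern A (f ^ j)) = CARD('a) ^ (degree f * (\<Sum>k\<leftarrow>primary_partition A f. min j k))"
    using l card_mat_kern_if_isomorphic[OF A f0, of l j] by simp_all
qed

section \<open>Similarity and the characteristic polynomial\<close>

definition unit_fun :: "nat \<Rightarrow> nat \<Rightarrow> 'a::{zero,one}" where
  "unit_fun j i = (if i = j then 1 else 0)"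

lemma unit_fun_fvec: "j < n \<Longrightarrow> unit_fun j \<in> fvec n"
  by (auto simp: unit_fun_def fvec_def)

lemma mult_mat_unit_fun:
  fixes M :: "'a::comm_ring_1 mat"
  assumes "M \<in> carrier_mat n n" "i < n" "j < n"
  shows "(M *\<^sub>v vec n (unit_fun j)) $ i = M $$ (i, j)"
proof -
  have "(M *\<^sub>v vec n (unit_fun j)) $ i = (\<Sum>k<n. M $$ (i, k) * unit_fun j k)"
    using assms by (simp add: scalar_prod_def lessThan_atLeast0)
  also have "\<dots> = (\<Sum>k<n. if k = j then M $$ (i, k) else 0)"
    by (intro sum.cong) (auto simp: unit_fun_def)
  finally show ?thesis using assms(3) by simp
qed

lemma mat_eqI_fvec:
  fixes M N :: "'a::comm_ring_1 mat"
  assumes "M \<in> carrier_mat n n" "N \<in> carrier_mat n n"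
    and "\<And>v. v \<in> fvec n \<Longrightarrow> M *\<^sub>v vec n v = N *\<^sub>v vec n v"
  shows "M = N"
proof (rule eq_matI)
  fix i j assume "i < dim_row N" "j < dim_col N"
  then have ij: "i < n" "j < n" using assms(2) by simp_all
  show "M $$ (i, j) = N $$ (i, j)"
    using mult_mat_unit_fun[OF assms(1) ij] mult_mat_unit_fun[OF assms(2) ij]
      assms(3)[OF unit_fun_fvec[OF ij(2)]] by simp
qed (use assms in auto)

lemma linear_map_matrix:
  fixes \<phi> :: "(nat \<Rightarrow> 'a::comm_ring_1) \<Rightarrow> nat \<Rightarrow> 'a"
  assumes add: "\<And>x y. x \<in> fvec n \<Longrightarrow> y \<in> fvec n \<Longrightarrow> \<phi> (x + y) = \<phi> x + \<phi> y"
    and scale: "\<And>c x. x \<in> fvec n \<Longrightarrow> \<phi> (\<lambda>i. c * x i) = (\<lambda>i. c * \<phi> x i)"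
  obtains P where "P \<in> carrier_mat n n" "\<And>v. v \<in> fvec n \<Longrightarrow> vec n (\<phi> v) = P *\<^sub>v vec n v"
proof (rule that)
  let ?P = "mat n n (\<lambda>(i, j). \<phi> (unit_fun j) i)"
  show "?P \<in> carrier_mat n n" by simp
  fix v :: "nat \<Rightarrow> 'a" assume v: "v \<in> fvec n"
  \<comment> \<open>Induction over the truncations of \<open>v\<close> to its first \<open>m\<close>
    coordinates, each step adding one multiple of a unit vector.\<close>
  have "(\<lambda>i. if i < m then v i else 0) \<in> fvec n \<and>
      \<phi> (\<lambda>i. if i < m then v i else 0) = (\<lambda>i. \<Sum>j<m. v j * \<phi> (unit_fun j) i)" if "m \<le> n" for m
    using that
  proof (induction m)
    case 0
    have z: "(\<lambda>i. 0) \<in> fvec n" by (simp add: fvec_def)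
    have "\<phi> (\<lambda>i. 0 * (0::'a)) = (\<lambda>i. 0 * \<phi> (\<lambda>i. 0) i)" by (rule scale[OF z])
    then show ?case using z by simp
  next
    case (Suc m)
    let ?u = "\<lambda>i. v m * unit_fun m i"
    have e: "(\<lambda>i. if i < Suc m then v i else 0) = (\<lambda>i. if i < m then v i else 0) + ?u"
      by (auto simp: unit_fun_def less_Suc_eq)
    have u: "(unit_fun m :: nat \<Rightarrow> 'a) \<in> fvec n" using Suc.prems by (intro unit_fun_fvec) simp
    then have "?u \<in> fvec n" by (simp add: fvec_def)
    then have "\<phi> (\<lambda>i. if i < Suc m then v i else 0) =
        \<phi> (\<lambda>i. if i < m then v i else 0) + (\<lambda>i. v m * \<phi> (unit_fun m) i)"
      unfolding e using Suc scale[OF u, of "v m"] by (subst add) simp_all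
    moreover have "(\<lambda>i. if i < Suc m then v i else 0) \<in> fvec n"
      using v by (auto simp: fvec_def)
    ultimately show ?case using Suc by (auto simp: fun_eq_iff)
  qed
  from this[of n] have "\<phi> (\<lambda>i. if i < n then v i else 0) = (\<lambda>i. \<Sum>j<n. v j * \<phi> (unit_fun j) i)"
    by simp
  moreover have "(\<lambda>i. if i < n then v i else 0) = v" using v by (auto simp: fvec_def)
  ultimately have \<phi>v: "\<phi> v = (\<lambda>i. \<Sum>j<n. v j * \<phi> (unit_fun j) i)" by simp
  show "vec n (\<phi> v) = ?P *\<^sub>v vec n v"
    unfolding \<phi>v by (intro eq_vecI) (auto simp: scalar_prod_def lessThan_atLeast0 mult.commute intro!: sum.cong)
qed

lemma act_const:
  assumes A: "A \<in> carrier_mat n n"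
  shows "act A [:c:] v = (\<lambda>i. c * v i)"
proof (rule ext)
  fix i
  have "poly_mat [:c:] A = c \<cdot>\<^sub>m 1\<^sub>m n" using A by (auto simp: poly_mat_pCons[OF A] poly_mat_0)
  then have "act A [:c:] v i = (\<Sum>j<n. (c \<cdot>\<^sub>m 1\<^sub>m n) $$ (i, j) * v j)" if "i < n"
    using A that by (simp only: act_def carrier_matD if_True)
  moreover have "(\<Sum>j<n. (c \<cdot>\<^sub>m 1\<^sub>m n) $$ (i, j) * v j) = (\<Sum>j<n. if j = i then c * v j else 0)" if "i < n"
    using that by (intro sum.cong) auto
  ultimately show "act A [:c:] v i = c * v i" using A by (cases "i < n") (auto simp: act_def)
qed

lemma act_unit_fun:
  assumes A: "A \<in> carrier_mat n n" and "j < n" "i < n"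
  shows "act A p (unit_fun j) i = poly_mat p A $$ (i, j)"
proof -
  have "act A p (unit_fun j) i = vec n (act A p (unit_fun j)) $ i" using assms(3) by simp
  then show ?thesis unfolding vec_act[OF A] using mult_mat_unit_fun[OF poly_mat_carrier[OF A] assms(3,2)] by simp
qed

text \<open>An isomorphism of the two actions is linear over the field because constants act as
  scalars, and it intertwines \<open>A\<close> with \<open>B\<close> because \<open>[:0, 1:]\<close>
  acts as the matrix. Its matrix and that of its inverse witness similarity.\<close>

theorem similar_if_equal_kernels:
  fixes A B :: "'a::{field,finite} mat"
  assumes A: "A \<in> carrier_mat n n" and B: "B \<in> carrier_mat n n"
    and kern: "\<And>f j. irreducible f \<Longrightarrow> monic f \<Longrightarrow> card (mat_kern A (f ^ j)) = card (mat_kern B (f ^ j))"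
  shows "similar_mat A B"
proof -
  interpret poly_module_pair "act A" "act B"
    using act_poly_module[OF A] act_poly_module[OF B] by (simp add: poly_module_pair_def)
  have dims: "dim_row A = n" "dim_row B = n" using A B by auto
  obtain \<phi> where \<phi>: "iso_on \<phi> (fvec n) (fvec n)"
    using iso_if_equal_kernels[OF fvec_subspace[OF A] finite_fvec fvec_subspace[OF B] finite_fvec]
      kern unfolding dims by blast
  then have bij: "bij_betw \<phi> (fvec n) (fvec n)"
    and add: "\<And>x y. x \<in> fvec n \<Longrightarrow> y \<in> fvec n \<Longrightarrow> \<phi> (x + y) = \<phi> x + \<phi> y"
    and sc: "\<And>p x. x \<in> fvec n \<Longrightarrow> \<phi> (act A p x) = act B p (\<phi> x)"
    unfolding iso_on_def by blast+
  define \<psi> where "\<psi> = inv_into (fvec n) \<phi>"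
  have \<phi>V: "\<phi> x \<in> fvec n" if "x \<in> fvec n" for x using bij_betwE[OF bij] that by simp
  have \<psi>V: "\<psi> y \<in> fvec n" "\<phi> (\<psi> y) = y" if "y \<in> fvec n" for y
    unfolding \<psi>_def using bij that
    by (simp_all add: bij_betw_inv_into_right bij_betwE[OF bij_betw_inv_into[OF bij]])
  have \<psi>\<phi>: "\<psi> (\<phi> x) = x" if "x \<in> fvec n" for x
    unfolding \<psi>_def using bij that by (simp add: bij_betw_inv_into_left)
  have scaleV: "(\<lambda>i. c * x i) \<in> fvec n" if "x \<in> fvec n" for c and x :: "nat \<Rightarrow> 'a"
    using that by (simp add: fvec_def)
  have addV: "x + y \<in> fvec n" if "x \<in> fvec n" "y \<in> fvec n" for x y :: "nat \<Rightarrow> 'a"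
    using that by (simp add: fvec_def)
  have scale: "\<phi> (\<lambda>i. c * x i) = (\<lambda>i. c * \<phi> x i)" if "x \<in> fvec n" for c x
    using sc[OF that, of "[:c:]"] by (simp add: act_const[OF A] act_const[OF B])
  obtain P where P: "P \<in> carrier_mat n n" "\<And>v. v \<in> fvec n \<Longrightarrow> vec n (\<phi> v) = P *\<^sub>v vec n v"
    using linear_map_matrix[of n \<phi>] add scale by blast
  have "\<psi> (x + y) = \<psi> x + \<psi> y" if x: "x \<in> fvec n" and y: "y \<in> fvec n" for x y
  proof -
    have "\<phi> (\<psi> x + \<psi> y) = x + y"
      using add[OF \<psi>V(1)[OF x] \<psi>V(1)[OF y]] \<psi>V(2)[OF x] \<psi>V(2)[OF y] by simp
    then show ?thesis using \<psi>\<phi>[OF addV[OF \<psi>V(1)[OF x] \<psi>V(1)[OF y]]] by simp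
  qed
  moreover have "\<psi> (\<lambda>i. c * x i) = (\<lambda>i. c * \<psi> x i)" if x: "x \<in> fvec n" for c x
  proof -
    have "\<phi> (\<lambda>i. c * \<psi> x i) = (\<lambda>i. c * x i)"
      using scale[OF \<psi>V(1)[OF x], of c] \<psi>V(2)[OF x] by simp
    then show ?thesis using \<psi>\<phi>[OF scaleV[OF \<psi>V(1)[OF x], of c]] by simp
  qed
  ultimately obtain Q where Q: "Q \<in> carrier_mat n n" "\<And>v. v \<in> fvec n \<Longrightarrow> vec n (\<psi> v) = Q *\<^sub>v vec n v"
    using linear_map_matrix[of n \<psi>] by blast
  have vecV: "vec n v \<in> carrier_vec n" for v :: "nat \<Rightarrow> 'a" by simp
  have "Q * P = 1\<^sub>m n"
  proof (rule mat_eqI_fvec)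
    fix v :: "nat \<Rightarrow> 'a" assume v: "v \<in> fvec n"
    have "(Q * P) *\<^sub>v vec n v = Q *\<^sub>v vec n (\<phi> v)"
      unfolding P(2)[OF v] by (rule assoc_mult_mat_vec[OF Q(1) P(1) vecV])
    also have "\<dots> = vec n v" unfolding Q(2)[OF \<phi>V[OF v], symmetric] \<psi>\<phi>[OF v] ..
    finally show "(Q * P) *\<^sub>v vec n v = 1\<^sub>m n *\<^sub>v vec n v" by simp
  qed (use P(1) Q(1) in auto)
  moreover have "P * Q = 1\<^sub>m n"
  proof (rule mat_eqI_fvec)
    fix v :: "nat \<Rightarrow> 'a" assume v: "v \<in> fvec n"
    have "(P * Q) *\<^sub>v vec n v = P *\<^sub>v vec n (\<psi> v)"
      unfolding Q(2)[OF v] by (rule assoc_mult_mat_vec[OF P(1) Q(1) vecV])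
    also have "\<dots> = vec n v" unfolding P(2)[OF \<psi>V(1)[OF v], symmetric] \<psi>V(2)[OF v] ..
    finally show "(P * Q) *\<^sub>v vec n v = 1\<^sub>m n *\<^sub>v vec n v" by simp
  qed (use P(1) Q(1) in auto)
  moreover have "P * A = B * P"
  proof (rule mat_eqI_fvec)
    fix v :: "nat \<Rightarrow> 'a" assume v: "v \<in> fvec n"
    have "(P * A) *\<^sub>v vec n v = P *\<^sub>v vec n (act A [:0, 1:] v)"
      unfolding vec_act[OF A] poly_mat_X[OF A] by (rule assoc_mult_mat_vec[OF P(1) A vecV])
    also have "\<dots> = vec n (act B [:0, 1:] (\<phi> v))"
      unfolding P(2)[OF act_fvec[OF A v], symmetric] sc[OF v] ..
    also have "\<dots> = B *\<^sub>v (P *\<^sub>v vec n v)" unfolding vec_act[OF B] poly_mat_X[OF B] P(2)[OF v] ..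
    also have "\<dots> = (B * P) *\<^sub>v vec n v" by (rule assoc_mult_mat_vec[OF B P(1) vecV, symmetric])
    finally show "(P * A) *\<^sub>v vec n v = (B * P) *\<^sub>v vec n v" .
  qed (use P(1) A B in auto)
  then have "Q * B * P = Q * (P * A)" using assoc_mult_mat[OF Q(1) B P(1)] by simp
  then have "Q * B * P = (Q * P) * A" using assoc_mult_mat[OF Q(1) P(1) A] by simp
  ultimately have "similar_mat_wit A B Q P" using A B P(1) Q(1) by (intro similar_mat_witI) auto
  then show ?thesis unfolding similar_mat_def by blast
qed

text \<open>Cayley--Hamilton: column \<open>j\<close> of \<open>xI - A\<close> is a relation between the unit vectors, and
  multiplying by the adjugate turns these relations into the annihilation by the characteristic
  polynomial.\<close>

theorem poly_mat_char_poly: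
  fixes A :: "'a::{field,finite} mat"
  assumes A: "A \<in> carrier_mat n n"
  shows "poly_mat (char_poly A) A = 0\<^sub>m n n"
proof (rule eq_matI)
  interpret poly_module "act A" using act_poly_module[OF A] .
  fix r k assume "r < dim_row (0\<^sub>m n n :: 'a mat)" "k < dim_col (0\<^sub>m n n :: 'a mat)"
  then have rk: "r < n" "k < n" by simp_all
  let ?N = "char_poly_matrix A" and ?e = "unit_fun :: nat \<Rightarrow> nat \<Rightarrow> 'a"
  have N: "?N \<in> carrier_mat n n" using A by simp
  note adj = adj_mat[OF N]
  have prod: "(\<Sum>j<n. ?N $$ (i, j) * adj_mat ?N $$ (j, k)) = (if i = k then char_poly A else 0)"
    if i: "i < n" for i
  proof -
    have "(?N * adj_mat ?N) $$ (i, k) = (\<Sum>j<n. ?N $$ (i, j) * adj_mat ?N $$ (j, k))"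
      using N adj(1) i rk by (simp add: scalar_prod_def lessThan_atLeast0)
    then show ?thesis using i rk unfolding adj(2) by (auto simp: char_poly_def)
  qed
  have col: "(\<Sum>i<n. act A (?N $$ (i, j)) (?e i)) = 0" if j: "j < n" for j
  proof -
    have Nij: "?N $$ (i, j) = (if i = j then [:0, 1:] else 0) + [:- (A $$ (i, j)):]" if "i < n" for i
      using A that j by (auto simp: char_poly_matrix_def)
    have "(\<Sum>i<n. act A (?N $$ (i, j)) (?e i)) =
        (\<Sum>i<n. (if i = j then act A [:0, 1:] (?e i) else 0) + act A [:- (A $$ (i, j)):] (?e i))"
      by (intro sum.cong) (auto simp: Nij scale_left_distrib)
    also have "\<dots> = act A [:0, 1:] (?e j) + (\<Sum>i<n. act A [:- (A $$ (i, j)):] (?e i))"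
      using j by (simp add: sum.distrib)
    also have "\<dots> = 0"
    proof (rule ext)
      fix s
      have sum_app: "(\<Sum>i<m. F i) s = (\<Sum>i<m. F i s)" for F :: "nat \<Rightarrow> nat \<Rightarrow> 'a" and m
        by (induction m) auto
      have "(\<Sum>i<n. - (A $$ (i, j)) * ?e i s) = (\<Sum>i<n. if i = s then - (A $$ (i, j)) else 0)"
        by (intro sum.cong) (auto simp: unit_fun_def)
      also have "\<dots> = (if s < n then - (A $$ (s, j)) else 0)" by simp
      finally have "(act A [:0, 1:] (?e j) + (\<Sum>i<n. act A [:- (A $$ (i, j)):] (?e i))) s =
          act A [:0, 1:] (?e j) s + (if s < n then - (A $$ (s, j)) else 0)"
        by (simp add: sum_app act_const[OF A])
      also have "\<dots> = 0"
      proof (cases "s < n")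
        case True
        then show ?thesis using act_unit_fun[OF A j True, of "[:0, 1:]"] by (simp add: poly_mat_X[OF A])
      next
        case False
        then show ?thesis using act_fvec[OF A unit_fun_fvec[OF j], of "[:0, 1:]"] by (simp add: fvec_def)
      qed
      finally show "(act A [:0, 1:] (?e j) + (\<Sum>i<n. act A [:- (A $$ (i, j)):] (?e i))) s = 0 s" by simp
    qed
    finally show ?thesis .
  qed
  have "act A (char_poly A) (?e k) = (\<Sum>i<n. if i = k then act A (char_poly A) (?e i) else 0)"
    using rk(2) by simp
  also have "\<dots> = (\<Sum>i<n. act A (\<Sum>j<n. ?N $$ (i, j) * adj_mat ?N $$ (j, k)) (?e i))"
    by (intro sum.cong) (auto simp: prod)
  also have "\<dots> = (\<Sum>i<n. \<Sum>j<n. act A (adj_mat ?N $$ (j, k)) (act A (?N $$ (i, j)) (?e i)))"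
    by (intro sum.cong refl) (simp add: scale_sum_left mult.commute)
  \<comment> \<open>Since polynomials commute, the inner sum over the rows \<open>i\<close> becomes
    the column relation \<open>col\<close>.\<close>
  also have "\<dots> = (\<Sum>j<n. act A (adj_mat ?N $$ (j, k)) (\<Sum>i<n. act A (?N $$ (i, j)) (?e i)))"
    by (subst sum.swap) (simp only: scale_sum_right)
  also have "\<dots> = 0" by (simp add: col)
  finally have "act A (char_poly A) (?e k) r = 0" by simp
  then show "poly_mat (char_poly A) A $$ (r, k) = 0\<^sub>m n n $$ (r, k)"
    using act_unit_fun[OF A rk(2,1), of "char_poly A"] rk by simp
qed (use A in auto)

lemma poly_mat_zero_iff:
  fixes A :: "'a::comm_ring_1 mat"
  assumes A: "A \<in> carrier_mat n n"
  shows "poly_mat p A = 0\<^sub>m n n \<longleftrightarrow> (\<forall>v\<in>fvec n. act A p v = 0)"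
proof
  assume *: "poly_mat p A = 0\<^sub>m n n"
  show "\<forall>v\<in>fvec n. act A p v = 0"
    using A by (auto simp: act_def * fvec_def fun_eq_iff)
next
  assume *: "\<forall>v\<in>fvec n. act A p v = 0"
  show "poly_mat p A = 0\<^sub>m n n"
  proof (rule eq_matI)
    fix i j assume "i < dim_row (0\<^sub>m n n :: 'a mat)" "j < dim_col (0\<^sub>m n n :: 'a mat)"
    then have ij: "i < n" "j < n" by simp_all
    have "(unit_fun j :: nat \<Rightarrow> 'a) \<in> fvec n" using ij(2) by (rule unit_fun_fvec)
    then show "poly_mat p A $$ (i, j) = 0\<^sub>m n n $$ (i, j)"
      using act_unit_fun[OF A ij(2,1), of p] * ij by simp
  qed (use A in auto)
qed

text \<open>\<open>p I - p(A)\<close> is divisible by \<open>xI - A\<close>; taking determinants when \<open>p(A) = 0\<close> shows that every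
  prime factor of the characteristic polynomial divides \<open>p\<close>.\<close>

lemma char_poly_dvd_power:
  fixes A :: "'a::field mat"
  assumes A: "A \<in> carrier_mat n n" and p0: "poly_mat p A = 0\<^sub>m n n"
  shows "char_poly A dvd p ^ n"
proof -
  let ?N = "char_poly_matrix A" and ?C = "map_mat (\<lambda>a::'a. [:a:])"
  interpret C: semiring_hom "\<lambda>a::'a. [:a:]"
    by unfold_locales (simp_all add: one_pCons)
  have N: "?N \<in> carrier_mat n n" using A by simp
  \<comment> \<open>Division by xI - A with remainder p(A), in Horner form: the quotient for
    \<open>pCons a p\<close> is x times the quotient \<open>Q\<close> for \<open>p\<close>, plus
    p(A).\<close>
  have "\<exists>Q\<in>carrier_mat n n. p \<cdot>\<^sub>m 1\<^sub>m n = ?N * Q + ?C (poly_mat p A)" for p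
  proof (induction p)
    case 0
    show ?case
      by (rule bexI[of _ "0\<^sub>m n n"]) (use A N in \<open>auto simp: poly_mat_0 right_mult_zero_mat[OF N] intro!: eq_matI\<close>)
  next
    case (pCons a p)
    obtain Q where e: "p \<cdot>\<^sub>m 1\<^sub>m n = ?N * Q + ?C (poly_mat p A)" and Q: "Q \<in> carrier_mat n n"
      using pCons.IH by (elim bexE)
    let ?x = "[:0, 1:] :: 'a poly" and ?P = "poly_mat p A"
    have P: "?P \<in> carrier_mat n n" using A by simp
    have CP: "?C ?P \<in> carrier_mat n n" "?C A \<in> carrier_mat n n" using A P by simp_all
    have comm: "?P * A = A * ?P"
      using poly_mat_mult[OF A, of ?x p] poly_mat_mult[OF A, of p ?x]
      by (simp only: poly_mat_X[OF A] mult.commute[of p])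
    have xI: "?x \<cdot>\<^sub>m 1\<^sub>m n = ?N + ?C A"
      by (rule eq_matI) (use A in \<open>auto simp: char_poly_matrix_def\<close>)
    have "?x \<cdot>\<^sub>m ?C ?P = (?x \<cdot>\<^sub>m 1\<^sub>m n) * ?C ?P"
      using mult_smult_assoc_mat[OF one_carrier_mat CP(1), of ?x] unfolding left_mult_one_mat[OF CP(1)]
      by (rule sym)
    also have "\<dots> = ?N * ?C ?P + ?C A * ?C ?P"
      unfolding xI by (rule add_mult_distrib_mat[OF N CP(2,1)])
    also have "?C A * ?C ?P = ?C (?P * A)" unfolding comm using C.mat_hom_mult[OF A P] by simp
    finally have xC: "?x \<cdot>\<^sub>m ?C ?P = ?N * ?C ?P + ?C (?P * A)" .
    have rearrange: "U + V + (W + Z) = W + (U + (V + Z))"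
      if "U \<in> carrier_mat n n" "V \<in> carrier_mat n n" "W \<in> carrier_mat n n" "Z \<in> carrier_mat n n"
      for U V W Z :: "'a poly mat"
      by (rule eq_matI) (use that in auto)
    have smult_add: "c \<cdot>\<^sub>m U + c \<cdot>\<^sub>m V = c \<cdot>\<^sub>m (U + V)"
      if "U \<in> carrier_mat n n" "V \<in> carrier_mat n n" for c and U V :: "'a poly mat"
      by (rule eq_matI) (use that in \<open>auto simp: ring_distribs\<close>)
    have NQ: "?N * Q \<in> carrier_mat n n" "?N * ?C ?P \<in> carrier_mat n n" "?C (?P * A) \<in> carrier_mat n n"
      by (rule mult_carrier_mat[OF N Q], rule mult_carrier_mat[OF N CP(1)],
          simp only: map_carrier_mat mult_carrier_mat[OF P A])
    have E: "?C (poly_mat (pCons a p) A) = [:a:] \<cdot>\<^sub>m 1\<^sub>m n + ?C (?P * A)"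
      unfolding poly_mat_pCons[OF A] by (rule eq_matI) (use A P in auto)
    have "?N * (?x \<cdot>\<^sub>m Q + ?C ?P) + ?C (poly_mat (pCons a p) A) =
        ?N * (?x \<cdot>\<^sub>m Q) + ?N * ?C ?P + ([:a:] \<cdot>\<^sub>m 1\<^sub>m n + ?C (?P * A))"
      unfolding E
      using mult_add_distrib_mat[OF N _ CP(1), of "?x \<cdot>\<^sub>m Q"] Q by simp
    also have "?N * (?x \<cdot>\<^sub>m Q) = ?x \<cdot>\<^sub>m (?N * Q)" by (rule mult_smult_distrib[OF N Q])
    also have "?x \<cdot>\<^sub>m (?N * Q) + ?N * ?C ?P + ([:a:] \<cdot>\<^sub>m 1\<^sub>m n + ?C (?P * A)) =
        [:a:] \<cdot>\<^sub>m 1\<^sub>m n + (?x \<cdot>\<^sub>m (?N * Q) + (?N * ?C ?P + ?C (?P * A)))"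
      by (rule rearrange) (use NQ in simp_all)
    also have "\<dots> = [:a:] \<cdot>\<^sub>m 1\<^sub>m n + ?x \<cdot>\<^sub>m (p \<cdot>\<^sub>m 1\<^sub>m n)"
      unfolding xC[symmetric] e smult_add[OF NQ(1) CP(1)] ..
    also have "\<dots> = pCons a p \<cdot>\<^sub>m 1\<^sub>m n" by (rule eq_matI) auto
    finally have "pCons a p \<cdot>\<^sub>m 1\<^sub>m n = ?N * (?x \<cdot>\<^sub>m Q + ?C ?P) + ?C (poly_mat (pCons a p) A)"
      by (rule sym)
    moreover have "?x \<cdot>\<^sub>m Q + ?C ?P \<in> carrier_mat n n" using CP(1) by (rule add_carrier_mat)
    ultimately show ?case by (rule bexI)
  qed
  from this[of p] obtain Q where e: "p \<cdot>\<^sub>m 1\<^sub>m n = ?N * Q + ?C (poly_mat p A)" and Q: "Q \<in> carrier_mat n n"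
    by (elim bexE)
  have "p \<cdot>\<^sub>m 1\<^sub>m n = ?N * Q" unfolding e p0 using N Q by (intro eq_matI) auto
  then have "det (p \<cdot>\<^sub>m 1\<^sub>m n) = det ?N * det Q" using det_mult[OF N Q] by simp
  then have "p ^ n = char_poly A * det Q" by (simp add: char_poly_def)
  then show ?thesis by simp
qed

text \<open>If \<open>f\<close> kills a nonzero vector but is prime to the characteristic
  polynomial, Bezout and Cayley--Hamilton make the vector vanish. Conversely, if \<open>f\<close>
  acts injectively, its powers cancel from \<open>char_poly A = f ^ k * u\<close>, so u(A) = 0; then
  every prime factor of the characteristic polynomial divides \<open>u\<close>, in particular
  \<open>f\<close>, a contradiction.\<close>

theorem irreducible_dvd_char_poly_iff:
  fixes A :: "'a::{field,finite} mat"
  assumes A: "A \<in> carrier_mat n n" and f: "irreducible f"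
  shows "f dvd char_poly A \<longleftrightarrow> mat_kern A f \<noteq> {0}"
proof -
  interpret poly_module "act A" using act_poly_module[OF A] .
  have dim: "dim_row A = n" using A by auto
  have zero: "0 \<in> mat_kern A h" for h using mat_kern_iff[OF A] by (simp add: fvec_def)
  have CH: "act A (char_poly A) v = 0" if "v \<in> fvec n" for v
    using poly_mat_char_poly[OF A] poly_mat_zero_iff[OF A] that by blast
  show ?thesis
  proof
    assume "mat_kern A f \<noteq> {0}"
    then obtain v where "v \<noteq> 0" "v \<in> mat_kern A f" using zero[of f] by blast
    then have v: "v \<noteq> 0" "v \<in> fvec n" "act A (f ^ 1) v = 0" using mat_kern_iff[OF A] by simp_all
    show "f dvd char_poly A"
    proof (rule ccontr)
      assume "\<not> f dvd char_poly A"
      then have "v = 0" by (rule irreducible_kernel_disjoint[OF f _ v(3) CH[OF v(2)]])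
      then show False using v(1) by simp
    qed
  next
    assume dvd: "f dvd char_poly A"
    show "mat_kern A f \<noteq> {0}"
    proof
      assume triv: "mat_kern A f = {0}"
      have "char_poly A \<noteq> 0" using degree_monic_char_poly[OF A] by auto
      then obtain k u where u: "char_poly A = f ^ k * u" "\<not> f dvd u" using extract_power[OF _ f] by blast
      have inj: "w = 0" if "w \<in> fvec n" "act A (f ^ i) w = 0" for w i
        using that
      proof (induction i)
        case (Suc i)
        have "act A (f ^ i) w \<in> mat_kern A f"
          using Suc.prems(2) act_fvec[OF A Suc.prems(1)] mat_kern_iff[OF A] by (simp add: zero_fun_def)
        then have "act A (f ^ i) w = 0" unfolding triv by simp
        then show ?case using Suc by simp
      qed simp
      have "act A u v = 0" if v: "v \<in> fvec n" for v
      proof (rule inj)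
        show "act A u v \<in> fvec n" by (rule act_fvec[OF A v])
        show "act A (f ^ k) (act A u v) = 0" using CH[OF v] u(1) by simp
      qed
      then have "poly_mat u A = 0\<^sub>m n n" using poly_mat_zero_iff[OF A, of u] by simp
      then have "f dvd u ^ n" by (rule dvd_trans[OF dvd char_poly_dvd_power[OF A]])
      then have "f dvd u" by (rule prime_elem_dvd_power[OF field_poly_irreducible_imp_prime[OF f]])
      then show False using u(2) by contradiction
    qed
  qed
qed

section \<open>Simple roots of polynomial compositions\<close>

text \<open>Evaluation in the algebraic closure makes the fields K[x]/(f), for different
  \<open>f\<close>, subfields of one field, where they can be compared as sets.\<close>

definition ac_eval :: "'a::field alg_closure \<Rightarrow> 'a poly \<Rightarrow> 'a alg_closure" where
  "ac_eval \<alpha> p = poly (map_poly to_ac p) \<alpha>"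

lemma ac_eval_0 [simp]: "ac_eval \<alpha> 0 = 0"
  by (simp add: ac_eval_def)

lemma ac_eval_pCons [simp]: "ac_eval \<alpha> (pCons a p) = to_ac a + \<alpha> * ac_eval \<alpha> p"
  by (cases "a = 0 \<and> p = 0") (auto simp: ac_eval_def map_poly_pCons)

lemma ac_eval_add: "ac_eval \<alpha> (p + q) = ac_eval \<alpha> p + ac_eval \<alpha> q"
  by (induction p q rule: poly_induct2) (simp_all add: algebra_simps)

lemma ac_eval_smult: "ac_eval \<alpha> (Polynomial.smult a p) = to_ac a * ac_eval \<alpha> p"
  by (induction p) (simp_all add: algebra_simps)

lemma ac_eval_mult: "ac_eval \<alpha> (p * q) = ac_eval \<alpha> p * ac_eval \<alpha> q"
  by (induction p) (simp_all add: ac_eval_add ac_eval_smult algebra_simps)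

lemma ac_eval_uminus: "ac_eval \<alpha> (- p) = - ac_eval \<alpha> p"
  using ac_eval_smult[of \<alpha> "-1" p] by simp

lemma ac_eval_diff: "ac_eval \<alpha> (p - q) = ac_eval \<alpha> p - ac_eval \<alpha> q"
  using ac_eval_add[of \<alpha> p "- q"] by (simp add: ac_eval_uminus)

lemma ac_eval_1 [simp]: "ac_eval \<alpha> 1 = 1"
  by (simp add: one_pCons)

lemma ac_eval_power: "ac_eval \<alpha> (p ^ n) = ac_eval \<alpha> p ^ n"
  by (induction n) (simp_all add: ac_eval_mult)

lemma ac_eval_pcompose: "ac_eval \<alpha> (p \<circ>\<^sub>p q) = ac_eval (ac_eval \<alpha> q) p"
  by (induction p) (simp_all add: pcompose_pCons ac_eval_add ac_eval_mult)

lemma ac_eval_eq_0_iff: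
  assumes "irreducible f" "ac_eval \<alpha> f = 0"
  shows "ac_eval \<alpha> p = 0 \<longleftrightarrow> f dvd p"
proof
  assume *: "ac_eval \<alpha> p = 0"
  show "f dvd p"
  proof (rule ccontr)
    assume "\<not> f dvd p"
    then obtain s t where "s * p + t * f = 1" by (rule irreducible_bezout[OF assms(1)])
    then have "ac_eval \<alpha> (s * p + t * f) = 1" by simp
    then show False using * assms(2) by (simp add: ac_eval_add ac_eval_mult)
  qed
next
  assume "f dvd p"
  then obtain r where "p = f * r" by (rule dvdE)
  then show "ac_eval \<alpha> p = 0" using assms(2) by (simp add: ac_eval_mult)
qed

lemma ac_eval_root:
  assumes "irreducible f"
  obtains \<alpha> where "ac_eval \<alpha> f = 0"
proof -
  have "degree (map_poly to_ac f) > 0"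
    using degree_irreducible_pos[OF assms] by (subst degree_map_poly) auto
  then show ?thesis using alg_closed_imp_poly_has_root that unfolding ac_eval_def by blast
qed

text \<open>Multiplication by a nonzero \<open>y\<close> permutes the nonzero elements of
  \<open>S\<close>; comparing the products of all of them gives
  \<open>y ^ (card S - 1) = 1\<close>.\<close>

lemma finite_mult_closed_power_card:
  fixes S :: "'a::idom set"
  assumes "finite S" "0 \<in> S" "\<And>x y. x \<in> S \<Longrightarrow> y \<in> S \<Longrightarrow> x * y \<in> S" and y: "y \<in> S"
  shows "y ^ card S = y"
proof (cases "y = 0")
  case True
  have "card S > 0" using assms(1,2) card_gt_0_iff by blast
  then show ?thesis using True by simp
next
  case False
  let ?T = "S - {0}"
  have inj: "inj_on ((*) y) ?T" using False by (auto simp: inj_on_def)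
  have "(*) y ` ?T \<subseteq> ?T" using assms(3)[OF y] False by auto
  then have img: "(*) y ` ?T = ?T" using assms(1) inj by (intro endo_inj_surj) auto
  have "(\<Prod>z\<in>?T. z) = (\<Prod>z\<in>(*) y ` ?T. z)" unfolding img ..
  also have "\<dots> = (\<Prod>z\<in>?T. y * z)" using inj by (simp add: prod.reindex)
  also have "\<dots> = y ^ card ?T * (\<Prod>z\<in>?T. z)" by (simp add: prod.distrib)
  finally have "y ^ card ?T * (\<Prod>z\<in>?T. z) = 1 * (\<Prod>z\<in>?T. z)" by simp
  moreover have "(\<Prod>z\<in>?T. z) \<noteq> 0" using assms(1) by simp
  ultimately have "y ^ card ?T = 1" by (simp only: mult_cancel_right) simp
  moreover have "card S = Suc (card ?T)" using card_Suc_Diff1[OF assms(1,2)] by (rule sym)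
  ultimately show ?thesis by simp
qed

text \<open>The image of evaluation has q^(deg f) elements and is closed under multiplication, hence
  consists of roots of y^(q^(deg f)) - y, and this polynomial has no further roots. So the image
  depends on the degree of \<open>f\<close> alone.\<close>

lemma range_ac_eval:
  fixes f :: "'a::{field,finite} poly"
  assumes f: "irreducible f" and \<alpha>: "ac_eval \<alpha> f = 0"
  shows "range (ac_eval \<alpha>) = {y. y ^ (CARD('a) ^ degree f) = y}"
proof -
  let ?N = "CARD('a) ^ degree f" and ?S = "range (ac_eval \<alpha>)"
  have f0: "f \<noteq> 0" using f by auto
  have e: "ac_eval \<alpha> p = ac_eval \<alpha> q \<longleftrightarrow> f ^ 1 dvd p - q" for p q
    using ac_eval_eq_0_iff[OF f \<alpha>, of "p - q"] by (simp add: ac_eval_diff)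
  have card: "card ?S = ?N" using card_cyclic_kernel[OF f0 e, of 1] by simp
  then have fin: "finite ?S" using card_ge_0_finite[of ?S] by simp
  have C: "CARD('a) > 1" using card_mono[of UNIV "{0::'a, 1}"] by simp
  have N: "?N > 1" using C degree_irreducible_pos[OF f] by (rule one_less_power)
  let ?Q = "monom 1 ?N + [:0, -1:] :: 'a alg_closure poly"
  have roots: "{y. poly ?Q y = 0} = {y. y ^ ?N = y}" by (auto simp: poly_monom)
  have "degree ?Q = ?N"
    using N degree_add_eq_left[of "[:0, -1:]" "monom 1 ?N :: 'a alg_closure poly"] by (simp add: degree_monom_eq)
  then have Q0: "?Q \<noteq> 0" using N by auto
  show ?thesis
  proof (rule card_seteq)
    show "finite {y :: 'a alg_closure. y ^ ?N = y}" using poly_roots_finite[OF Q0] unfolding roots .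
    show "?S \<subseteq> {y. y ^ ?N = y}"
    proof (rule image_subsetI)
      fix p
      have "ac_eval \<alpha> p ^ card ?S = ac_eval \<alpha> p"
      proof (rule finite_mult_closed_power_card[OF fin])
        show "0 \<in> ?S" using ac_eval_0[of \<alpha>] by (metis rangeI)
        show "x * y \<in> ?S" if "x \<in> ?S" "y \<in> ?S" for x y
        proof -
          obtain p q where "x = ac_eval \<alpha> p" "y = ac_eval \<alpha> q" using \<open>x \<in> ?S\<close> \<open>y \<in> ?S\<close> by auto
          then have "x * y = ac_eval \<alpha> (p * q)" by (simp add: ac_eval_mult)
          then show ?thesis by simp
        qed
      qed simp
      then show "ac_eval \<alpha> p \<in> {y. y ^ ?N = y}" unfolding card by simp
    qed
    show "card {y :: 'a alg_closure. y ^ ?N = y} \<le> card ?S"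
      using card_poly_roots_bound[OF Q0] unfolding roots card \<open>degree ?Q = ?N\<close> .
  qed
qed

lemma irreducible_dvd_power_card_minus:
  fixes f :: "'a::{field,finite} poly"
  assumes f: "irreducible f"
  shows "f dvd p ^ (CARD('a) ^ degree f) - p"
proof -
  obtain \<alpha> where \<alpha>: "ac_eval \<alpha> f = 0" using ac_eval_root[OF f] .
  have "ac_eval \<alpha> p \<in> {y. y ^ (CARD('a) ^ degree f) = y}" unfolding range_ac_eval[OF f \<alpha>, symmetric] by (rule rangeI)
  then have "ac_eval \<alpha> (p ^ (CARD('a) ^ degree f) - p) = 0" by (simp add: ac_eval_diff ac_eval_power)
  then show ?thesis unfolding ac_eval_eq_0_iff[OF f \<alpha>] .
qed

text \<open>A root of \<open>g\<close> and a root of \<open>f\<close> generate the same subfield of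
  the closure, so the former is a polynomial \<open>p\<close> in the latter.\<close>

lemma dvd_pcompose_same_degree:
  fixes f g :: "'a::{field,finite} poly"
  assumes f: "irreducible f" and g: "irreducible g" and deg: "degree f = degree g"
  obtains p where "f dvd g \<circ>\<^sub>p p"
proof -
  obtain \<alpha> where \<alpha>: "ac_eval \<alpha> f = 0" using ac_eval_root[OF f] .
  obtain \<beta> where \<beta>: "ac_eval \<beta> g = 0" using ac_eval_root[OF g] .
  have "\<beta> = ac_eval \<beta> [:0, 1:]" by simp
  then have "\<beta> \<in> range (ac_eval \<beta>)" by (rule range_eqI)
  then have "\<beta> \<in> range (ac_eval \<alpha>)" unfolding range_ac_eval[OF f \<alpha>] range_ac_eval[OF g \<beta>] deg .
  then obtain p where "\<beta> = ac_eval \<alpha> p" by (rule rangeE)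
  then have "ac_eval \<alpha> (g \<circ>\<^sub>p p) = 0" using \<beta> by (simp add: ac_eval_pcompose)
  then show ?thesis using that ac_eval_eq_0_iff[OF f \<alpha>] by blast
qed

section \<open>Derivatives and exact divisibility\<close>

lemma dvd_pcompose_diff:
  fixes q :: "'a::comm_ring_1 poly"
  assumes "q dvd a - b"
  shows "q dvd g \<circ>\<^sub>p a - g \<circ>\<^sub>p b"
proof (induction g)
  case (pCons c g)
  have "pCons c g \<circ>\<^sub>p a - pCons c g \<circ>\<^sub>p b = (a - b) * (g \<circ>\<^sub>p a) + b * (g \<circ>\<^sub>p a - g \<circ>\<^sub>p b)"
    by (simp add: pcompose_pCons algebra_simps)
  then show ?case using assms pCons.IH by simp
qed simp

lemma pcompose_power:
  fixes p q :: "'a::comm_semiring_1 poly"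
  shows "(p ^ n) \<circ>\<^sub>p q = (p \<circ>\<^sub>p q) ^ n"
  by (induction n) (simp_all add: pcompose_mult pcompose_1)

text \<open>Translation by 1 permutes the ring, so the sum over all elements equals itself plus
  \<open>of_nat CARD('a)\<close>.\<close>

lemma of_nat_card_eq_0: "of_nat CARD('a) = (0 :: 'a::{ring_1,finite})"
proof -
  have "(\<Sum>x::'a\<in>UNIV. x) = (\<Sum>x\<in>(\<lambda>x. x + 1) ` UNIV. x)"
    using surj_plus_right[of "1::'a"] by (simp add: add.commute)
  also have "\<dots> = (\<Sum>x::'a\<in>UNIV. x + 1)" by (subst sum.reindex) (auto simp: inj_on_def)
  also have "\<dots> = (\<Sum>x::'a\<in>UNIV. x) + of_nat CARD('a)" by (simp add: sum.distrib)
  finally show ?thesis by simp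
qed

text \<open>As \<open>d > 0\<close>, the exponent vanishes in the field, so the power has derivative
  0.\<close>

lemma pderiv_power_card_minus:
  fixes p :: "'a::{field,finite} poly"
  assumes "d > 0"
  shows "pderiv (p ^ (CARD('a) ^ d) - p) = - pderiv p"
proof -
  have "of_nat (CARD('a) ^ d) = (0 :: 'a)" using assms by (simp add: of_nat_card_eq_0)
  then show ?thesis by (simp add: pderiv_diff pderiv_power)
qed

lemma dvd_pderiv_if_square_dvd:
  fixes f :: "'a::field poly"
  assumes "f ^ 2 dvd u"
  shows "f dvd pderiv u"
proof -
  obtain r where "u = f ^ 2 * r" using assms by (rule dvdE)
  then have "pderiv u = f * (f * pderiv r + pderiv f * r + pderiv f * r)"
    by (simp add: power2_eq_square pderiv_mult algebra_simps)
  then show ?thesis by simp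
qed

text \<open>Separability of irreducibles: with d = deg f, \<open>f\<close> divides X^(q^d) - X,
  whose derivative is -1. By the product rule, \<open>f dvd pderiv f\<close> would make
  \<open>f\<close> a divisor of -1.\<close>

lemma irreducible_not_dvd_pderiv:
  fixes f :: "'a::{field,finite} poly"
  assumes f: "irreducible f"
  shows "\<not> f dvd pderiv f"
proof
  assume *: "f dvd pderiv f"
  obtain h where h: "[:0, 1:] ^ (CARD('a) ^ degree f) - [:0, 1:] = f * h"
    using irreducible_dvd_power_card_minus[OF f] by (rule dvdE)
  have "- 1 = pderiv (f * h)"
    unfolding h[symmetric] pderiv_power_card_minus[OF degree_irreducible_pos[OF f]]
    by (simp add: pderiv_pCons one_pCons)
  also have "\<dots> = f * pderiv h + h * pderiv f" by (simp add: pderiv_mult)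
  finally have "f dvd - 1" using * by simp
  then show False using irreducible_not_unit[OF f] by simp
qed

text \<open>Perturbing a solution \<open>p\<close> of \<open>g(p) = 0\<close> modulo \<open>f\<close> to \<open>p + f\<close> changes the derivative of
  \<open>p ^ (q ^ d) - p\<close>, a multiple of \<open>g(p)\<close>, modulo \<open>f\<close>; so one of the two is a simple solution.\<close>

lemma exactly_dvd_pcompose:
  fixes f g :: "'a::{field,finite} poly"
  assumes f: "irreducible f" and g: "irreducible g" and deg: "degree f = degree g"
  obtains p where "f dvd g \<circ>\<^sub>p p" "\<not> f ^ 2 dvd g \<circ>\<^sub>p p"
proof -
  let ?N = "CARD('a) ^ degree g"
  obtain p where p: "f dvd g \<circ>\<^sub>p p" using dvd_pcompose_same_degree[OF assms] .
  obtain h where h: "[:0, 1:] ^ ?N - [:0, 1:] = g * h"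
    using irreducible_dvd_power_card_minus[OF g] by (rule dvdE)
  \<comment> \<open>Substituting \<open>r\<close> into \<open>h\<close> shows that
    \<open>f ^ 2\<close> divides \<open>r ^ ?N - r\<close>, and the derivative of the latter is
    \<open>- pderiv r\<close>.\<close>
  have pd: "f dvd pderiv r" if "f ^ 2 dvd g \<circ>\<^sub>p r" for r
  proof -
    have "([:0, 1:] ^ ?N - [:0, 1:]) \<circ>\<^sub>p r = r ^ ?N - r"
      by (simp add: pcompose_diff pcompose_power pcompose_pCons)
    then have "r ^ ?N - r = (g \<circ>\<^sub>p r) * (h \<circ>\<^sub>p r)" unfolding h by (simp add: pcompose_mult)
    then have "f ^ 2 dvd r ^ ?N - r" using that by simp
    then have "f dvd pderiv (r ^ ?N - r)" by (rule dvd_pderiv_if_square_dvd)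
    then show ?thesis unfolding pderiv_power_card_minus[OF degree_irreducible_pos[OF g]] by simp
  qed
  have "f dvd g \<circ>\<^sub>p (p + f) - g \<circ>\<^sub>p p" by (rule dvd_pcompose_diff) simp
  then have pf: "f dvd g \<circ>\<^sub>p (p + f)" using p dvd_add[of f "g \<circ>\<^sub>p (p + f) - g \<circ>\<^sub>p p" "g \<circ>\<^sub>p p"] by simp
  show ?thesis
  proof (cases "f ^ 2 dvd g \<circ>\<^sub>p p")
    case False
    then show ?thesis by (rule that[OF p])
  next
    case True
    have "\<not> f ^ 2 dvd g \<circ>\<^sub>p (p + f)"
    proof
      assume "f ^ 2 dvd g \<circ>\<^sub>p (p + f)"
      then have "f dvd pderiv (p + f)" by (rule pd)
      then have "f dvd pderiv f" using dvd_add_right_iff[OF pd[OF True]] unfolding pderiv_add by simp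
      then show False using irreducible_not_dvd_pderiv[OF f] by blast
    qed
    then show ?thesis by (rule that[OF pf])
  qed
qed

section \<open>Chinese remainder theorem for squares of primes\<close>

lemma prime_elem_dvd_prodE:
  assumes "prime_elem p" "finite S" "p dvd prod F S"
  obtains x where "x \<in> S" "p dvd F x"
proof -
  have "\<exists>x\<in>S. p dvd F x" using assms(2,3)
  proof (induction S rule: finite_induct)
    case empty
    then show ?case using assms(1) by (simp add: prime_elem_def)
  next
    case (insert x S)
    then show ?case using prime_elem_dvd_mult_iff[OF assms(1)] by auto
  qed
  then show ?thesis using that by blast
qed

lemma chinese_remainder_squares:
  fixes r :: "'a::field poly \<Rightarrow> 'a poly"
  assumes "finite S" "\<And>f. f \<in> S \<Longrightarrow> irreducible f" "\<And>f. f \<in> S \<Longrightarrow> monic f"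
  shows "\<exists>F. \<forall>f\<in>S. f ^ 2 dvd F - r f"
  using assms
proof (induction S rule: finite_induct)
  case (insert f S)
  then obtain F where F: "\<And>g. g \<in> S \<Longrightarrow> g ^ 2 dvd F - r g" by auto
  have f: "irreducible f" "monic f" using insert.prems by auto
  let ?M = "\<Prod>g\<in>S. g ^ 2"
  have "\<not> f dvd ?M"
  proof
    assume "f dvd ?M"
    then obtain g where g: "g \<in> S" "f dvd g ^ 2"
      using prime_elem_dvd_prodE[OF field_poly_irreducible_imp_prime[OF f(1)] insert.hyps(1)] by metis
    then have "f dvd g" using prime_elem_dvd_power[OF field_poly_irreducible_imp_prime[OF f(1)]] by blast
    then have "f = g" using monic_irreducible_dvd_eq f g(1) insert.prems by blast
    then show False using g(1) insert.hyps(2) by simp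
  qed
  then obtain s t where st: "s * ?M + t * f ^ 2 = 1" using irreducible_power_bezout[OF f(1)] by blast
  \<comment> \<open>\<open>s * ?M\<close> is 1 modulo \<open>f ^ 2\<close> and 0 modulo every
    earlier \<open>g ^ 2\<close>, so the correction repairs the new congruence and leaves the old
    ones intact.\<close>
  let ?F = "F + ?M * (s * (r f - F))"
  have "?F - r f = (r f - F) * (s * ?M + t * f ^ 2) - (r f - F) - t * f ^ 2 * (r f - F)"
    by (simp add: algebra_simps)
  also have "\<dots> = f ^ 2 * (- t * (r f - F))" unfolding st by (simp add: algebra_simps)
  finally have "f ^ 2 dvd ?F - r f" by (metis dvd_triv_left)
  moreover have "g ^ 2 dvd ?F - r g" if g: "g \<in> S" for g
  proof -
    have "g ^ 2 dvd ?M" using insert.hyps(1) g by (rule dvd_prodI)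
    then have "g ^ 2 dvd (F - r g) + ?M * (s * (r f - F))" using F[OF g] by (intro dvd_add dvd_mult2)
    then show ?thesis by (simp add: algebra_simps)
  qed
  ultimately show ?case by blast
qed simp

section \<open>Class types of polynomials in a matrix\<close>

text \<open>Substituting \<open>F\<close> into a Bezout identity for \<open>g'\<close> and
  \<open>g\<close> would make \<open>f\<close> a unit. Thus \<open>f\<close> divides the composite
  with \<open>F\<close> of at most one monic prime.\<close>

lemma dvd_pcompose_coprime:
  fixes f g g' :: "'a::field poly"
  assumes "irreducible f" "irreducible g" "\<not> g dvd g'" "f dvd g \<circ>\<^sub>p F" "f dvd g' \<circ>\<^sub>p F"
  shows False
proof -
  obtain s t where "s * g' + t * g = 1" using irreducible_bezout[OF assms(2,3)] .
  then have "(s * g' + t * g) \<circ>\<^sub>p F = 1" by (simp add: pcompose_1)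
  then have "(s \<circ>\<^sub>p F) * (g' \<circ>\<^sub>p F) + (t \<circ>\<^sub>p F) * (g \<circ>\<^sub>p F) = 1"
    by (simp add: pcompose_add pcompose_mult)
  moreover have "f dvd (s \<circ>\<^sub>p F) * (g' \<circ>\<^sub>p F) + (t \<circ>\<^sub>p F) * (g \<circ>\<^sub>p F)"
    by (intro dvd_add dvd_mult assms)
  ultimately show False using irreducible_not_unit[OF assms(1)] by simp
qed

text \<open>A prime dividing the composite of a product divides the composite of one of its factors;
  induction on the degree.\<close>

lemma dvd_pcompose_factor:
  fixes f p :: "'a::field poly"
  assumes f: "irreducible f" and "p \<noteq> 0" "f dvd p \<circ>\<^sub>p F"
  shows "\<exists>g. irreducible g \<and> monic g \<and> g dvd p \<and> f dvd g \<circ>\<^sub>p F"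
  using assms(2,3)
proof (induction "degree p" arbitrary: p rule: less_induct)
  case less
  show ?case
  proof (cases "is_unit p")
    case True
    then have "degree p = 0" using is_unit_iff_degree[OF less.prems(1)] by simp
    then obtain c where c: "p = [:c:]" by (rule degree_eq_zeroE)
    have "c \<noteq> 0" using less.prems(1) c by simp
    have "f dvd [:c:]" using less.prems(2) unfolding c by simp
    moreover have "is_unit [:c:]" using \<open>c \<noteq> 0\<close> is_unit_iff_degree[of "[:c:]"] by simp
    ultimately have "is_unit f" by (rule dvd_unit_imp_unit)
    then show ?thesis using irreducible_not_unit[OF f] by contradiction
  next
    case False
    obtain g where g: "irreducible g" "monic g" "g dvd p"
      using exists_irreducible_factor[OF less.prems(1) False] .
    then obtain r where r: "p = g * r" by (elim dvdE)
    have r0: "r \<noteq> 0" using less.prems(1) unfolding r by (metis mult_zero_right)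
    have "f dvd (g \<circ>\<^sub>p F) * (r \<circ>\<^sub>p F)" using less.prems(2) unfolding r pcompose_mult .
    then consider "f dvd g \<circ>\<^sub>p F" | "f dvd r \<circ>\<^sub>p F"
      using prime_elem_dvd_mult_iff[OF field_poly_irreducible_imp_prime[OF f]] by blast
    then show ?thesis
    proof cases
      case 2
      have "degree r < degree p"
        using degree_irreducible_pos[OF g(1)] less.prems(1) unfolding r by (subst degree_mult_eq) auto
      then show ?thesis using less.hyps[OF _ r0 2] dvd_mult unfolding r by blast
    qed (use g in blast)
  qed
qed

text \<open>Turns equality of class types into a matching of the prime factors that preserves degree
  and partition.\<close>

lemma image_mset_eq_bij:
  assumes "finite S" "finite T" "image_mset a (mset_set S) = image_mset b (mset_set T)"
  shows "\<exists>\<sigma>. bij_betw \<sigma> S T \<and> (\<forall>x\<in>S. b (\<sigma> x) = a x)"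
  using assms
proof (induction S arbitrary: T rule: finite_induct)
  case empty
  then have "T = {}" by (simp add: mset_set_empty_iff)
  then show ?case by (auto simp: bij_betw_def)
next
  case (insert x S)
  have "a x \<in># image_mset b (mset_set T)" using insert.hyps insert.prems(2)[symmetric] by simp
  then obtain y where y: "y \<in> T" "b y = a x" using insert.prems(1) by auto
  have "mset_set T = add_mset y (mset_set (T - {y}))"
    using y(1) insert.prems(1) by (simp add: mset_set.remove)
  then have "image_mset a (mset_set S) = image_mset b (mset_set (T - {y}))"
    using insert.hyps insert.prems(2) y(2) by simp
  then obtain \<sigma> where \<sigma>: "bij_betw \<sigma> S (T - {y})" "\<And>z. z \<in> S \<Longrightarrow> b (\<sigma> z) = a z"
    using insert.IH[of "T - {y}"] insert.prems(1) by auto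
  let ?\<tau> = "\<sigma>(x := y)"
  have "bij_betw ?\<tau> S (T - {y})"
    using \<sigma>(1) insert.hyps(2) by (subst bij_betw_cong[of S ?\<tau> \<sigma>]) auto
  then have "bij_betw ?\<tau> (S \<union> {x}) (T - {y} \<union> {y})"
    using notIn_Un_bij_betw3[of x S ?\<tau> "T - {y}"] insert.hyps(2) by simp
  moreover have "S \<union> {x} = insert x S" "T - {y} \<union> {y} = T" using y(1) by auto
  ultimately have "bij_betw ?\<tau> (insert x S) T" by simp
  moreover have "\<forall>z\<in>insert x S. b (?\<tau> z) = a z" using \<sigma>(2) y(2) by auto
  ultimately show ?case by blast
qed

definition char_factors :: "'a::field mat \<Rightarrow> 'a poly set" where
  "char_factors A = {f. monic f \<and> irreducible f \<and> f dvd char_poly A}"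

lemma finite_char_factors:
  fixes A :: "'a::{field,finite} mat"
  assumes "A \<in> carrier_mat n n"
  shows "finite (char_factors A)"
proof -
  have "inj_on (\<lambda>f. (f, primary_partition A f)) (char_factors A)" by (auto simp: inj_on_def)
  then show ?thesis
    using finite_imageD finite_cycle_type[OF assms] unfolding cycle_type_def char_factors_def by blast
qed

text \<open>Pairing a prime with its partition is injective, so the multiset can be indexed by the
  primes themselves.\<close>

lemma class_type_alt:
  "class_type A = image_mset (\<lambda>f. (degree f, primary_partition A f)) (mset_set (char_factors A))"
proof -
  have "mset_set ((\<lambda>f. (f, primary_partition A f)) ` char_factors A) =
      image_mset (\<lambda>f. (f, primary_partition A f)) (mset_set (char_factors A))"
    by (rule image_mset_mset_set[symmetric]) (auto simp: inj_on_def)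
  then show ?thesis
    unfolding class_type_def cycle_type_def char_factors_def[symmetric]
    by (simp add: multiset.map_comp comp_def)
qed

lemma char_factors_kern:
  fixes A :: "'a::{field,finite} mat"
  assumes A: "A \<in> carrier_mat n n" and f: "f \<in> char_factors A"
  obtains v where "v \<noteq> 0" "v \<in> fvec n" "act A f v = 0"
proof -
  have "mat_kern A f \<noteq> {0}"
    using irreducible_dvd_char_poly_iff[OF A] f unfolding char_factors_def by blast
  moreover have "0 \<in> mat_kern A f"
    using poly_module.kern_subspace[OF act_poly_module[OF A] fvec_subspace[OF A], of f]
      Modules.module.subspace_0[OF poly_module.axioms[OF act_poly_module[OF A]]] A by auto
  ultimately obtain v where "v \<noteq> 0" "v \<in> mat_kern A f" by blast
  then show ?thesis using that mat_kern_iff[OF A] by blast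
qed

lemma act_char_poly:
  fixes A :: "'a::{field,finite} mat"
  assumes "A \<in> carrier_mat n n" "v \<in> fvec n"
  shows "act A (char_poly A) v = 0"
  using poly_mat_zero_iff[OF assms(1)] poly_mat_char_poly[OF assms(1)] assms(2) by blast

lemma char_poly_nonzero: "(A :: 'a::field mat) \<in> carrier_mat n n \<Longrightarrow> char_poly A \<noteq> 0"
  using degree_monic_char_poly[of A n] by auto

text \<open>A nonzero vector killed by \<open>u ^ j\<close> has a nonzero multiple killed by a prime
  factor of the characteristic polynomial; that prime does not divide \<open>u ^ j\<close>, so the
  multiple would vanish.\<close>

lemma act_injective:
  fixes A :: "'a::{field,finite} mat"
  assumes A: "A \<in> carrier_mat n n" and u: "\<And>f. f \<in> char_factors A \<Longrightarrow> \<not> f dvd u"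
    and v: "v \<in> fvec n" "act A (u ^ j) v = 0"
  shows "v = 0"
proof (rule ccontr)
  interpret poly_module "act A" using act_poly_module[OF A] .
  assume "v \<noteq> 0"
  then obtain f r where f: "irreducible f" "monic f" "f dvd char_poly A"
    and w: "act A r v \<noteq> 0" "act A f (act A r v) = 0"
    using irreducible_torsion[OF act_char_poly[OF A v(1)] char_poly_nonzero[OF A]] by metis
  have "\<not> f dvd u" using u f unfolding char_factors_def by blast
  then have "\<not> f dvd u ^ j"
    using prime_elem_dvd_power[OF field_poly_irreducible_imp_prime[OF f(1)]] by blast
  moreover have "act A (f ^ 1) (act A r v) = 0" using w(2) by (simp only: power_one_right)
  moreover have "act A (u ^ j) (act A r v) = 0" by (rule annihilates_multiple[OF v(2)])
  ultimately have "act A r v = 0" by (rule irreducible_kernel_disjoint[OF f(1)])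
  then show False using w(1) by contradiction
qed

text \<open>\<open>u\<close> acts injectively, so its power can be cancelled.\<close>

lemma mat_kern_eq_if_exactly_dvd:
  fixes A :: "'a::{field,finite} mat"
  assumes A: "A \<in> carrier_mat n n" and u: "\<And>f. f \<in> char_factors A \<Longrightarrow> \<not> f dvd u"
  shows "mat_kern A ((f * u) ^ j) = mat_kern A (f ^ j)"
proof -
  interpret poly_module "act A" using act_poly_module[OF A] .
  have "act A ((f * u) ^ j) v = 0 \<longleftrightarrow> act A (f ^ j) v = 0" if v: "v \<in> fvec n" for v
  proof
    assume "act A ((f * u) ^ j) v = 0"
    then have z: "act A (u ^ j) (act A (f ^ j) v) = 0" by (simp add: power_mult_distrib mult.commute)
    show "act A (f ^ j) v = 0"
    proof (rule act_injective[OF A])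
      show "\<not> h dvd u" if "h \<in> char_factors A" for h by (rule u[OF that])
      show "act A (f ^ j) v \<in> fvec n" by (rule act_fvec[OF A v])
    qed (rule z)
  next
    assume "act A (f ^ j) v = 0"
    then have "act A (f ^ j) (act A (u ^ j) v) = 0" by (rule annihilates_multiple)
    then show "act A ((f * u) ^ j) v = 0" by (simp add: power_mult_distrib)
  qed
  then show ?thesis using mat_kern_iff[OF A] by (intro Set.set_eqI) metis
qed

lemma mat_kern_poly_mat:
  fixes A :: "'a::{field,finite} mat"
  assumes A: "A \<in> carrier_mat n n"
  shows "mat_kern (poly_mat F A) h = mat_kern A (h \<circ>\<^sub>p F)"
proof -
  have "v \<in> mat_kern (poly_mat F A) h \<longleftrightarrow> v \<in> mat_kern A (h \<circ>\<^sub>p F)" for v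
    unfolding mat_kern_iff[OF A] mat_kern_iff[OF poly_mat_carrier[OF A]]
    by (auto simp: act_pcompose[OF A])
  then show ?thesis by blast
qed

lemma mat_kern_trivial:
  fixes A :: "'a::{field,finite} mat"
  assumes A: "A \<in> carrier_mat n n" and u: "\<And>f. f \<in> char_factors A \<Longrightarrow> \<not> f dvd u"
  shows "mat_kern A (u ^ j) = {0}"
proof -
  have "act A (u ^ j) 0 = 0"
    using Modules.module.scale_zero_right[OF poly_module.axioms[OF act_poly_module[OF A]]] .
  then have "0 \<in> mat_kern A (u ^ j)" unfolding mat_kern_iff[OF A] by (simp add: fvec_def)
  moreover have "v = 0" if "v \<in> mat_kern A (u ^ j)" for v
  proof (rule act_injective[OF A u])
    show "v \<in> fvec n" "act A (u ^ j) v = 0" using that unfolding mat_kern_iff[OF A] by blast+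
  qed
  ultimately show ?thesis by blast
qed

section \<open>From equal class types to a polynomial\<close>

theorem similar_poly_mat_if_class_type_eq:
  fixes A B :: "'a::{field,finite} mat"
  assumes A: "A \<in> carrier_mat n n" and B: "B \<in> carrier_mat n n"
    and eq: "class_type A = class_type B"
  shows "\<exists>F. similar_mat (poly_mat F A) B"
proof -
  let ?S = "char_factors A" and ?T = "char_factors B"
  obtain \<sigma> where bij: "bij_betw \<sigma> ?S ?T"
    and \<sigma>: "\<And>f. f \<in> ?S \<Longrightarrow> degree (\<sigma> f) = degree f \<and> primary_partition B (\<sigma> f) = primary_partition A f"
    using image_mset_eq_bij[OF finite_char_factors[OF A] finite_char_factors[OF B]
      eq[unfolded class_type_alt]] by auto
  have irr: "\<And>f. f \<in> ?S \<Longrightarrow> irreducible f" "\<And>f. f \<in> ?S \<Longrightarrow> monic f"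
    "\<And>g. g \<in> ?T \<Longrightarrow> irreducible g" "\<And>g. g \<in> ?T \<Longrightarrow> monic g"
    unfolding char_factors_def by blast+
  have \<sigma>T: "\<sigma> f \<in> ?T" if "f \<in> ?S" for f using bij_betwE[OF bij] that by blast
  have "\<exists>p. f dvd \<sigma> f \<circ>\<^sub>p p \<and> \<not> f ^ 2 dvd \<sigma> f \<circ>\<^sub>p p" if f: "f \<in> ?S" for f
    using exactly_dvd_pcompose[OF irr(1)[OF f] irr(3)[OF \<sigma>T[OF f]]] \<sigma>[OF f] by metis
  then obtain r where r: "\<And>f. f \<in> ?S \<Longrightarrow> f dvd \<sigma> f \<circ>\<^sub>p r f \<and> \<not> f ^ 2 dvd \<sigma> f \<circ>\<^sub>p r f" by metis
  obtain F where F: "\<And>f. f \<in> ?S \<Longrightarrow> f ^ 2 dvd F - r f"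
    using chinese_remainder_squares[OF finite_char_factors[OF A] irr(1,2)] by blast
  have \<sigma>F: "f dvd \<sigma> f \<circ>\<^sub>p F" "\<not> f ^ 2 dvd \<sigma> f \<circ>\<^sub>p F" if f: "f \<in> ?S" for f
  proof -
    have d: "f ^ 2 dvd \<sigma> f \<circ>\<^sub>p F - \<sigma> f \<circ>\<^sub>p r f" by (rule dvd_pcompose_diff[OF F[OF f]])
    then have "f dvd \<sigma> f \<circ>\<^sub>p F - \<sigma> f \<circ>\<^sub>p r f" by (rule dvd_trans[rotated]) (simp add: power2_eq_square)
    then have "f dvd (\<sigma> f \<circ>\<^sub>p F - \<sigma> f \<circ>\<^sub>p r f) + \<sigma> f \<circ>\<^sub>p r f" using r[OF f] by (intro dvd_add) auto
    then show "f dvd \<sigma> f \<circ>\<^sub>p F" by simp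
    show "\<not> f ^ 2 dvd \<sigma> f \<circ>\<^sub>p F"
    proof
      assume "f ^ 2 dvd \<sigma> f \<circ>\<^sub>p F"
      then have "f ^ 2 dvd \<sigma> f \<circ>\<^sub>p F - (\<sigma> f \<circ>\<^sub>p F - \<sigma> f \<circ>\<^sub>p r f)" using d by (rule dvd_diff)
      then show False using r[OF f] by simp
    qed
  qed
  \<comment> \<open>With exactness and the injectivity of \<open>\<sigma>\<close>, this makes the
    cofactor \<open>u\<close> of \<open>f\<close> in \<open>\<sigma> f \<circ>\<^sub>p F\<close>
    prime to every prime factor of the characteristic polynomial of \<open>A\<close>, so that
    \<open>u\<close> does not affect kernels.\<close>
  have other: "\<not> f dvd g \<circ>\<^sub>p F" if f: "f \<in> ?S" and g: "irreducible g" "monic g" "g \<noteq> \<sigma> f" for f g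
  proof
    assume fg: "f dvd g \<circ>\<^sub>p F"
    have "\<not> \<sigma> f dvd g"
      using monic_irreducible_dvd_eq[OF irr(3)[OF \<sigma>T[OF f]] g(1) irr(4)[OF \<sigma>T[OF f]] g(2)] g(3) by metis
    then show False using dvd_pcompose_coprime[OF irr(1)[OF f] irr(3)[OF \<sigma>T[OF f]] _ \<sigma>F(1)[OF f] fg] by blast
  qed
  have "card (mat_kern (poly_mat F A) (g ^ j)) = card (mat_kern B (g ^ j))"
    if g: "irreducible g" "monic g" for g j
  proof (cases "g \<in> ?T")
    case True
    then have "g \<in> \<sigma> ` ?S" using bij_betw_imp_surj_on[OF bij] by simp
    then obtain f where f: "g = \<sigma> f" "f \<in> ?S" by (rule imageE)
    obtain u where u: "g \<circ>\<^sub>p F = f * u" using \<sigma>F(1)[OF f(2)] unfolding f(1) by (rule dvdE)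
    have nd: "\<not> h dvd u" if h: "h \<in> ?S" for h
    proof (cases "h = f")
      case True
      show ?thesis
      proof
        assume "h dvd u"
        then have "f ^ 2 dvd f * u" unfolding True power2_eq_square by (rule mult_dvd_mono[OF dvd_refl])
        then show False using \<sigma>F(2)[OF f(2)] u f(1) by simp
      qed
    next
      case False
      then have "g \<noteq> \<sigma> h" using f h bij_betw_imp_inj_on[OF bij] by (auto dest: inj_onD)
      then have "\<not> h dvd g \<circ>\<^sub>p F" by (rule other[OF h g])
      then show ?thesis unfolding u by (meson dvd_mult)
    qed
    have "mat_kern A ((f * u) ^ j) = mat_kern A (f ^ j)"
    proof (rule mat_kern_eq_if_exactly_dvd[OF A])
      show "\<not> h dvd u" if "h \<in> ?S" for h by (rule nd[OF that])
    qed
    then have "mat_kern (poly_mat F A) (g ^ j) = mat_kern A (f ^ j)"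
      unfolding mat_kern_poly_mat[OF A] pcompose_power u .
    then show ?thesis
      using primary_partition_spec(2)[OF A irr(1)[OF f(2)], of j]
        primary_partition_spec(2)[OF B g(1), of j] \<sigma>[OF f(2)] unfolding f(1) by simp
  next
    case False
    \<comment> \<open>Primes outside the matching have trivial kernels on both sides.\<close>
    have "mat_kern (poly_mat F A) (g ^ j) = {0}"
      unfolding mat_kern_poly_mat[OF A] pcompose_power
    proof (rule mat_kern_trivial[OF A])
      fix f assume f: "f \<in> ?S"
      show "\<not> f dvd g \<circ>\<^sub>p F" by (rule other[OF f g]) (use False \<sigma>T[OF f] in auto)
    qed
    moreover have "mat_kern B (g ^ j) = {0}"
    proof (rule mat_kern_trivial[OF B])
      fix f assume "f \<in> ?T"
      then show "\<not> f dvd g" using monic_irreducible_dvd_eq[OF irr(3) g(1) irr(4) g(2)] False by metis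
    qed
    ultimately show ?thesis by simp
  qed
  then have "similar_mat (poly_mat F A) B" by (rule similar_if_equal_kernels[OF poly_mat_carrier[OF A] B])
  then show ?thesis by blast
qed

section \<open>From mutual polynomials to equal class types\<close>

lemma char_factor_transfer:
  fixes A :: "'a::{field,finite} mat"
  assumes A: "A \<in> carrier_mat n n" and f: "f \<in> char_factors A"
  shows "\<exists>g\<in>char_factors (poly_mat F A). \<forall>j. mat_kern A (f ^ j) \<subseteq> mat_kern (poly_mat F A) (g ^ j)"
proof -
  interpret poly_module "act A" using act_poly_module[OF A] .
  let ?Y = "poly_mat F A"
  have Y: "?Y \<in> carrier_mat n n" using A by simp
  have irr: "irreducible f" using f unfolding char_factors_def by blast
  obtain v where v: "v \<noteq> 0" "v \<in> fvec n" "act A f v = 0" using char_factors_kern[OF A f] .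
  have z: "act A (char_poly ?Y \<circ>\<^sub>p F) v = 0"
    using act_char_poly[OF Y v(2)] unfolding act_pcompose[OF A v(2)] .
  have v1: "act A (f ^ 1) v = 0" using v(3) by (simp only: power_one_right)
  \<comment> \<open>The nonzero \<open>v\<close> is killed by \<open>f\<close> and, by
    Cayley--Hamilton for \<open>?Y\<close>, also by \<open>char_poly ?Y \<circ>\<^sub>p F\<close>;
    if these were coprime, \<open>v\<close> would be 0.\<close>
  have "f dvd char_poly ?Y \<circ>\<^sub>p F"
  proof (rule ccontr)
    assume "\<not> f dvd char_poly ?Y \<circ>\<^sub>p F"
    then have "v = 0" by (rule irreducible_kernel_disjoint[OF irr _ v1 z])
    then show False using v(1) by contradiction
  qed
  then obtain g where g: "irreducible g" "monic g" "g dvd char_poly ?Y" "f dvd g \<circ>\<^sub>p F"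
    using dvd_pcompose_factor[OF irr char_poly_nonzero[OF Y]] by blast
  have "mat_kern A (f ^ j) \<subseteq> mat_kern ?Y (g ^ j)" for j
  proof
    fix w assume "w \<in> mat_kern A (f ^ j)"
    then have w: "w \<in> fvec n" "act A (f ^ j) w = 0" unfolding mat_kern_iff[OF A] by blast+
    obtain u where u: "(g \<circ>\<^sub>p F) ^ j = f ^ j * u" using dvd_power_same[OF g(4)] by (rule dvdE)
    have "act A (f ^ j * u) w = 0" using annihilates_multiple[OF w(2), of u] by simp
    then show "w \<in> mat_kern ?Y (g ^ j)"
      unfolding mat_kern_poly_mat[OF A] pcompose_power u mat_kern_iff[OF A] using w(1) by blast
  qed
  then show ?thesis using g unfolding char_factors_def by blast
qed

text \<open>Kernels of distinct monic primes meet trivially, while the kernel of a prime factor of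
  the characteristic polynomial is nonzero.\<close>

lemma char_factor_eqI:
  fixes A :: "'a::{field,finite} mat"
  assumes A: "A \<in> carrier_mat n n" and f: "f \<in> char_factors A" and g: "g \<in> char_factors A"
    and sub: "mat_kern A f \<subseteq> mat_kern A g"
  shows "f = g"
proof (rule ccontr)
  interpret poly_module "act A" using act_poly_module[OF A] .
  have irr: "irreducible f" "irreducible g" "monic f" "monic g"
    using f g unfolding char_factors_def by blast+
  assume "f \<noteq> g"
  then have nd: "\<not> f dvd g" using monic_irreducible_dvd_eq[OF irr] by blast
  obtain v where v: "v \<noteq> 0" "v \<in> fvec n" "act A f v = 0" using char_factors_kern[OF A f] .
  have "act A g v = 0" using subsetD[OF sub] v(2,3) unfolding mat_kern_iff[OF A] by blast
  moreover have "act A (f ^ 1) v = 0" using v(3) by (simp only: power_one_right)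
  ultimately have "v = 0" using irreducible_kernel_disjoint[OF irr(1) nd] by blast
  then show False using v(1) by contradiction
qed

text \<open>The cyclic module of \<open>v\<close> is a copy of K[x]/(f).\<close>

lemma card_cyclic_range:
  fixes A :: "'a::{field,finite} mat"
  assumes A: "A \<in> carrier_mat n n" and f: "irreducible f" and v: "v \<noteq> 0" "act A f v = 0"
  shows "card (range (\<lambda>p. act A p v)) = CARD('a) ^ degree f"
proof -
  interpret poly_module "act A" using act_poly_module[OF A] .
  have "has_order v (f ^ Suc 0)" by (rule has_order_power[OF f]) (use v in simp_all)
  then have ord: "act A p v = 0 \<longleftrightarrow> f ^ 1 dvd p" for p unfolding has_order_def by simp
  have "act A p v = act A q v \<longleftrightarrow> f ^ 1 dvd p - q" for p q
    unfolding ord[symmetric] by (simp add: scale_left_diff_distrib)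
  then show ?thesis using card_cyclic_kernel[of f "\<lambda>p. act A p v" 1 1] f by auto
qed

theorem class_type_eq_if_poly_mat_inverse:
  fixes A :: "'a::{field,finite} mat"
  assumes A: "A \<in> carrier_mat n n" and H: "poly_mat H (poly_mat F A) = A"
  shows "class_type A = class_type (poly_mat F A)"
proof -
  let ?Y = "poly_mat F A" and ?S = "char_factors A"
  let ?T = "char_factors ?Y"
  have Y: "?Y \<in> carrier_mat n n" using A by simp
  have match: "\<exists>g\<in>?T. \<forall>j. mat_kern A (f ^ j) = mat_kern ?Y (g ^ j)" if f: "f \<in> ?S" for f
  proof -
    obtain g where g: "g \<in> ?T" "\<And>j. mat_kern A (f ^ j) \<subseteq> mat_kern ?Y (g ^ j)"
      using char_factor_transfer[OF A f] by blast
    obtain f' where f': "f' \<in> ?S" "\<And>j. mat_kern ?Y (g ^ j) \<subseteq> mat_kern A (f' ^ j)"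
      using char_factor_transfer[OF Y g(1), of H] unfolding H by blast
    \<comment> \<open>Going from \<open>A\<close> to \<open>?Y\<close> and back encloses the kernel
      of \<open>g ^ j\<close> between those of \<open>f ^ j\<close> and \<open>f' ^ j\<close>; once
      \<open>f = f'\<close>, the inclusions are equalities for every \<open>j\<close>.\<close>
    have "f = f'"
      by (rule char_factor_eqI[OF A f f'(1)]) (use g(2)[of 1] f'(2)[of 1] in simp)
    then show ?thesis using g f'(2) by blast
  qed
  have match': "\<exists>f\<in>?S. \<forall>j. mat_kern ?Y (g ^ j) = mat_kern A (f ^ j)" if g: "g \<in> ?T" for g
  proof -
    obtain f where f: "f \<in> ?S" "\<And>j. mat_kern ?Y (g ^ j) \<subseteq> mat_kern A (f ^ j)"
      using char_factor_transfer[OF Y g, of H] unfolding H by blast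
    obtain g' where g': "g' \<in> ?T" "\<And>j. mat_kern A (f ^ j) = mat_kern ?Y (g' ^ j)"
      using match[OF f(1)] by blast
    have "g = g'"
      by (rule char_factor_eqI[OF Y g g'(1)]) (use f(2)[of 1] g'(2)[of 1] in simp)
    then show ?thesis using f(1) g'(2) by blast
  qed
  obtain \<sigma> where \<sigma>T: "\<And>f. f \<in> ?S \<Longrightarrow> \<sigma> f \<in> ?T"
    and \<sigma>: "\<And>f j. f \<in> ?S \<Longrightarrow> mat_kern A (f ^ j) = mat_kern ?Y (\<sigma> f ^ j)"
    using match by metis
  have \<sigma>1: "mat_kern A f = mat_kern ?Y (\<sigma> f)" if "f \<in> ?S" for f using \<sigma>[OF that, of 1] by simp
  have inj: "inj_on \<sigma> ?S"
  proof (rule inj_onI)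
    fix f f' assume "f \<in> ?S" "f' \<in> ?S" "\<sigma> f = \<sigma> f'"
    then show "f = f'" using \<sigma>1 by (intro char_factor_eqI[OF A]) auto
  qed
  have img: "\<sigma> ` ?S = ?T"
  proof (intro equalityI subsetI)
    fix g assume g: "g \<in> ?T"
    obtain f where f: "f \<in> ?S" "\<And>j. mat_kern ?Y (g ^ j) = mat_kern A (f ^ j)"
      using match'[OF g] by blast
    have "g = \<sigma> f"
      by (rule char_factor_eqI[OF Y g \<sigma>T[OF f(1)]]) (use f(2)[of 1] \<sigma>1[OF f(1)] in simp)
    then show "g \<in> \<sigma> ` ?S" using f(1) by blast
  qed (use \<sigma>T in blast)
  have C: "CARD('a) > 1" using card_mono[of UNIV "{0::'a, 1}"] by simp
  have same: "degree (\<sigma> f) = degree f \<and> primary_partition ?Y (\<sigma> f) = primary_partition A f"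
    if f: "f \<in> ?S" for f
  proof -
    have irr: "irreducible f" "irreducible (\<sigma> f)" using f \<sigma>T[OF f] unfolding char_factors_def by blast+
    obtain v where v: "v \<noteq> 0" "v \<in> fvec n" "act A f v = 0" using char_factors_kern[OF A f] .
    have "v \<in> mat_kern ?Y (\<sigma> f)" unfolding \<sigma>1[OF f, symmetric] mat_kern_iff[OF A] using v by blast
    then have vY: "act ?Y (\<sigma> f) v = 0" unfolding mat_kern_iff[OF Y] by blast
    have "range (\<lambda>p. act A p v) = range (\<lambda>p. act ?Y p v)"
    proof (intro equalityI image_subsetI)
      fix p
      have "act A p v = act ?Y (p \<circ>\<^sub>p H) v" using act_pcompose[OF Y v(2), of H p] unfolding H .
      then show "act A p v \<in> range (\<lambda>p. act ?Y p v)" by (rule range_eqI)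
    next
      fix p show "act ?Y p v \<in> range (\<lambda>p. act A p v)"
        unfolding act_pcompose[OF A v(2)] by (rule rangeI)
    qed
    then have "CARD('a) ^ degree f = CARD('a) ^ degree (\<sigma> f)"
      using card_cyclic_range[OF A irr(1) v(1,3)] card_cyclic_range[OF Y irr(2) v(1) vY] by simp
    then have deg: "degree (\<sigma> f) = degree f" using C by (simp add: power_inject_exp)
    moreover have "primary_partition ?Y (\<sigma> f) = primary_partition A f"
    proof (rule partition_eqI)
      fix j
      have "CARD('a) ^ (degree f * (\<Sum>k\<leftarrow>primary_partition ?Y (\<sigma> f). min j k)) =
          CARD('a) ^ (degree f * (\<Sum>k\<leftarrow>primary_partition A f. min j k))"
        using primary_partition_spec(2)[OF A irr(1), of j] primary_partition_spec(2)[OF Y irr(2), of j]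
          \<sigma>[OF f, of j] deg by simp
      then show "(\<Sum>k\<leftarrow>primary_partition ?Y (\<sigma> f). min j k) = (\<Sum>k\<leftarrow>primary_partition A f. min j k)"
        using C degree_irreducible_pos[OF irr(1)] by (simp add: power_inject_exp)
    qed (use primary_partition_spec(1)[OF A irr(1)] primary_partition_spec(1)[OF Y irr(2)] in simp_all)
    ultimately show ?thesis by blast
  qed
  have "class_type ?Y = image_mset (\<lambda>g. (degree g, primary_partition ?Y g)) (image_mset \<sigma> (mset_set ?S))"
    unfolding class_type_alt img[symmetric] image_mset_mset_set[OF inj] ..
  also have "\<dots> = image_mset (\<lambda>f. (degree f, primary_partition A f)) (mset_set ?S)"
    unfolding multiset.map_comp comp_def
    by (rule image_mset_cong) (use same finite_char_factors[OF A] in auto)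
  finally show ?thesis unfolding class_type_alt by simp
qed

text \<open>By Cayley--Hamilton only remainders modulo the characteristic polynomial matter.\<close>

lemma finite_range_poly_mat:
  fixes A :: "'a::{field,finite} mat"
  assumes A: "A \<in> carrier_mat n n"
  shows "finite (range (\<lambda>p. poly_mat p A))"
proof -
  let ?c = "char_poly A"
  have "poly_mat p A = poly_mat (p mod ?c) A" for p
  proof -
    have "poly_mat p A = poly_mat (p div ?c * ?c + p mod ?c) A" by simp
    also have "\<dots> = poly_mat (p mod ?c) A"
      unfolding poly_mat_add[OF A] poly_mat_mult[OF A] poly_mat_char_poly[OF A]
      using A poly_mat_carrier[OF A, of "p div ?c"] by (subst right_mult_zero_mat) (auto intro!: eq_matI)
    finally show ?thesis .
  qed
  then have "poly_mat p A \<in> (\<lambda>p. poly_mat p A) ` {p. p = 0 \<or> degree p < degree ?c}" for p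
    using degree_mod_less[OF char_poly_nonzero[OF A]] by (intro image_eqI[of _ _ "p mod ?c"]) simp_all
  then show ?thesis by (intro finite_surj[OF card_poly_degree_less(2)] image_subsetI)
qed

text \<open>Conjugation by the similarity witness maps the polynomials in \<open>B\<close> onto
  those in \<open>A\<close>.\<close>

lemma card_range_poly_mat_similar:
  fixes A B :: "'a::{field,finite} mat"
  assumes "similar_mat A B" and A: "A \<in> carrier_mat n n" and B: "B \<in> carrier_mat n n"
  shows "card (range (\<lambda>p. poly_mat p A)) \<le> card (range (\<lambda>p. poly_mat p B))"
proof -
  obtain P Q where w: "similar_mat_wit A B P Q" using assms(1) unfolding similar_mat_def by blast
  have "range (\<lambda>p. poly_mat p A) = (\<lambda>M. P * M * Q) ` range (\<lambda>p. poly_mat p B)"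
    unfolding poly_mat_similar[OF w A] by (simp add: image_image)
  then show ?thesis by (simp only: card_image_le[OF finite_range_poly_mat[OF B]])
qed

theorem class_type_eq_if_mutually_polynomial:
  fixes A B :: "'a::{field,finite} mat"
  assumes A: "A \<in> carrier_mat n n" and B: "B \<in> carrier_mat n n"
    and F: "similar_mat (poly_mat F A) B" and G: "similar_mat (poly_mat G B) A"
  shows "class_type A = class_type B"
proof -
  let ?Y = "poly_mat F A"
  let ?Z = "poly_mat G ?Y"
  let ?K = "\<lambda>M :: 'a mat. range (\<lambda>p. poly_mat p M)"
  have Y: "?Y \<in> carrier_mat n n" using A by simp
  have Z: "?Z \<in> carrier_mat n n" using Y by simp
  obtain P Q where w: "similar_mat_wit ?Y B P Q" using F unfolding similar_mat_def by blast
  note wD = similar_mat_witD2[OF Y w]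
  have "similar_mat ?Z (poly_mat G B)"
    by (rule similar_matI[of _ _ P Q n]) (use wD poly_mat_similar[OF w Y] Z in auto)
  then have "similar_mat ?Z A" using G by (rule similar_mat_trans)
  \<comment> \<open>\<open>?Z\<close> is merely similar to \<open>A\<close>. Yet
    \<open>?K ?Z\<close> lies in \<open>?K ?Y\<close> and \<open>?K ?Y\<close> in
    \<open>?K A\<close>, and \<open>?K A\<close> is no larger than \<open>?K ?Z\<close>; so
    \<open>?K ?Y\<close> is all of \<open>?K A\<close> and contains \<open>A\<close>.\<close>
  then have "card (?K A) \<le> card (?K ?Z)"
    by (rule card_range_poly_mat_similar[OF similar_mat_sym A Z])
  moreover have "?K ?Z \<subseteq> ?K ?Y"
    by (rule image_subsetI, rule range_eqI, rule poly_mat_pcompose[OF Y, symmetric])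
  moreover have YA: "?K ?Y \<subseteq> ?K A"
    by (rule image_subsetI, rule range_eqI, rule poly_mat_pcompose[OF A, symmetric])
  ultimately have "card (?K A) \<le> card (?K ?Y)"
    using card_mono[OF finite_range_poly_mat[OF Y]] le_trans by blast
  then have "?K ?Y = ?K A" using YA finite_range_poly_mat[OF A] by (intro card_seteq) auto
  moreover have "A \<in> ?K A" by (rule range_eqI[of _ _ "[:0, 1:]"]) (simp add: poly_mat_X[OF A])
  ultimately have "A \<in> ?K ?Y" by simp
  then obtain H where "A = poly_mat H ?Y" by (rule rangeE)
  then have "class_type A = class_type ?Y" by (rule class_type_eq_if_poly_mat_inverse[OF A sym])
  then show ?thesis using class_type_similar[OF F] by simp
qed

section \<open>Passage to similarity classes\<close>

lemma similarity_class_representative: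
  assumes "C \<in> similarity_classes n"
  obtains A where "A \<in> C" "A \<in> carrier_mat n n"
    "\<And>B. B \<in> C \<longleftrightarrow> B \<in> carrier_mat n n \<and> similar_mat A B"
proof -
  obtain A where A: "A \<in> carrier_mat n n"
    and C: "C = {(A, B) \<in> carrier_mat n n \<times> carrier_mat n n. similar_mat A B} `` {A}"
    using assms unfolding similarity_classes_def quotient_def by blast
  show ?thesis
  proof (rule that[of A])
    show "A \<in> C" unfolding C using A similar_mat_refl by auto
    show "B \<in> C \<longleftrightarrow> B \<in> carrier_mat n n \<and> similar_mat A B" for B unfolding C using A by auto
  qed (rule A)
qed

text \<open>Evaluation of polynomials commutes with conjugation, so the condition on all members of
  \<open>C\<close> may be tested on one representative.\<close>

lemma polynomial_in_iff:
  assumes C: "\<And>M. M \<in> C \<longleftrightarrow> M \<in> carrier_mat n n \<and> similar_mat A M" and A: "A \<in> carrier_mat n n"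
    and D: "\<And>M. M \<in> D \<longleftrightarrow> M \<in> carrier_mat n n \<and> similar_mat B M"
  shows "D polynomial_in C \<longleftrightarrow> (\<exists>F. similar_mat (poly_mat F A) B)"
proof -
  have "(\<forall>M\<in>C. poly_mat F M \<in> D) \<longleftrightarrow> similar_mat (poly_mat F A) B" for F
  proof
    assume "\<forall>M\<in>C. poly_mat F M \<in> D"
    moreover have "A \<in> C" unfolding C using A similar_mat_refl by blast
    ultimately show "similar_mat (poly_mat F A) B" using D similar_mat_sym by blast
  next
    assume s: "similar_mat (poly_mat F A) B"
    show "\<forall>M\<in>C. poly_mat F M \<in> D"
    proof
      fix M assume "M \<in> C"
      then have M: "M \<in> carrier_mat n n" "similar_mat A M" unfolding C by blast+
      obtain P Q where w: "similar_mat_wit A M P Q" using M(2) unfolding similar_mat_def by blast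
      note wD = similar_mat_witD2[OF A w]
      have "similar_mat (poly_mat F A) (poly_mat F M)"
        by (rule similar_matI[of _ _ P Q n]) (use wD poly_mat_similar[OF w A] A M in auto)
      then have "similar_mat B (poly_mat F M)" using similar_mat_trans[OF similar_mat_sym[OF s]] by blast
      then show "poly_mat F M \<in> D" unfolding D using M(1) by simp
    qed
  qed
  then show ?thesis unfolding polynomial_in_def by blast
qed

theorem theorem2p6:
  fixes C D :: "'a::{field,finite} mat set" and n :: nat
  assumes "C \<in> similarity_classes n" and "D \<in> similarity_classes n"
  shows "class_type_of_class C = class_type_of_class D \<longleftrightarrow>
    D polynomial_in C \<and> C polynomial_in D"
proof -
  obtain A where A: "A \<in> C" "A \<in> carrier_mat n n"
    and C: "\<And>M. M \<in> C \<longleftrightarrow> M \<in> carrier_mat n n \<and> similar_mat A M"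
    using similarity_class_representative[OF assms(1)] by blast
  obtain B where B: "B \<in> D" "B \<in> carrier_mat n n"
    and D: "\<And>M. M \<in> D \<longleftrightarrow> M \<in> carrier_mat n n \<and> similar_mat B M"
    using similarity_class_representative[OF assms(2)] by blast
  show ?thesis
    unfolding class_type_of_class[OF assms(1) A(1)] class_type_of_class[OF assms(2) B(1)]
      polynomial_in_iff[OF C A(2) D] polynomial_in_iff[OF D B(2) C]
    using similar_poly_mat_if_class_type_eq[OF A(2) B(2)] similar_poly_mat_if_class_type_eq[OF B(2) A(2)]
      class_type_eq_if_mutually_polynomial[OF A(2) B(2)] by metis
qed

end
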